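(* Let $n\ge 3$ and $g\ge 0$ be integers. Put $\boldsymbol n:=(0,2^{n-4},2^{n-5},\ldots,2,1,1)\in\mathbb N^{n-1}$ if $n>3$, and $\boldsymbol n:=(0,1)$ if $n=3$. Then the elements $U_{k_2,\ldots,k_n}$ with $\boldsymbol k=(k_2,\ldots,k_n)\in\mathbb N^{n-1}$, $\sum_{i=2}^n i k_i=g$ and $\boldsymbol k\succeq\boldsymbol n$ form a basis of a space of perpetuants of degree $n$ and weight $g$.
   Context: $\mathbb N=\{0,1,2,\ldots\}$. For $n>3$ the tuple $\boldsymbol n$ has entries $0$, then $2^{n-4},2^{n-5},\ldots,2,1$, then a further $1$ (for example $(0,1,1)$ for $n=4$); tuples in $\mathbb N^{n-1}$ are indexed by $2,\ldots,n$. The partial order is $(t_2,\ldots,t_n)\succeq(s_2,\ldots,s_n)$ iff $t_i\ge s_i$ for all $i$. Let $\mathbb C[a]=\mathbb C[a_0,a_1,a_2,\ldots]$ be the polynomial ring in infinitely many variables, bigraded by degree (each $a_i$ has degree $1$) and weight ($a_i$ has weight $i$); $\mathbb C[a]_{n,g}$ is the span of monomials of degree $n$ and weight $g$. Let $\mathbf D=\sum_{i\ge1}a_{i-1}\frac{\partial}{\partial a_i}$. The algebra of $U$-invariants is $S=\ker\mathbf D\subset\mathbb C[a]$; it is bigraded, $S=\bigoplus_{n,g}S_{n,g}$ with $S_{n,g}=S\cap\mathbb C[a]_{n,g}$. Let $I=\bigoplus_{n\ge1,g\ge0}S_{n,g}$ be its maximal homogeneous ideal. Elements of $I^2$ are called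 decomposable. A space of perpetuants is a bigraded subspace of $I$ which is a complement of $I^2$ in $I$; a space of perpetuants of degree $n$ and weight $g$ is a subspace of $S_{n,g}$ which is a complement of $I^2\cap S_{n,g}$ in $S_{n,g}$. The potenziante is $$\pi_{n,g}(\lambda;a)=\sum_{\substack{r_1,\ldots,r_n\in\mathbb N\\ r_1+\cdots+r_n=g}}\lambda_1^{r_1}\cdots\lambda_n^{r_n}\,a_{r_1}\cdots a_{r_n}\in\mathbb C[\lambda_1,\ldots,\lambda_n]\otimes\mathbb C[a]_{n,g}.$$ Let $\bar\lambda_i$ be the image of $\lambda_i$ in $\mathbb C[\lambda_1,\ldots,\lambda_n]/(\lambda_1+\cdots+\lambda_n)$ and $\bar e_i$ the image of the $i$-th elementary symmetric function $e_i(\lambda_1,\ldots,\lambda_n)$. The monomials in $\bar e_2,\ldots,\bar e_n$ are linearly independent, and the elements $U_{k_2,\ldots,k_n}\in\mathbb C[a]_{n,g}$ (for $\sum_i ik_i=g$) are defined as the coefficients in the expansion $$\pi_{n,g}(\bar\lambda_1,\ldots,\bar\lambda_n;a)=\sum_{\substack{k_2,\ldots,k_n\ge0\\ \sum_i ik_i=g}}\bar e_2^{k_2}\cdots\bar e_n^{k_n}\,U_{k_2,\ldots,k_n}.$$ They lie in $S_{n,g}$. *)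

theory Defs
  imports Complex_Main "HOL-Library.Poly_Mapping"
begin

section \<open>Polynomials in variables indexed by the natural numbers\<close>

text \<open>
  A monomial is a finitely supported exponent vector, a polynomial a finitely supported
  family of coefficients. With complex coefficients this is the ring $\mathbb C[a]$; with
  coefficients in that ring again it is $\mathbb C[\lambda] \otimes \mathbb C[a]$.
\<close>

type_synonym monomial = "nat \<Rightarrow>\<^sub>0 nat"

type_synonym 'c mpoly = "monomial \<Rightarrow>\<^sub>0 'c"

type_synonym apoly = "complex mpoly"

definition mvar :: "nat \<Rightarrow> 'c::comm_ring_1 mpoly"
  where "mvar i = Poly_Mapping.single (Poly_Mapping.single i 1) 1"

definition mconst :: "'c::comm_ring_1 \<Rightarrow> 'c mpoly"
  where "mconst c = Poly_Mapping.single 0 c"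

definition mono_degree :: "monomial \<Rightarrow> nat"
  where "mono_degree m = (\<Sum>i\<in>Poly_Mapping.keys m. Poly_Mapping.lookup m i)"

definition mono_weight :: "monomial \<Rightarrow> nat"
  where "mono_weight m = (\<Sum>i\<in>Poly_Mapping.keys m. i * Poly_Mapping.lookup m i)"

definition pscale :: "complex \<Rightarrow> apoly \<Rightarrow> apoly"
  where "pscale c p = mconst c * p"

global_interpretation apoly: vector_space pscale
  defines apoly_span = apoly.span
      and apoly_subspace = apoly.subspace
      and apoly_dependent = apoly.dependent
  by standard
    (simp_all add: pscale_def mconst_def distrib_left distrib_right single_add mult_single
      flip: mult.assoc)

text \<open>The bihomogeneous component $\mathbb C[a]_{n,g}$ of degree $n$ and weight $g$.\<close>

definition apoly_part :: "nat \<Rightarrow> nat \<Rightarrow> apoly set"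
  where "apoly_part n g =
    apoly_span {Poly_Mapping.single m 1 | m. mono_degree m = n \<and> mono_weight m = g}"


section \<open>Invariants, decomposable elements, perpetuants\<close>

definition partial :: "nat \<Rightarrow> apoly \<Rightarrow> apoly"
  where "partial i p = (\<Sum>m\<in>Poly_Mapping.keys p.
    Poly_Mapping.single (m - Poly_Mapping.single i 1)
      (of_nat (Poly_Mapping.lookup m i) * Poly_Mapping.lookup p m))"

text \<open>
  Only finitely many partial derivatives of a polynomial are nonzero; restricting the sum to
  these is what makes it a finite sum.
\<close>

definition deriv_D :: "apoly \<Rightarrow> apoly"
  where "deriv_D p = (\<Sum>i | i \<ge> 1 \<and> partial i p \<noteq> 0. mvar (i - 1) * partial i p)"

definition invariants :: "nat \<Rightarrow> nat \<Rightarrow> apoly set"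
  where "invariants n g = {p \<in> apoly_part n g. deriv_D p = 0}"

definition inv_ideal :: "apoly set"
  where "inv_ideal = apoly_span (\<Union>n\<in>{1..}. \<Union>g. invariants n g)"

definition inv_ideal_sq :: "apoly set"
  where "inv_ideal_sq = apoly_span {p * q | p q. p \<in> inv_ideal \<and> q \<in> inv_ideal}"

definition perpetuant_space :: "nat \<Rightarrow> nat \<Rightarrow> apoly set \<Rightarrow> bool"
  where "perpetuant_space n g P \<longleftrightarrow>
    apoly_subspace P \<and> P \<subseteq> invariants n g \<and>
    P \<inter> (inv_ideal_sq \<inter> invariants n g) = {0} \<and>
    {p + q | p q. p \<in> P \<and> q \<in> inv_ideal_sq \<inter> invariants n g} = invariants n g"


section \<open>The potenziante and the elements U\<close>

text \<open>
  Tuples indexed by $1,\ldots,n$ or $2,\ldots,n$ are functions on the natural numbers that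
  vanish outside the index range, so that distinct functions are distinct tuples. The
  variables $\lambda_i$ are the indeterminates with index $1 \le i \le n$ of
  \<^typ>\<open>apoly mpoly\<close>.
\<close>

definition potenziante :: "nat \<Rightarrow> nat \<Rightarrow> apoly mpoly"
  where "potenziante n g =
    (\<Sum>r | (\<forall>i. i \<notin> {1..n} \<longrightarrow> r i = 0) \<and> (\<Sum>i=1..n. r i) = g.
      (\<Prod>i=1..n. mvar i ^ r i) * mconst (\<Prod>i=1..n. mvar (r i)))"

definition esym :: "nat \<Rightarrow> nat \<Rightarrow> apoly mpoly"
  where "esym n i = (\<Sum>A | A \<subseteq> {1..n} \<and> card A = i. \<Prod>j\<in>A. mvar j)"

text \<open>
  Equality of images in the quotient of $\mathbb C[\lambda_1,\ldots,\lambda_n] \otimes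
  \mathbb C[a]$ by the ideal generated by $\lambda_1+\cdots+\lambda_n$; the cofactor has to
  involve no variables other than $\lambda_1,\ldots,\lambda_n$.
\<close>

definition cong_lambda :: "nat \<Rightarrow> apoly mpoly \<Rightarrow> apoly mpoly \<Rightarrow> bool"
  where "cong_lambda n x y \<longleftrightarrow>
    (\<exists>q. (\<forall>m\<in>Poly_Mapping.keys q. Poly_Mapping.keys m \<subseteq> {1..n}) \<and>
         x - y = (\<Sum>i=1..n. mvar i) * q)"

definition U_index :: "nat \<Rightarrow> nat \<Rightarrow> (nat \<Rightarrow> nat) set"
  where "U_index n g = {k. (\<forall>i. i \<notin> {2..n} \<longrightarrow> k i = 0) \<and> (\<Sum>i=2..n. i * k i) = g}"

text \<open>
  The coefficient family in the expansion of the potenziante, made unique as a total function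
  by letting it vanish off the index set.
\<close>

definition U_elem :: "nat \<Rightarrow> nat \<Rightarrow> (nat \<Rightarrow> nat) \<Rightarrow> apoly"
  where "U_elem n g = (THE u.
    (\<forall>k. k \<notin> U_index n g \<longrightarrow> u k = 0) \<and>
    (\<forall>k\<in>U_index n g. u k \<in> apoly_part n g) \<and>
    cong_lambda n (potenziante n g)
      (\<Sum>k\<in>U_index n g. (\<Prod>i=2..n. esym n i ^ k i) * mconst (u k)))"

text \<open>
  The tuple $(0,2^{n-4},2^{n-5},\ldots,2,1,1)$, indexed by $2,\ldots,n$: the entry at $i$ is
  $2^{n-1-i}$ for $3 \le i \le n-1$. For $n = 3$ this range is empty and the tuple is $(0,1)$.
\<close>

definition min_tuple :: "nat \<Rightarrow> nat \<Rightarrow> nat"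
  where "min_tuple n i =
    (if i = n then 1 else if 3 \<le> i \<and> i < n then 2 ^ (n - 1 - i) else 0)"

definition perpetuant_index :: "nat \<Rightarrow> nat \<Rightarrow> (nat \<Rightarrow> nat) set"
  where "perpetuant_index n g = {k \<in> U_index n g. \<forall>i\<in>{2..n}. k i \<ge> min_tuple n i}"

end

theory Submission
  imports Defs "HOL-Computational_Algebra.Polynomial" "HOL-Combinatorics.Permutations"
begin

text \<open>
Write $H_n$ for the hyperplane $\lambda_1+\cdots+\lambda_n=0$. A linear functional $\phi$ on
$\mathbb C[a]_{n,g}$ gives the symmetric form $\lambda\mapsto\phi(\pi_{n,g}(\lambda;a))$ of degree
$g$, every symmetric form of degree $g$ arises in this way (\<open>symmetric_function_functional\<close>),
and the form determines $\phi$ (\<open>functional_vanishes_on_part\<close>). So $\mathbb C[a]_{n,g}$ is the dual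
space of the symmetric forms, and the statement is proved by computing in that dual picture.

The derivation satisfies $\mathbf D\,\pi_{n,g}=e_1(\lambda)\,\pi_{n,g-1}$ (\<open>deriv_D_pot\<close>), hence the
dual of $S_{n,g}$ consists of the symmetric forms modulo $e_1$, that is, restricted to $H_n$. There
the monomials in $e_2,\ldots,e_n$ are a basis (\<open>symmetric_expansion_on_zero_sum\<close>,
\<open>elem_monos_independent\<close>), and the elements $U_k$ are the basis of $S_{n,g}$ dual to it.

The potenziante of $n$ variables is the product of those of the first $h$ and of the last $n-h$
variables, summed over the weights (\<open>pot_product\<close>). Hence a functional on $S_{n,g}$ kills the
decomposable elements iff its form vanishes at all points of $H_n$ at which, for some $0<h<n$, the
sum $\lambda_1+\cdots+\lambda_h$ is zero. By symmetry the form then vanishes with every sum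
$\lambda_A=\sum_{i\in A}\lambda_i$ over a proper nonempty subset $A$, and, these sums being pairwise
non-proportional on $H_n$ up to passing to complements, it is divisible by
$Q_n=\prod_{1\in A\ne\{1,\ldots,n\}}\lambda_A$. For $n\ge3$ this product is symmetric on $H_n$, so the
perpetuants are dual to $Q_n\cdot\mathbb C[e_2,\ldots,e_n]$ (\<open>divide_by_subset_product\<close>).

It remains to see that the coefficients of $Q_ne^m$ at the monomials $e^k$ with
$k\succeq\boldsymbol n$ form an invertible matrix. For a suitable linear weight on exponents, $Q_n$
contains $e^{\boldsymbol n}$ and all its other monomials are strictly heavier
(\<open>leading_exponent_subset_product\<close>); so the matrix is triangular. The exponent is found by a
recursion: $Q_n=\pm e_nP_n$, where $P_n$ is the product over the subsets of sizes $2,\ldots,n-2$, and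
setting $\lambda_{n+1}=0$ turns $P_{n+1}$ into $\pm e_nP_n^2$. This is where the powers of two come from.
\<close>


abbreviation lookup :: "('a \<Rightarrow>\<^sub>0 'b::zero) \<Rightarrow> 'a \<Rightarrow> 'b" where
  "lookup \<equiv> Poly_Mapping.lookup"

abbreviation keys :: "('a \<Rightarrow>\<^sub>0 'b::zero) \<Rightarrow> 'a set" where
  "keys \<equiv> Poly_Mapping.keys"

abbreviation single :: "'a \<Rightarrow> 'b::zero \<Rightarrow> ('a \<Rightarrow>\<^sub>0 'b)" where
  "single \<equiv> Poly_Mapping.single"


section \<open>Homogeneous polynomial functions\<close>

text \<open>
Polynomial functions of the coordinates $1,\ldots,n$, as a closure of the coordinate functions with
the degree as an index: substitution and division by a linear form become rule inductions. The
zero function has every degree, so that the forms of a fixed degree are a vector space.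
\<close>

inductive homogeneous :: "nat \<Rightarrow> nat \<Rightarrow> ((nat \<Rightarrow> complex) \<Rightarrow> complex) \<Rightarrow> bool" for n where
  zero: "homogeneous n d (\<lambda>x. 0)"
| const: "homogeneous n 0 (\<lambda>x. c)"
| var: "i \<in> {1..n} \<Longrightarrow> homogeneous n 1 (\<lambda>x. x i)"
| add: "homogeneous n d f \<Longrightarrow> homogeneous n d g \<Longrightarrow> homogeneous n d (\<lambda>x. f x + g x)"
| mult: "homogeneous n d f \<Longrightarrow> homogeneous n d' g \<Longrightarrow> homogeneous n (d + d') (\<lambda>x. f x * g x)"

lemma homogeneous_scale: "homogeneous n d f \<Longrightarrow> homogeneous n d (\<lambda>x. c * f x)"
  using homogeneous.mult[OF homogeneous.const[of n c], of d f] by simp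

lemma homogeneous_diff:
  "homogeneous n d f \<Longrightarrow> homogeneous n d g \<Longrightarrow> homogeneous n d (\<lambda>x. f x - g x)"
  using homogeneous.add[OF _ homogeneous_scale[of n d g "-1"], of f] by simp

lemma homogeneous_sum:
  "(\<And>i. i \<in> I \<Longrightarrow> homogeneous n d (f i)) \<Longrightarrow> homogeneous n d (\<lambda>x. \<Sum>i\<in>I. f i x)"
  by (induction I rule: infinite_finite_induct) (auto intro: homogeneous.intros)

lemma homogeneous_prod:
  "(\<And>i. i \<in> I \<Longrightarrow> homogeneous n (d i) (f i)) \<Longrightarrow>
    homogeneous n (\<Sum>i\<in>I. d i) (\<lambda>x. \<Prod>i\<in>I. f i x)"
  by (induction I rule: infinite_finite_induct) (auto intro: homogeneous.intros)

lemma homogeneous_power: "homogeneous n d f \<Longrightarrow> homogeneous n (k * d) (\<lambda>x. f x ^ k)"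
  by (induction k) (auto intro: homogeneous.intros)

lemma homogeneous_subst:
  assumes "homogeneous n d f" and "\<And>i. i \<in> {1..n} \<Longrightarrow> homogeneous n' 1 (\<lambda>x. y x i)"
  shows "homogeneous n' d (\<lambda>x. f (y x))"
  using assms(1)
  by induction (auto intro: homogeneous.intros assms(2) simp del: One_nat_def)

lemma homogeneous_cong:
  assumes "homogeneous n d f" and "\<And>i. i \<in> {1..n} \<Longrightarrow> x i = y i"
  shows "f x = f y"
  using assms(1) by induction (auto intro: assms(2))

lemma homogeneous_at_origin:
  assumes "homogeneous n d f" and "d > 0" and "\<And>i. i \<in> {1..n} \<Longrightarrow> x i = 0"
  shows "f x = 0"
  using assms(1,2) by induction (auto simp: assms(3))

lemma homogeneous_poly_on_line:
  assumes "homogeneous n d f"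
  shows "\<exists>P. \<forall>t. f (\<lambda>i. (1 - t) * x i + t * w i) = poly P t"
  using assms
proof induction
  case (zero d)
  show ?case by (rule exI[of _ 0]) simp
next
  case (const c)
  show ?case by (rule exI[of _ "[:c:]"]) simp
next
  case (var i)
  show ?case by (rule exI[of _ "[:x i, w i - x i:]"]) (simp add: algebra_simps)
next
  case (add d f g)
  then show ?case by (metis poly_add)
next
  case (mult d f d' g)
  then show ?case by (metis poly_mult)
qed

text \<open>
Polynomial functions on a set that contains the line through any two of its points have no zero
divisors: on the line from $x$ to a point where $f$ does not vanish, both factors are
polynomials in one variable.
\<close>

lemma homogeneous_cancel:
  assumes "homogeneous n d f" "homogeneous n d' g"
    and line: "\<And>x w t. x \<in> X \<Longrightarrow> w \<in> X \<Longrightarrow> (\<lambda>i. (1 - t) * x i + t * w i) \<in> X"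
    and zero: "\<And>x. x \<in> X \<Longrightarrow> f x * g x = 0"
    and w: "w \<in> X" "f w \<noteq> 0" and x: "x \<in> X"
  shows "g x = 0"
proof -
  obtain P where P: "\<And>t. f (\<lambda>i. (1 - t) * x i + t * w i) = poly P t"
    using homogeneous_poly_on_line[OF assms(1)] by metis
  obtain Q where Q: "\<And>t. g (\<lambda>i. (1 - t) * x i + t * w i) = poly Q t"
    using homogeneous_poly_on_line[OF assms(2)] by metis
  have "poly (P * Q) t = 0" for t
    using zero[OF line[OF x w(1)], of t] by (simp add: P Q)
  then have "P * Q = 0" using poly_all_0_iff_0 by blast
  moreover have "P \<noteq> 0" using P[of 1] w(2) by auto
  ultimately have "Q = 0" by simp
  then show ?thesis using Q[of 0] by simp
qed

text \<open>
Moving $x$ by $-s(x)v$ changes $f(x)$ by a multiple of $s(x)$. If $s(v)=1$, the moved point is the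
projection of $x$ to $s=0$ along $v$, so that a form vanishing on $s=0$ is divisible by $s$. The
clause for $d=0$ compensates for the truncated subtraction in $d-1$.
\<close>

lemma homogeneous_difference_quotient:
  assumes "homogeneous n d f" and s: "homogeneous n 1 s"
  shows "\<exists>g. homogeneous n (d - 1) g \<and> (d = 0 \<longrightarrow> g = (\<lambda>x. 0)) \<and>
    (\<forall>x. f x - f (\<lambda>i. x i - s x * v i) = s x * g x)"
  using assms(1)
proof induction
  case (zero d)
  show ?case by (rule exI[of _ "\<lambda>x. 0"]) (auto intro: homogeneous.intros)
next
  case (const c)
  show ?case by (rule exI[of _ "\<lambda>x. 0"]) (auto intro: homogeneous.intros)
next
  case (var i)
  show ?case by (rule exI[of _ "\<lambda>x. v i"]) (auto intro: homogeneous.intros)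
next
  case (add d f g)
  then obtain f' g' where
    "homogeneous n (d - 1) f'" "d = 0 \<longrightarrow> f' = (\<lambda>x. 0)"
      "\<forall>x. f x - f (\<lambda>i. x i - s x * v i) = s x * f' x"
    "homogeneous n (d - 1) g'" "d = 0 \<longrightarrow> g' = (\<lambda>x. 0)"
      "\<forall>x. g x - g (\<lambda>i. x i - s x * v i) = s x * g' x" by blast
  then show ?case
    by (intro exI[of _ "\<lambda>x. f' x + g' x"])
      (auto intro: homogeneous.intros simp: distrib_left add_diff_add)
next
  case (mult d f d' g)
  obtain f' where f': "homogeneous n (d - 1) f'" "d = 0 \<longrightarrow> f' = (\<lambda>x. 0)"
      "\<And>x. f x - f (\<lambda>i. x i - s x * v i) = s x * f' x" using mult.IH by blast
  obtain g' where g': "homogeneous n (d' - 1) g'" "d' = 0 \<longrightarrow> g' = (\<lambda>x. 0)"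
      "\<And>x. g x - g (\<lambda>i. x i - s x * v i) = s x * g' x" using mult.IH by blast
  let ?y = "\<lambda>x i. x i - s x * v i"
  have y: "homogeneous n 1 (\<lambda>x. ?y x i)" if "i \<in> {1..n}" for i
    using homogeneous_diff[OF homogeneous.var[OF that] homogeneous_scale[OF s, of "v i"]]
    by (simp add: mult.commute)
  have "homogeneous n (d + d' - 1) (\<lambda>x. f' x * g x)"
  proof (cases "d = 0")
    case False
    then show ?thesis using homogeneous.mult[OF f'(1) mult.hyps(2)] by simp
  qed (use f'(2) in \<open>simp add: homogeneous.zero\<close>)
  moreover have "homogeneous n (d + d' - 1) (\<lambda>x. f (?y x) * g' x)"
  proof (cases "d' = 0")
    case False
    then show ?thesis
      using homogeneous.mult[OF homogeneous_subst[OF mult.hyps(1), of n ?y] g'(1)] y by simp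
  qed (use g'(2) in \<open>simp add: homogeneous.zero\<close>)
  ultimately have "homogeneous n (d + d' - 1) (\<lambda>x. f' x * g x + f (?y x) * g' x)"
    by (rule homogeneous.add)
  moreover have "f x * g x - f (?y x) * g (?y x) = s x * (f' x * g x + f (?y x) * g' x)" for x
  proof -
    have "f x * g x - f (?y x) * g (?y x) = (f x - f (?y x)) * g x + f (?y x) * (g x - g (?y x))"
      by (simp add: algebra_simps)
    then show ?thesis unfolding f'(3) g'(3) by (simp add: algebra_simps)
  qed
  moreover have "d + d' = 0 \<longrightarrow> (\<lambda>x. f' x * g x + f (?y x) * g' x) = (\<lambda>x. 0)"
    using f'(2) g'(2) by simp
  ultimately show ?case by blast
qed

definition linear_subset :: "(nat \<Rightarrow> complex) set \<Rightarrow> bool" where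
  "linear_subset X \<longleftrightarrow> (\<forall>x\<in>X. \<forall>y\<in>X. \<forall>a b. (\<lambda>i. a * x i + b * y i) \<in> X)"

abbreviation partial_sum :: "nat set \<Rightarrow> (nat \<Rightarrow> complex) \<Rightarrow> complex" where
  "partial_sum A x \<equiv> \<Sum>i\<in>A. x i"

lemma partial_sum_linear:
  "partial_sum A (\<lambda>i. a * x i + b * y i) = a * partial_sum A x + b * partial_sum A y"
  by (simp add: sum.distrib sum_distrib_left)

lemma homogeneous_partial_sum: "A \<subseteq> {1..n} \<Longrightarrow> homogeneous n 1 (partial_sum A)"
  by (intro homogeneous_sum homogeneous.var) auto

lemma linear_subset_hyperplane:
  "linear_subset X \<Longrightarrow> linear_subset {x \<in> X. partial_sum A x = 0}"
  by (auto simp: linear_subset_def partial_sum_linear)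

text \<open>
A point at which it is nonzero is given for each factor separately, so the factors are cancelled one
by one.
\<close>

lemma homogeneous_cancel_prod:
  assumes "finite J" and "homogeneous n d' g" and X: "linear_subset X"
    and J: "\<And>A. A \<in> J \<Longrightarrow> A \<subseteq> {1..n}"
    and w: "\<And>A. A \<in> J \<Longrightarrow> \<exists>w\<in>X. partial_sum A w \<noteq> 0"
    and zero: "\<And>x. x \<in> X \<Longrightarrow> (\<Prod>A\<in>J. partial_sum A x) * g x = 0" and x: "x \<in> X"
  shows "g x = 0"
  using assms(1) J w zero x
proof (induction J arbitrary: x)
  case (insert A J)
  have prod: "homogeneous n (card J) (\<lambda>x. \<Prod>A\<in>J. partial_sum A x)"
    using homogeneous_prod[of J n "\<lambda>_. 1" partial_sum, OF homogeneous_partial_sum] insert.prems(1)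
    by simp
  obtain w where w: "w \<in> X" "partial_sum A w \<noteq> 0" using insert.prems(2) by blast
  have "(\<Prod>A\<in>J. partial_sum A y) * g y = 0" if "y \<in> X" for y
  proof (rule homogeneous_cancel[OF homogeneous_partial_sum homogeneous.mult[OF prod assms(2)]])
    show "A \<subseteq> {1..n}" using insert.prems(1) by blast
    show "(\<lambda>i. (1 - t) * x i + t * w i) \<in> X" if "x \<in> X" "w \<in> X" for x w t
      using X that by (auto simp: linear_subset_def)
    show "partial_sum A x * ((\<Prod>A\<in>J. partial_sum A x) * g x) = 0" if "x \<in> X" for x
      using insert.prems(3)[OF that] insert.hyps by (simp add: mult.assoc)
  qed (use w that in auto)
  then show ?case using insert.IH insert.prems(1,2,4) by blast
qed simp

text \<open>
The forms are divided out one at a time. After division by some of them, the quotient still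
vanishes on the hyperplane of the next one, because no earlier form is identically zero there. If
there are more forms than the degree of $f$ allows, then $f$ vanishes on $X$.
\<close>

lemma homogeneous_divide_linear_forms:
  assumes "finite J" and f: "homogeneous n d f" and X: "linear_subset X"
    and "\<And>A. A \<in> J \<Longrightarrow> A \<subseteq> {1..n}"
    and "\<And>A. A \<in> J \<Longrightarrow> \<exists>v\<in>X. partial_sum A v = 1"
    and "\<And>A B. A \<in> J \<Longrightarrow> B \<in> J \<Longrightarrow> A \<noteq> B \<Longrightarrow>
      \<exists>w\<in>X. partial_sum A w = 0 \<and> partial_sum B w \<noteq> 0"
    and "\<And>A x. A \<in> J \<Longrightarrow> x \<in> X \<Longrightarrow> partial_sum A x = 0 \<Longrightarrow> f x = 0"
  shows "\<exists>g. homogeneous n (d - card J) g \<and> (d < card J \<longrightarrow> g = (\<lambda>x. 0)) \<and>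
    (\<forall>x\<in>X. f x = (\<Prod>A\<in>J. partial_sum A x) * g x)"
  using assms(1,4-)
proof (induction J)
  case empty
  show ?case by (rule exI[of _ f]) (use f in auto)
next
  case (insert A J)
  have "\<exists>g. homogeneous n (d - card J) g \<and> (d < card J \<longrightarrow> g = (\<lambda>x. 0)) \<and>
    (\<forall>x\<in>X. f x = (\<Prod>A\<in>J. partial_sum A x) * g x)"
  proof (rule insert.IH)
    show "f x = 0" if "A \<in> J" "x \<in> X" "partial_sum A x = 0" for A x
      using insert.prems(4) that by blast
  qed (use insert.prems(1,2,3) in \<open>simp_all only: insert_iff simp_thms\<close>)
  then obtain g where g: "homogeneous n (d - card J) g" "d < card J \<longrightarrow> g = (\<lambda>x. 0)"
    "\<And>x. x \<in> X \<Longrightarrow> f x = (\<Prod>A\<in>J. partial_sum A x) * g x" by blast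
  have A: "A \<subseteq> {1..n}" using insert.prems(1) by blast
  obtain v where v: "v \<in> X" "partial_sum A v = 1" using insert.prems(2) by blast
  have g0: "g x = 0" if "x \<in> X" "partial_sum A x = 0" for x
  proof (rule homogeneous_cancel_prod[OF insert.hyps(1) g(1) linear_subset_hyperplane[OF X]])
    show "x \<in> {x \<in> X. partial_sum A x = 0}" using that by simp
    show "\<exists>w\<in>{x \<in> X. partial_sum A x = 0}. partial_sum B w \<noteq> 0" if "B \<in> J" for B
      using insert.prems(3)[of A B] insert.hyps(2) that by blast
    show "(\<Prod>A\<in>J. partial_sum A x) * g x = 0" if "x \<in> {x \<in> X. partial_sum A x = 0}" for x
      using insert.prems(4)[of A x] g(3) that by auto
  qed (use insert.prems(1) in blast)
  obtain h where h: "homogeneous n (d - card J - 1) h" "d - card J = 0 \<longrightarrow> h = (\<lambda>x. 0)"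
    "\<forall>x. g x - g (\<lambda>i. x i - partial_sum A x * v i) = partial_sum A x * h x"
    using homogeneous_difference_quotient[OF g(1) homogeneous_partial_sum[OF A], of v]
    by (elim exE conjE)
  have "g x = partial_sum A x * h x" if "x \<in> X" for x
  proof -
    have "(\<lambda>i. x i - partial_sum A x * v i) \<in> X"
      using X[unfolded linear_subset_def, rule_format, OF that v(1), of 1 "- partial_sum A x"]
      by simp
    moreover have "partial_sum A (\<lambda>i. x i - partial_sum A x * v i) = 0"
      using v(2) by (simp add: sum_subtractf flip: sum_distrib_left)
    ultimately show ?thesis using h(3)[rule_format, of x] g0 by simp
  qed
  then have "\<forall>x\<in>X. f x = (\<Prod>A\<in>insert A J. partial_sum A x) * h x"
    using g(3) insert.hyps by (simp add: mult_ac)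
  moreover have "d < card (insert A J) \<longrightarrow> h = (\<lambda>x. 0)" using h(2) insert.hyps by simp
  moreover have "homogeneous n (d - card (insert A J)) h" using h(1) insert.hyps by simp
  ultimately show ?case by blast
qed


section \<open>Coefficients of polynomial functions\<close>

definition tuples :: "nat \<Rightarrow> nat \<Rightarrow> (nat \<Rightarrow> nat) set" where
  "tuples n g = {r. (\<forall>i. i \<notin> {1..n} \<longrightarrow> r i = 0) \<and> (\<Sum>i=1..n. r i) = g}"

lemma finite_bounded_tuples:
  assumes "\<And>r i. r \<in> R \<Longrightarrow> i \<in> {1..n} \<Longrightarrow> r i \<le> (g::nat)"
    and "\<And>r i. r \<in> R \<Longrightarrow> i \<notin> {1..n} \<Longrightarrow> r i = 0"
  shows "finite (R :: (nat \<Rightarrow> nat) set)"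
proof (rule finite_subset)
  show "R \<subseteq> {r. \<forall>i. (i \<in> {1..n} \<longrightarrow> r i \<in> {..g}) \<and> (i \<notin> {1..n} \<longrightarrow> r i = 0)}"
    using assms by auto
  show "finite {r. \<forall>i. (i \<in> {1..n} \<longrightarrow> r i \<in> {..g}) \<and> (i \<notin> {1..n} \<longrightarrow> r i = 0)}"
    by (rule finite_set_of_finite_funs) auto
qed

lemma finite_tuples [simp]: "finite (tuples n g)"
proof (rule finite_bounded_tuples[where g = g and n = n])
  show "r i \<le> g" if "r \<in> tuples n g" "i \<in> {1..n}" for r i
    using that member_le_sum[of i "{1..n}" r] by (simp add: tuples_def)
qed (auto simp: tuples_def)

text \<open>
The values determine the coefficients, one variable at a time. Exponents are given by a map $E$ on
an arbitrary index set, which covers both tuples and finitely supported exponent vectors.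
\<close>

lemma polynomial_coefficients_zero:
  fixes c :: "'k \<Rightarrow> complex"
  assumes "finite A" "finite K"
    and "\<And>k l. k \<in> K \<Longrightarrow> l \<in> K \<Longrightarrow> (\<And>i. i \<in> A \<Longrightarrow> E k i = E l i) \<Longrightarrow> k = l"
    and "\<And>x. (\<Sum>k\<in>K. c k * (\<Prod>i\<in>A. x i ^ E k i)) = 0"
    and "k \<in> K"
  shows "c k = 0"
  using assms
proof (induction A arbitrary: K k)
  case empty
  have "K = {k}" using empty.prems(2,4) by auto
  then show ?case using empty.prems(3) by simp
next
  case (insert a A)
  define L where "L = {l \<in> K. E l a = E k a}"
  show ?case
  proof (rule insert.IH[of L])
    show "(\<Sum>k\<in>L. c k * (\<Prod>i\<in>A. x i ^ E k i)) = 0" for x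
    proof -
      define P where "P = (\<Sum>k\<in>K. monom (c k * (\<Prod>i\<in>A. x i ^ E k i)) (E k a))"
      have "poly P t = 0" for t
      proof -
        have "poly P t = (\<Sum>k\<in>K. c k * (\<Prod>i\<in>insert a A. (x(a := t)) i ^ E k i))"
          unfolding P_def poly_sum poly_monom
        proof (rule sum.cong[OF refl])
          fix k
          have "(\<Prod>i\<in>A. x i ^ E k i) = (\<Prod>i\<in>A. (x(a := t)) i ^ E k i)"
            using insert.hyps(2) by (intro prod.cong) auto
          then show "c k * (\<Prod>i\<in>A. x i ^ E k i) * t ^ E k a =
              c k * (\<Prod>i\<in>insert a A. (x(a := t)) i ^ E k i)"
            using insert.hyps by (simp add: mult_ac)
        qed
        then show ?thesis using insert.prems(3) by simp
      qed
      then have "P = 0" using poly_all_0_iff_0 by blast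
      then have "coeff P (E k a) = 0" by simp
      moreover have "coeff P (E k a) = (\<Sum>k\<in>L. c k * (\<Prod>i\<in>A. x i ^ E k i))"
        unfolding P_def coeff_sum L_def using insert.prems(1)
        by (intro sum.mono_neutral_cong_right) auto
      ultimately show ?thesis by simp
    qed
    show "k = l" if "k \<in> L" "l \<in> L" "\<And>i. i \<in> A \<Longrightarrow> E k i = E l i" for k l
      by (rule insert.prems(2)) (use that in \<open>auto simp: L_def\<close>)
  qed (use insert.prems in \<open>auto simp: L_def\<close>)
qed

lemma sum_product_convolution:
  fixes c :: "'k \<Rightarrow> complex"
  assumes "finite K" "finite L" "finite M"
    and "\<And>k l. k \<in> K \<Longrightarrow> l \<in> L \<Longrightarrow> h k l \<in> M \<and> G (h k l) = E k * F l"
  shows "(\<Sum>k\<in>K. c k * E k) * (\<Sum>l\<in>L. d l * F l) =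
    (\<Sum>m\<in>M. (\<Sum>(k, l)\<in>{p \<in> K \<times> L. h (fst p) (snd p) = m}. c k * d l) * G m)"
proof -
  have "(\<Sum>k\<in>K. c k * E k) * (\<Sum>l\<in>L. d l * F l) =
      (\<Sum>p\<in>K \<times> L. c (fst p) * d (snd p) * G (h (fst p) (snd p)))"
    unfolding sum_product sum.cartesian_product
    by (intro sum.cong) (auto simp: assms(4))
  also have "\<dots> = (\<Sum>m\<in>M. \<Sum>p\<in>{p \<in> K \<times> L. h (fst p) (snd p) = m}.
      c (fst p) * d (snd p) * G (h (fst p) (snd p)))"
    by (rule sum.group[symmetric]) (use assms in auto)
  also have "\<dots> = (\<Sum>m\<in>M. (\<Sum>(k, l)\<in>{p \<in> K \<times> L. h (fst p) (snd p) = m}. c k * d l) * G m)"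
    by (intro sum.cong refl) (auto simp: sum_distrib_right split: prod.splits intro!: sum.cong)
  finally show ?thesis .
qed

lemma homogeneous_expansion:
  assumes "homogeneous n d f"
  shows "\<exists>c. \<forall>x. f x = (\<Sum>r\<in>tuples n d. c r * (\<Prod>i=1..n. x i ^ r i))"
  using assms
proof induction
  case (zero d)
  show ?case by (rule exI[of _ "\<lambda>_. 0"]) simp
next
  case (const c)
  have "tuples n 0 = {\<lambda>_. 0}" by (fastforce simp: tuples_def fun_eq_iff)
  then show ?case by (intro exI[of _ "\<lambda>_. c"]) simp
next
  case (var j)
  define r where "r = (\<lambda>i. if i = j then 1 else 0 :: nat)"
  have "x j = (\<Sum>s\<in>tuples n 1. (if s = r then 1 else 0) * (\<Prod>i=1..n. x i ^ s i))" for x :: "nat \<Rightarrow> complex"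
  proof -
    have "r \<in> tuples n 1" using var by (auto simp: tuples_def r_def)
    then have "(\<Sum>s\<in>tuples n 1. (if s = r then 1 else 0) * (\<Prod>i=1..n. x i ^ s i)) =
        (\<Prod>i=1..n. x i ^ r i)"
      by (simp add: if_distrib[of "\<lambda>c. c * _"] cong: if_cong)
    also have "\<dots> = (\<Prod>i=1..n. if i = j then x i else 1)"
      by (intro prod.cong) (auto simp: r_def)
    also have "\<dots> = x j" using var by simp
    finally show ?thesis by simp
  qed
  then show ?case by (intro exI[of _ "\<lambda>s. if s = r then 1 else 0"] allI)
next
  case (add d f g)
  then obtain a b where
    "\<And>x. f x = (\<Sum>r\<in>tuples n d. a r * (\<Prod>i=1..n. x i ^ r i))"
    "\<And>x. g x = (\<Sum>r\<in>tuples n d. b r * (\<Prod>i=1..n. x i ^ r i))" by blast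
  then show ?case
    by (intro exI[of _ "\<lambda>r. a r + b r"]) (simp add: sum.distrib distrib_right)
next
  case (mult d f d' g)
  then obtain a b where
    "\<And>x. f x = (\<Sum>r\<in>tuples n d. a r * (\<Prod>i=1..n. x i ^ r i))"
    "\<And>x. g x = (\<Sum>r\<in>tuples n d'. b r * (\<Prod>i=1..n. x i ^ r i))" by blast
  moreover have "(\<Sum>r\<in>tuples n d. a r * (\<Prod>i=1..n. x i ^ r i)) *
      (\<Sum>r\<in>tuples n d'. b r * (\<Prod>i=1..n. x i ^ r i)) =
      (\<Sum>m\<in>tuples n (d + d'). (\<Sum>(r, s)\<in>{p \<in> tuples n d \<times> tuples n d'.
        (\<lambda>r s i. r i + s i) (fst p) (snd p) = m}. a r * b s) * (\<Prod>i=1..n. x i ^ m i))" for x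
  proof (rule sum_product_convolution)
    show "(\<lambda>i. r i + s i) \<in> tuples n (d + d') \<and>
        (\<Prod>i=1..n. x i ^ (r i + s i)) = (\<Prod>i=1..n. x i ^ r i) * (\<Prod>i=1..n. x i ^ s i)"
      if "r \<in> tuples n d" "s \<in> tuples n d'" for r s
      using that by (auto simp: tuples_def sum.distrib power_add prod.distrib)
  qed simp_all
  ultimately show ?case by auto
qed


section \<open>Symmetric polynomial functions\<close>

definition symmetric_on :: "nat \<Rightarrow> (nat \<Rightarrow> complex) set \<Rightarrow> ((nat \<Rightarrow> complex) \<Rightarrow> complex) \<Rightarrow> bool" where
  "symmetric_on n X f \<longleftrightarrow> (\<forall>p x. p permutes {1..n} \<longrightarrow> x \<in> X \<longrightarrow> f (x \<circ> p) = f x)"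

definition zero_sum :: "nat \<Rightarrow> (nat \<Rightarrow> complex) set" where
  "zero_sum n = {x. (\<Sum>i=1..n. x i) = 0}"

lemma linear_subset_zero_sum: "linear_subset (zero_sum n)"
  by (simp add: linear_subset_def zero_sum_def partial_sum_linear)

lemma permuted_zero_sum:
  assumes "p permutes {1..n}" "x \<in> zero_sum n"
  shows "x \<circ> p \<in> zero_sum n"
  using assms sum.permute[OF assms(1), of x] by (simp add: zero_sum_def)

lemma homogeneous_permuted:
  assumes "homogeneous n d f" "p permutes {1..n}"
  shows "homogeneous n d (\<lambda>x. f (x \<circ> p))"
  by (rule homogeneous_subst[OF assms(1)])
    (use permutes_in_image[OF assms(2)] in \<open>auto intro!: homogeneous.var simp del: One_nat_def\<close>)

text \<open>
If $f$ and $l$ are symmetric, then the quotient may be replaced by its average over all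
permutations. The average is symmetric everywhere, not only on $X$.
\<close>

lemma symmetric_quotient:
  assumes g: "homogeneous n d g" and f: "symmetric_on n X f" and l: "symmetric_on n X l"
    and X: "\<And>p x. p permutes {1..n} \<Longrightarrow> x \<in> X \<Longrightarrow> x \<circ> p \<in> X"
    and eq: "\<And>x. x \<in> X \<Longrightarrow> f x = l x * g x"
  shows "\<exists>h. homogeneous n d h \<and> symmetric_on n UNIV h \<and> (g = (\<lambda>x. 0) \<longrightarrow> h = (\<lambda>x. 0)) \<and>
    (\<forall>x\<in>X. f x = l x * h x)"
proof -
  let ?S = "{p. p permutes {1..n}}"
  define h where "h = (\<lambda>x. inverse (of_nat (card ?S)) * (\<Sum>p\<in>?S. g (x \<circ> p)))"
  have S: "finite ?S" "card ?S \<noteq> 0"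
    by (auto simp: card_eq_0_iff finite_permutations intro: permutes_id)
  have "homogeneous n d h"
    unfolding h_def by (intro homogeneous_scale homogeneous_sum homogeneous_permuted[OF g]) auto
  moreover have "symmetric_on n UNIV h"
    unfolding symmetric_on_def
  proof (intro allI impI)
    fix p and x :: "nat \<Rightarrow> complex" assume p: "p permutes {1..n}"
    show "h (x \<circ> p) = h x"
      using setum_permutations_compose_left[OF p, of "\<lambda>q. g (x \<circ> q)"]
      by (simp add: h_def comp_assoc)
  qed
  moreover have "f x = l x * h x" if x: "x \<in> X" for x
  proof -
    have "f x = l x * g (x \<circ> p)" if p: "p \<in> ?S" for p
      using eq[OF X[of p x]] f l p x by (auto simp: symmetric_on_def)
    then have "(\<Sum>p\<in>?S. l x * g (x \<circ> p)) = (\<Sum>p\<in>?S. f x)" by (intro sum.cong) auto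
    then show ?thesis using S by (simp add: h_def field_simps flip: sum_distrib_left)
  qed
  moreover have "g = (\<lambda>x. 0) \<longrightarrow> h = (\<lambda>x. 0)" by (simp add: h_def)
  ultimately show ?thesis by blast
qed

definition elem_sym :: "nat \<Rightarrow> nat \<Rightarrow> (nat \<Rightarrow> complex) \<Rightarrow> complex" where
  "elem_sym n i x = (\<Sum>A | A \<subseteq> {1..n} \<and> card A = i. \<Prod>j\<in>A. x j)"

lemma homogeneous_elem_sym: "homogeneous n i (elem_sym n i)"
proof -
  have "homogeneous n i (\<lambda>x. \<Prod>j\<in>A. x j)" if "A \<subseteq> {1..n}" "card A = i" for A
    using homogeneous_prod[of A n "\<lambda>_. 1" "\<lambda>j x. x j", OF homogeneous.var] that
    by (simp add: subset_iff)
  then show ?thesis unfolding elem_sym_def by (intro homogeneous_sum) auto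
qed

lemma elem_sym_permuted:
  assumes p: "p permutes {1..n}"
  shows "elem_sym n i (x \<circ> p) = elem_sym n i x"
  unfolding elem_sym_def
proof (rule sum.reindex_bij_witness[of _ "image (inv p)" "image p"])
  fix A assume A: "A \<in> {A. A \<subseteq> {1..n} \<and> card A = i}"
  have inj: "inj p" "inj (inv p)" using p permutes_inj permutes_inv by blast+
  show "inv p ` p ` A = A" "p ` inv p ` A = A"
    using permutes_inverses[OF p] by (auto simp: image_image)
  show "p ` A \<in> {A. A \<subseteq> {1..n} \<and> card A = i}"
    using A permutes_in_image[OF p] inj by (auto simp: card_image inj_on_subset[of p UNIV])
  show "inv p ` A \<in> {A. A \<subseteq> {1..n} \<and> card A = i}"
    using A permutes_in_image[OF permutes_inv[OF p]] inj
    by (auto simp: card_image inj_on_subset[of "inv p" UNIV])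
  show "prod x (p ` A) = prod (x \<circ> p) A"
    using inj by (subst prod.reindex) (auto simp: inj_on_subset[of p UNIV])
qed

lemma elem_sym_1: "elem_sym n 1 x = (\<Sum>i=1..n. x i)"
proof -
  have "elem_sym n 1 x = (\<Sum>A\<in>(\<lambda>i. {i}) ` {1..n}. \<Prod>j\<in>A. x j)"
    unfolding elem_sym_def by (rule sum.cong) (auto simp: card_1_singleton_iff)
  then show ?thesis by (simp add: sum.reindex)
qed

lemma elem_sym_n: "elem_sym n n x = (\<Prod>i=1..n. x i)"
proof -
  have "{A. A \<subseteq> {1..n} \<and> card A = n} = {{1..n}}"
    using card_subset_eq[of "{1..n}"] by auto
  then show ?thesis by (simp add: elem_sym_def)
qed

lemma elem_sym_restrict:
  assumes "x (Suc n) = 0"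
  shows "elem_sym (Suc n) i x = elem_sym n i x"
  unfolding elem_sym_def
proof (rule sum.mono_neutral_right)
  show "\<forall>A\<in>{A. A \<subseteq> {1..Suc n} \<and> card A = i} - {A. A \<subseteq> {1..n} \<and> card A = i}. prod x A = 0"
  proof
    fix A assume A: "A \<in> {A. A \<subseteq> {1..Suc n} \<and> card A = i} - {A. A \<subseteq> {1..n} \<and> card A = i}"
    then have "Suc n \<in> A" by (auto simp: atLeastAtMostSuc_conv)
    moreover have "finite A" using A finite_subset by blast
    ultimately show "prod x A = 0" using assms by auto
  qed
qed (auto intro: finite_subset[of _ "Pow {1..Suc n}"])

text \<open>
The index starts at $a=1$ for all symmetric functions and at $a=2$ on the hyperplane, where the
first elementary symmetric function vanishes.
\<close>

definition graded_tuples :: "nat \<Rightarrow> nat \<Rightarrow> nat \<Rightarrow> (nat \<Rightarrow> nat) set" where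
  "graded_tuples a n g = {k. (\<forall>i. i \<notin> {a..n} \<longrightarrow> k i = 0) \<and> (\<Sum>i=a..n. i * k i) = g}"

lemma U_index_weighted: "U_index n g = graded_tuples 2 n g"
  by (simp add: U_index_def graded_tuples_def)

lemma finite_graded_tuples [simp]:
  assumes "a > 0" shows "finite (graded_tuples a n g)"
proof (rule finite_bounded_tuples[where g = g and n = n])
  fix k i assume k: "k \<in> graded_tuples a n g"
  then show "k i = 0" if "i \<notin> {1..n}" using that assms by (auto simp: graded_tuples_def)
  show "k i \<le> g" if "i \<in> {1..n}"
  proof (cases "i \<in> {a..n}")
    case True
    then have "i * k i \<le> g"
      using k member_le_sum[of i "{a..n}" "\<lambda>i. i * k i"] by (simp add: graded_tuples_def)
    moreover have "k i \<le> i * k i" using that by simp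
    ultimately show ?thesis by linarith
  qed (use k in \<open>auto simp: graded_tuples_def\<close>)
qed

lemma finite_U_index [simp]: "finite (U_index n g)"
  by (simp add: U_index_weighted)

lemma graded_tuples_restrict:
  assumes "a \<le> Suc n"
  shows "k \<in> graded_tuples a n g \<longleftrightarrow> k \<in> graded_tuples a (Suc n) g \<and> k (Suc n) = 0"
proof -
  have "i \<notin> {a..n} \<longleftrightarrow> i \<notin> {a..Suc n} \<or> i = Suc n" for i
    using assms by auto
  then have "(\<forall>i. i \<notin> {a..n} \<longrightarrow> k i = 0) \<longleftrightarrow>
      (\<forall>i. i \<notin> {a..Suc n} \<longrightarrow> k i = 0) \<and> k (Suc n) = 0" by blast
  then show ?thesis using assms by (auto simp: graded_tuples_def)
qed

lemma graded_tuples_drop_first: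
  "k \<in> graded_tuples (Suc a) n g \<longleftrightarrow> k \<in> graded_tuples a n g \<and> k a = 0"
proof -
  have "i \<notin> {Suc a..n} \<longleftrightarrow> i \<notin> {a..n} \<or> i = a" for i by auto
  then have "(\<forall>i. i \<notin> {Suc a..n} \<longrightarrow> k i = 0) \<longleftrightarrow> (\<forall>i. i \<notin> {a..n} \<longrightarrow> k i = 0) \<and> k a = 0"
    by blast
  moreover have "(\<Sum>i=a..n. i * k i) = (\<Sum>i=Suc a..n. i * k i)" if "k a = 0"
    using that by (cases "a \<le> n") (simp_all add: sum.atLeast_Suc_atMost)
  ultimately show ?thesis by (auto simp: graded_tuples_def)
qed

text \<open>
The tuples with last entry $0$ are those of one variable less; from the others one unit in the last
place can be removed, which corresponds to dividing a monomial by the last elementary symmetric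
function. Both inductions on the number of variables below rest on this splitting.
\<close>

lemma sum_graded_tuples_Suc:
  fixes f :: "(nat \<Rightarrow> nat) \<Rightarrow> 'b::comm_monoid_add"
  assumes "a \<le> Suc n" and that: "a > 0"
  shows "(\<Sum>k\<in>graded_tuples a (Suc n) g. f k) = (\<Sum>k\<in>graded_tuples a n g. f k) +
    (if Suc n \<le> g then \<Sum>k\<in>graded_tuples a (Suc n) (g - Suc n). f (k(Suc n := Suc (k (Suc n))))
     else 0)"
proof -
  let ?W = "graded_tuples a (Suc n) g"
  have 0: "{k \<in> ?W. k (Suc n) = 0} = graded_tuples a n g"
    using graded_tuples_restrict[OF assms(1)] by blast
  have weight: "(\<Sum>i=a..n. i * (k(Suc n := m)) i) = (\<Sum>i=a..n. i * k i)" for k m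
    by (rule sum.cong) auto
  have 1: "(\<Sum>k\<in>{k \<in> ?W. k (Suc n) \<noteq> 0}. f k) =
    (if Suc n \<le> g then \<Sum>k\<in>graded_tuples a (Suc n) (g - Suc n). f (k(Suc n := Suc (k (Suc n))))
     else 0)"
  proof (cases "Suc n \<le> g")
    case True
    have "(\<Sum>k\<in>{k \<in> ?W. k (Suc n) \<noteq> 0}. f k) =
      (\<Sum>k\<in>graded_tuples a (Suc n) (g - Suc n). f (k(Suc n := Suc (k (Suc n)))))"
    proof (rule sum.reindex_bij_witness[of _ "\<lambda>k. k(Suc n := Suc (k (Suc n)))"
          "\<lambda>k. k(Suc n := k (Suc n) - 1)"])
      fix k assume k: "k \<in> {k \<in> ?W. k (Suc n) \<noteq> 0}"
      then obtain m where m: "k (Suc n) = Suc m" using not0_implies_Suc by auto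
      show "k(Suc n := k (Suc n) - 1) \<in> graded_tuples a (Suc n) (g - Suc n)"
        using k m assms by (auto simp: graded_tuples_def weight)
      show "(k(Suc n := k (Suc n) - 1))(Suc n := Suc ((k(Suc n := k (Suc n) - 1)) (Suc n))) = k"
        using m by auto
      then show "f ((k(Suc n := k (Suc n) - 1))(Suc n := Suc ((k(Suc n := k (Suc n) - 1)) (Suc n)))) = f k"
        by simp
    next
      fix k assume k: "k \<in> graded_tuples a (Suc n) (g - Suc n)"
      show "k(Suc n := Suc (k (Suc n))) \<in> {k \<in> ?W. k (Suc n) \<noteq> 0}"
        using k assms True by (auto simp: graded_tuples_def weight)
    qed auto
    then show ?thesis using True by simp
  next
    case False
    have "g \<ge> Suc n" if k: "k \<in> ?W" "k (Suc n) \<noteq> 0" for k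
    proof -
      have "Suc n * k (Suc n) \<le> g"
        using k assms member_le_sum[of "Suc n" "{a..Suc n}" "\<lambda>i. i * k i"]
        by (auto simp: graded_tuples_def)
      moreover have "Suc n * 1 \<le> Suc n * k (Suc n)" using k(2) by (intro mult_le_mono2) simp
      ultimately show ?thesis unfolding mult_1_right by (rule order_trans[rotated])
    qed
    then have "{k \<in> ?W. k (Suc n) \<noteq> 0} = {}" using False by blast
    then show ?thesis using False by (simp only: sum.empty if_False)
  qed
  have "(\<Sum>k\<in>?W. f k) = (\<Sum>k\<in>{k \<in> ?W. k (Suc n) = 0} \<union> {k \<in> ?W. k (Suc n) \<noteq> 0}. f k)"
    by (rule sum.cong) auto
  also have "\<dots> = (\<Sum>k\<in>{k \<in> ?W. k (Suc n) = 0}. f k) + (\<Sum>k\<in>{k \<in> ?W. k (Suc n) \<noteq> 0}. f k)"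
    using that by (intro sum.union_disjoint) auto
  finally show ?thesis unfolding 0 1 .
qed

definition elem_mono :: "nat \<Rightarrow> nat \<Rightarrow> (nat \<Rightarrow> nat) \<Rightarrow> (nat \<Rightarrow> complex) \<Rightarrow> complex" where
  "elem_mono a n k x = (\<Prod>i=a..n. elem_sym n i x ^ k i)"

lemma elem_mono_restrict:
  assumes "x (Suc n) = 0" "k (Suc n) = 0" "a \<le> Suc n"
  shows "elem_mono a (Suc n) k x = elem_mono a n k x"
  using assms by (simp add: elem_mono_def elem_sym_restrict)

lemma elem_mono_Suc:
  assumes "a \<le> Suc n"
  shows "elem_mono a (Suc n) (k(Suc n := Suc (k (Suc n)))) x =
    elem_sym (Suc n) (Suc n) x * elem_mono a (Suc n) k x"
proof -
  have "(\<Prod>i=a..n. elem_sym (Suc n) i x ^ (k(Suc n := m)) i) =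
      (\<Prod>i=a..n. elem_sym (Suc n) i x ^ k i)" for m
    by (rule prod.cong) auto
  then show ?thesis using assms by (simp add: elem_mono_def)
qed

lemma elem_mono_drop_first:
  "k a = 0 \<Longrightarrow> elem_mono (Suc a) n k x = elem_mono a n k x"
  by (cases "a \<le> n") (simp_all add: elem_mono_def prod.atLeast_Suc_atMost)

lemma elem_mono_permuted:
  "p permutes {1..n} \<Longrightarrow> elem_mono a n k (x \<circ> p) = elem_mono a n k x"
  by (simp add: elem_mono_def elem_sym_permuted)

lemma homogeneous_elem_mono:
  assumes "k \<in> graded_tuples a n g"
  shows "homogeneous n g (elem_mono a n k)"
proof -
  have "homogeneous n (\<Sum>i=a..n. k i * i) (\<lambda>x. \<Prod>i=a..n. elem_sym n i x ^ k i)"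
    by (intro homogeneous_prod homogeneous_power homogeneous_elem_sym)
  then show ?thesis using assms by (simp add: graded_tuples_def elem_mono_def[abs_def] mult.commute)
qed

lemma elem_mono_add:
  "elem_mono a n (\<lambda>i. k i + l i) x = elem_mono a n k x * elem_mono a n l x"
  by (simp add: elem_mono_def power_add prod.distrib)

lemma graded_tuples_add:
  "k \<in> graded_tuples a n g \<Longrightarrow> l \<in> graded_tuples a n g' \<Longrightarrow>
    (\<lambda>i. k i + l i) \<in> graded_tuples a n (g + g')"
  by (simp add: graded_tuples_def sum.distrib distrib_left)

lemma swapped_coordinate:
  fixes i n :: nat
  assumes "i \<in> {1..n}"
  shows "transpose i n permutes {1..n}" "(x \<circ> transpose i n) n = x i"
  using permutes_swap_id[of i "{1..n}" n] assms by simp_all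

text \<open>
The fundamental theorem on symmetric polynomials. With the last variable set to $0$, induction on
$n$ yields the part of the expansion without $e_n$. After subtracting it, the function vanishes on
one and hence on every coordinate hyperplane, so it is $e_n$ times a symmetric form of lower degree.
\<close>

lemma symmetric_expansion:
  assumes "homogeneous n g f" "symmetric_on n UNIV f"
  shows "\<exists>c. \<forall>x. f x = (\<Sum>k\<in>graded_tuples 1 n g. c k * elem_mono 1 n k x)"
  using assms
proof (induction n arbitrary: g f)
  case 0
  have "graded_tuples 1 0 g = (if g = 0 then {\<lambda>_. 0} else {})"
    by (auto simp: graded_tuples_def)
  then have sum: "(\<Sum>k\<in>graded_tuples 1 0 g. f (\<lambda>_. 0) * elem_mono 1 0 k x) =
      (if g = 0 then f (\<lambda>_. 0) else 0)" for x
    by (simp add: elem_mono_def)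
  have "f x = (if g = 0 then f (\<lambda>_. 0) else 0)" for x
    using homogeneous_cong[OF 0(1), of x "\<lambda>_. 0"] homogeneous_at_origin[OF 0(1), of x] by simp
  then have "f x = (\<Sum>k\<in>graded_tuples 1 0 g. f (\<lambda>_. 0) * elem_mono 1 0 k x)" for x
    unfolding sum .
  then show ?case by (intro exI[of _ "\<lambda>_. f (\<lambda>_. 0)"] allI)
next
  case (Suc n)
  note IH = Suc.IH
  show ?case using Suc.prems
  proof (induction g arbitrary: f rule: less_induct)
    case (less g)
    let ?N = "Suc n"
    have hom\<^sub>0: "homogeneous n g (\<lambda>x. f (x(?N := 0)))"
    proof (rule homogeneous_subst[OF less.prems(1), where y = "\<lambda>x. x(?N := 0)"])
      show "homogeneous n 1 (\<lambda>x. (x(?N := 0)) i)" if "i \<in> {1..?N}" for i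
        using that homogeneous.var[of i n]
        by (cases "i = ?N") (simp_all add: homogeneous.zero del: One_nat_def)
    qed
    have sym\<^sub>0: "symmetric_on n UNIV (\<lambda>x. f (x(?N := 0)))"
      unfolding symmetric_on_def
    proof (intro allI impI)
      fix p and x :: "nat \<Rightarrow> complex" assume p: "p permutes {1..n}"
      have p': "p permutes {1..?N}" by (rule permutes_subset[OF p]) auto
      have last: "p i = ?N \<longleftrightarrow> i = ?N" for i
        using permutes_not_in[OF p, of ?N] inj_eq[OF permutes_inj[OF p], of i ?N] by simp
      have "(x \<circ> p)(?N := 0) = x(?N := 0) \<circ> p"
        by (rule ext) (simp add: last)
      then show "f ((x \<circ> p)(?N := 0)) = f (x(?N := 0))"
        using less.prems(2) p' by (simp add: symmetric_on_def)
    qed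
    obtain a where a:
      "\<And>x. f (x(?N := 0)) = (\<Sum>k\<in>graded_tuples 1 n g. a k * elem_mono 1 n k x)"
      using IH[OF hom\<^sub>0 sym\<^sub>0] by blast
    define f\<^sub>1 where "f\<^sub>1 = (\<lambda>x. f x - (\<Sum>k\<in>graded_tuples 1 n g. a k * elem_mono 1 ?N k x))"
    have sub: "graded_tuples 1 n g \<subseteq> graded_tuples 1 ?N g"
      by (auto simp: graded_tuples_def)
    have hom: "homogeneous ?N g f\<^sub>1"
      unfolding f\<^sub>1_def using sub
      by (intro homogeneous_diff less.prems homogeneous_sum homogeneous_scale homogeneous_elem_mono) auto
    have sym: "symmetric_on ?N UNIV f\<^sub>1"
      using less.prems(2) by (simp add: symmetric_on_def f\<^sub>1_def elem_mono_permuted)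
    have zero: "f\<^sub>1 x = 0" if "x ?N = 0" for x
    proof -
      have "x(?N := 0) = x" using that by auto
      moreover have "elem_mono 1 ?N k x = elem_mono 1 n k x"
        if "k \<in> graded_tuples 1 n g" for k
        using that \<open>x ?N = 0\<close> by (intro elem_mono_restrict) (auto simp: graded_tuples_def)
      ultimately show ?thesis using a[of x] by (simp add: f\<^sub>1_def)
    qed
    have zero': "f\<^sub>1 x = 0" if "i \<in> {1..?N}" "x i = 0" for i x
    proof -
      have "f\<^sub>1 (x \<circ> transpose i ?N) = f\<^sub>1 x"
        using sym[unfolded symmetric_on_def] swapped_coordinate(1)[OF that(1)] by blast
      moreover have "f\<^sub>1 (x \<circ> transpose i ?N) = 0" by (rule zero) (simp add: that(2))
      ultimately show ?thesis by simp
    qed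
    have "\<exists>h. homogeneous ?N (g - card ((\<lambda>i. {i}) ` {1..?N})) h \<and>
      (g < card ((\<lambda>i. {i}) ` {1..?N}) \<longrightarrow> h = (\<lambda>x. 0)) \<and>
      (\<forall>x\<in>UNIV. f\<^sub>1 x = (\<Prod>A\<in>(\<lambda>i. {i}) ` {1..?N}. partial_sum A x) * h x)"
    proof (rule homogeneous_divide_linear_forms[OF _ hom])
      show "linear_subset UNIV" by (simp add: linear_subset_def)
      show "\<exists>v\<in>UNIV. partial_sum A v = (1::complex)" if "A \<in> (\<lambda>i. {i}) ` {1..?N}" for A
        using that by (intro bexI[of _ "\<lambda>_. 1"]) auto
      show "\<exists>w\<in>UNIV. partial_sum A w = (0::complex) \<and> partial_sum B w \<noteq> 0"
        if "A \<in> (\<lambda>i. {i}) ` {1..?N}" "B \<in> (\<lambda>i. {i}) ` {1..?N}" "A \<noteq> B" for A B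
        using that by (intro bexI[of _ "\<lambda>i. if i \<in> B then 1 else 0"]) auto
    qed (use zero' in auto)
    then obtain h where h: "homogeneous ?N (g - ?N) h" "g < ?N \<longrightarrow> h = (\<lambda>x. 0)"
      "\<And>x. f\<^sub>1 x = elem_sym ?N ?N x * h x"
      by (auto simp: card_image prod.reindex elem_sym_n simp del: prod.cl_ivl_Suc)
    have "symmetric_on ?N UNIV (elem_sym ?N ?N)" by (simp add: symmetric_on_def elem_sym_permuted)
    from symmetric_quotient[OF h(1) sym this _ h(3)] obtain h' where h':
      "homogeneous ?N (g - ?N) h'" "symmetric_on ?N UNIV h'" "h = (\<lambda>x. 0) \<longrightarrow> h' = (\<lambda>x. 0)"
      "\<And>x. f\<^sub>1 x = elem_sym ?N ?N x * h' x" by auto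
    have "\<exists>b. \<forall>x. ?N \<le> g \<longrightarrow>
      h' x = (\<Sum>k\<in>graded_tuples 1 ?N (g - ?N). b k * elem_mono 1 ?N k x)"
    proof (cases "?N \<le> g")
      case True
      then have "g - ?N < g" by simp
      from less.IH[OF this h'(1,2)] show ?thesis by blast
    qed simp
    then obtain b where b: "?N \<le> g \<Longrightarrow>
      h' x = (\<Sum>k\<in>graded_tuples 1 ?N (g - ?N). b k * elem_mono 1 ?N k x)" for x
      by blast
    define c where "c = (\<lambda>k. if k ?N = 0 then a k else b (k(?N := k ?N - 1)))"
    have "f x = (\<Sum>k\<in>graded_tuples 1 ?N g. c k * elem_mono 1 ?N k x)" for x
    proof -
      have low: "(\<Sum>k\<in>graded_tuples 1 n g. c k * elem_mono 1 ?N k x) =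
          (\<Sum>k\<in>graded_tuples 1 n g. a k * elem_mono 1 ?N k x)"
        by (rule sum.cong) (auto simp: c_def graded_tuples_def)
      have high: "c (k(?N := Suc (k ?N))) = b k" for k
        by (simp add: c_def)
      have "(\<Sum>k\<in>graded_tuples 1 ?N g. c k * elem_mono 1 ?N k x) =
        (\<Sum>k\<in>graded_tuples 1 n g. a k * elem_mono 1 ?N k x) +
        (if ?N \<le> g then \<Sum>k\<in>graded_tuples 1 ?N (g - ?N).
          b k * (elem_sym ?N ?N x * elem_mono 1 ?N k x) else 0)"
        by (subst sum_graded_tuples_Suc) (simp_all add: low high elem_mono_Suc del: One_nat_def)
      also have "(if ?N \<le> g then \<Sum>k\<in>graded_tuples 1 ?N (g - ?N).
          b k * (elem_sym ?N ?N x * elem_mono 1 ?N k x) else 0) = elem_sym ?N ?N x * h' x"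
        using b[of x] h(2) h'(3) by (auto simp: sum_distrib_left mult_ac)
      also have "\<dots> = f\<^sub>1 x" using h'(4) by simp
      finally show ?thesis by (simp add: f\<^sub>1_def)
    qed
    then show ?case by blast
  qed
qed

lemma zero_sum_extend:
  assumes "x \<in> zero_sum n"
  shows "x(Suc n := 0) \<in> zero_sum (Suc n)"
proof -
  have "(\<Sum>i=1..n. (x(Suc n := 0)) i) = (\<Sum>i=1..n. x i)" by (rule sum.cong) auto
  then show ?thesis using assms by (simp add: zero_sum_def)
qed

lemma elem_mono_extend:
  assumes "k \<in> graded_tuples 2 n g" "n > 0"
  shows "elem_mono 2 (Suc n) k (x(Suc n := 0)) = elem_mono 2 n k x"
proof -
  have "elem_mono 2 (Suc n) k (x(Suc n := 0)) = elem_mono 2 n k (x(Suc n := 0))"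
    using assms by (intro elem_mono_restrict) (auto simp: graded_tuples_def)
  also have "\<dots> = elem_mono 2 n k x"
    by (rule homogeneous_cong[OF homogeneous_elem_mono[OF assms(1)]]) auto
  finally show ?thesis .
qed

text \<open>
Setting the last variable to $0$ leaves the hyperplane for one variable less and kills exactly the
monomials that contain $e_n$, so induction on $n$ removes the other coefficients. What is left is
$e_n$ times a relation of lower degree, and $e_n$ is not identically zero on the hyperplane.
\<close>

lemma elem_monos_independent:
  assumes "n > 0"
    and "\<And>x. x \<in> zero_sum n \<Longrightarrow> (\<Sum>k\<in>U_index n g. c k * elem_mono 2 n k x) = 0"
    and "k \<in> U_index n g"
  shows "c k = 0"
  using assms unfolding U_index_weighted
proof (induction n arbitrary: g c k rule: nat_induct_non_zero)
  case 1
  have W: "graded_tuples 2 1 g = (if g = 0 then {\<lambda>_. 0} else {})"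
    by (auto simp: graded_tuples_def)
  then have "g = 0" "k = (\<lambda>_. 0)" using 1(2) by (auto split: if_splits)
  then show ?case using 1(1)[of "\<lambda>_. 0"] W by (auto simp: elem_mono_def zero_sum_def)
next
  case (Suc n)
  note IH = Suc.IH and n = Suc.hyps
  let ?N = "Suc n"
  show ?case using Suc.prems
  proof (induction g arbitrary: c k rule: less_induct)
    case (less g)
    have low: "c k = 0" if k: "k \<in> graded_tuples 2 n g" for k
    proof (rule IH[OF _ k])
      fix x assume x: "x \<in> zero_sum n"
      define y where "y = x(?N := 0)"
      have y: "y \<in> zero_sum ?N" unfolding y_def by (rule zero_sum_extend[OF x])
      have eq: "elem_mono 2 n k x = elem_mono 2 ?N k y" if "k \<in> graded_tuples 2 n g" for k
        unfolding y_def using elem_mono_extend[OF that n] by simp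
      have "(\<Sum>k\<in>graded_tuples 2 ?N g. c k * elem_mono 2 ?N k y) =
          (\<Sum>k\<in>graded_tuples 2 n g. c k * elem_mono 2 ?N k y)"
        using n by (subst sum_graded_tuples_Suc) (auto simp: elem_mono_Suc elem_sym_n y_def)
      then show "(\<Sum>k\<in>graded_tuples 2 n g. c k * elem_mono 2 n k x) = 0"
        using less.prems(1)[OF y] eq by (simp cong: sum.cong)
    qed
    show ?case
    proof (cases "k ?N = 0")
      case True
      then have "k \<in> graded_tuples 2 n g"
        using less.prems(2) n graded_tuples_restrict[of 2 n k g] by simp
      then show ?thesis by (rule low)
    next
      case False
      define l where "l = k(?N := k ?N - 1)"
      have k: "k = l(?N := Suc (l ?N))" using False by (auto simp: l_def)
      have weight: "(\<Sum>i=2..n. i * l i) = (\<Sum>i=2..n. i * k i)"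
        by (rule sum.cong) (auto simp: l_def)
      have kN: "?N * k ?N = ?N + ?N * l ?N" using k by (metis fun_upd_same mult_Suc_right)
      have g: "?N \<le> g" "l \<in> graded_tuples 2 ?N (g - ?N)"
        using less.prems(2) n kN weight by (auto simp: graded_tuples_def l_def)
      define h where "h = (\<lambda>x. \<Sum>k\<in>graded_tuples 2 ?N (g - ?N).
          c (k(?N := Suc (k ?N))) * elem_mono 2 ?N k x)"
      have h: "elem_sym ?N ?N x * h x = 0" if "x \<in> zero_sum ?N" for x
      proof -
        have "(\<Sum>k\<in>graded_tuples 2 ?N g. c k * elem_mono 2 ?N k x) = elem_sym ?N ?N x * h x"
          using n g(1) low
          by (subst sum_graded_tuples_Suc)
            (auto simp: elem_mono_Suc h_def sum_distrib_left mult_ac intro!: sum.cong)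
        then show ?thesis using less.prems(1)[OF that] by simp
      qed
      have "h x = 0" if x: "x \<in> zero_sum ?N" for x
      proof (rule homogeneous_cancel[OF homogeneous_elem_sym _ _ h])
        show "homogeneous ?N (g - ?N) h"
          unfolding h_def by (intro homogeneous_sum homogeneous_scale homogeneous_elem_mono)
        show "(\<lambda>i. (1 - t) * x i + t * w i) \<in> zero_sum ?N"
          if "x \<in> zero_sum ?N" "w \<in> zero_sum ?N" for x w t
          using linear_subset_zero_sum that by (simp add: linear_subset_def)
        \<comment> \<open>A point of the hyperplane without zero coordinates.\<close>
        let ?w = "\<lambda>i. if i = ?N then - of_nat n else 1 :: complex"
        have "(\<Sum>i=1..n. ?w i) = (\<Sum>i=1..n. 1)" by (rule sum.cong) auto
        then show "?w \<in> zero_sum ?N" by (simp add: zero_sum_def)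
        show "elem_sym ?N ?N ?w \<noteq> 0" using n by (auto simp: elem_sym_n)
      qed (use x in auto)
      then have "c (l(?N := Suc (l ?N))) = 0"
        using less.IH[of "g - ?N" "\<lambda>k. c (k(?N := Suc (k ?N)))", OF _ _ g(2)] g(1) by (simp add: h_def)
      then show ?thesis using k by metis
    qed
  qed
qed

text \<open>
A form that is symmetric only on the hyperplane agrees there with its average, to which the
fundamental theorem applies; then $e_1=0$ removes all monomials that contain $e_1$.
\<close>

lemma symmetric_expansion_on_zero_sum:
  assumes f: "homogeneous n g f" and sym: "symmetric_on n (zero_sum n) f"
  shows "\<exists>c. \<forall>x\<in>zero_sum n. f x = (\<Sum>k\<in>U_index n g. c k * elem_mono 2 n k x)"
proof -
  have one: "symmetric_on n (zero_sum n) (\<lambda>_. 1)" by (simp add: symmetric_on_def)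
  from symmetric_quotient[OF f sym one permuted_zero_sum]
  obtain h where h: "homogeneous n g h" "symmetric_on n UNIV h"
    "\<And>x. x \<in> zero_sum n \<Longrightarrow> f x = h x" by auto
  obtain c where c: "\<And>x. h x = (\<Sum>k\<in>graded_tuples 1 n g. c k * elem_mono 1 n k x)"
    using symmetric_expansion[OF h(1,2)] by blast
  have "f x = (\<Sum>k\<in>U_index n g. c k * elem_mono 2 n k x)" if x: "x \<in> zero_sum n" for x
  proof -
    have e1: "elem_sym n 1 x = 0" using x by (simp only: elem_sym_1) (simp add: zero_sum_def)
    have "f x = (\<Sum>k\<in>graded_tuples 1 n g. c k * elem_mono 1 n k x)" using h(3)[OF x] c by simp
    also have "\<dots> = (\<Sum>k\<in>U_index n g. c k * elem_mono 2 n k x)"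
    proof (rule sum.mono_neutral_cong_right)
      show "U_index n g \<subseteq> graded_tuples 1 n g"
        using graded_tuples_drop_first[of _ 1 n g] by (auto simp: U_index_weighted numeral_2_eq_2)
      show "\<forall>k\<in>graded_tuples 1 n g - U_index n g. c k * elem_mono 1 n k x = 0"
      proof
        fix k assume k: "k \<in> graded_tuples 1 n g - U_index n g"
        then have "k 1 \<noteq> 0"
          using graded_tuples_drop_first[of k 1 n g] by (auto simp: U_index_weighted numeral_2_eq_2)
        moreover from this have "n \<noteq> 0"
          using k by (cases "n = 0") (auto simp: graded_tuples_def)
        ultimately show "c k * elem_mono 1 n k x = 0" using e1
          by (auto simp: elem_mono_def intro!: bexI[of _ 1])
      qed
      show "c k * elem_mono 1 n k x = c k * elem_mono 2 n k x" if k: "k \<in> U_index n g" for k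
      proof -
        have "k 1 = 0" using k by (auto simp: U_index_def)
        then show ?thesis using elem_mono_drop_first[of k 1 n x] by (simp add: numeral_2_eq_2)
      qed
    qed simp
    finally show ?thesis .
  qed
  then show ?thesis by blast
qed


section \<open>The product of the subset sums\<close>

text \<open>
On the hyperplane the sums over a set and over its complement differ by a sign; the condition
$1\in A$ selects one set of each complementary pair.
\<close>

definition proper_sets :: "nat \<Rightarrow> nat set set" where
  "proper_sets n = {A. A \<subseteq> {1..n} \<and> 1 \<in> A \<and> A \<noteq> {1..n}}"

text \<open>
For $j=1$ these are the proper subsets containing $1$ without $\{1\}$ and the complements of single
elements. The distinguished element $j$ is a parameter because a permutation moves it.
\<close>

definition middle_sets :: "nat \<Rightarrow> nat \<Rightarrow> nat set set" where
  "middle_sets n j = {A. A \<subseteq> {1..n} \<and> j \<in> A \<and> 2 \<le> card A \<and> card A + 2 \<le> n}"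

definition subset_product :: "nat set set \<Rightarrow> (nat \<Rightarrow> complex) \<Rightarrow> complex" where
  "subset_product J x = (\<Prod>A\<in>J. partial_sum A x)"

abbreviation middle_product :: "nat \<Rightarrow> (nat \<Rightarrow> complex) \<Rightarrow> complex" where
  "middle_product n \<equiv> subset_product (middle_sets n 1)"

definition cosingletons :: "nat \<Rightarrow> nat set set" where
  "cosingletons n = (\<lambda>j. {1..n} - {j}) ` {2..n}"

lemma finite_subset_families [simp]:
  "finite (proper_sets n)" "finite (middle_sets n j)" "finite (cosingletons n)"
  by (auto simp: proper_sets_def middle_sets_def cosingletons_def
      intro: finite_subset[of _ "Pow {1..n}"])

lemma cosingleton_iff:
  assumes "n \<ge> 2"
  shows "A \<in> cosingletons n \<longleftrightarrow> A \<subseteq> {1..n} \<and> 1 \<in> A \<and> Suc (card A) = n"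
proof
  assume "A \<in> cosingletons n"
  then show "A \<subseteq> {1..n} \<and> 1 \<in> A \<and> Suc (card A) = n"
    using assms by (auto simp: cosingletons_def)
next
  assume A: "A \<subseteq> {1..n} \<and> 1 \<in> A \<and> Suc (card A) = n"
  then have "card ({1..n} - A) = 1"
    by (subst card_Diff_subset) (auto intro: finite_subset)
  then obtain j where "{1..n} - A = {j}" by (auto simp: card_1_singleton_iff)
  then have "A = {1..n} - {j}" "j \<in> {1..n}" "j \<noteq> 1" using A by blast+
  then show "A \<in> cosingletons n" by (auto simp: cosingletons_def intro!: image_eqI[of _ _ j])
qed

lemma inj_on_cosingleton: "inj_on (\<lambda>j. {1..n} - {j}) {2..n::nat}"
proof (rule inj_onI)
  fix i j assume "i \<in> {2..n}" and eq: "{1..n} - {i} = {1..n} - {j}"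
  then have "i \<in> {1..n}" by simp
  moreover have "i \<notin> {1..n} - {j}" using eq by blast
  ultimately show "i = j" by blast
qed

lemma card_cosingletons: "card (cosingletons n) = n - 1"
  using card_image[OF inj_on_cosingleton] by (simp add: cosingletons_def)

text \<open>
On the hyperplane the sum over the complement of $j$ is $-\lambda_j$.
\<close>

lemma subset_product_cosingletons:
  assumes "x \<in> zero_sum n" "n \<ge> 1"
  shows "x 1 * subset_product (cosingletons n) x = (- 1) ^ (n - 1) * elem_sym n n x"
proof -
  have "subset_product (cosingletons n) x = (\<Prod>j=2..n. partial_sum ({1..n} - {j}) x)"
    unfolding subset_product_def cosingletons_def prod.reindex[OF inj_on_cosingleton] comp_def ..
  also have "\<dots> = (\<Prod>j=2..n. - 1 * x j)"
    using assms(1) by (intro prod.cong) (simp_all add: sum_diff1 zero_sum_def)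
  also have "\<dots> = (- 1) ^ (n - 1) * (\<Prod>j=2..n. x j)"
    by (subst prod.distrib) simp
  finally show ?thesis
    using assms(2) by (simp add: elem_sym_n prod.atLeast_Suc_atMost numeral_2_eq_2)
qed

lemma proper_sets_decomposition:
  assumes "n \<ge> 3"
  shows "proper_sets n = insert {1} (cosingletons n \<union> middle_sets n 1)"
    and "cosingletons n \<inter> middle_sets n 1 = {}"
    and "{1} \<notin> cosingletons n" and "{1} \<notin> middle_sets n 1"
proof -
  have iff: "A \<in> proper_sets n \<longleftrightarrow> A = {1} \<or> A \<in> cosingletons n \<or> A \<in> middle_sets n 1" for A
  proof (cases "A \<subseteq> {1..n} \<and> 1 \<in> A")
    case True
    then have fin: "finite A" using finite_subset by blast
    have "card A \<noteq> 0" using True fin by auto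
    moreover have "A = {1} \<longleftrightarrow> card A = 1" using True by (auto simp: card_1_singleton_iff)
    moreover have "card A \<le> n" using card_mono[of "{1..n}" A] True by simp
    moreover have "card A = n \<longleftrightarrow> A = {1..n}" using card_subset_eq[of "{1..n}" A] True by auto
    moreover have "A \<in> proper_sets n \<longleftrightarrow> A \<noteq> {1..n}" using True by (simp add: proper_sets_def)
    moreover have "A \<in> cosingletons n \<longleftrightarrow> Suc (card A) = n" using True assms by (simp add: cosingleton_iff)
    moreover have "A \<in> middle_sets n 1 \<longleftrightarrow> 2 \<le> card A \<and> card A + 2 \<le> n"
      using True by (simp add: middle_sets_def)
    ultimately show ?thesis using assms by linarith
  next
    case False
    then show ?thesis
      using assms cosingleton_iff[of n A] by (auto simp: proper_sets_def middle_sets_def)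
  qed
  then show "proper_sets n = insert {1} (cosingletons n \<union> middle_sets n 1)" by blast
  show "cosingletons n \<inter> middle_sets n 1 = {}"
    using assms by (auto simp: cosingleton_iff middle_sets_def)
  show "{1} \<notin> cosingletons n" "{1} \<notin> middle_sets n 1"
    using assms by (auto simp: cosingleton_iff middle_sets_def)
qed

text \<open>
The singleton and the complements of single elements contribute $\lambda_1$ and the $-\lambda_j$ for
$j\ge2$, together $\pm e_n$.
\<close>

lemma proper_sets_middle:
  assumes "n \<ge> 3"
  shows "card (proper_sets n) = n + card (middle_sets n 1)"
    and "x \<in> zero_sum n \<Longrightarrow> subset_product (proper_sets n) x =
      (- 1) ^ (n - 1) * (elem_sym n n x * middle_product n x)"
proof -
  note d = proper_sets_decomposition[OF assms]
  show "card (proper_sets n) = n + card (middle_sets n 1)"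
    unfolding d(1) using d(2-4) assms by (simp add: card_Un_disjoint card_cosingletons)
  assume x: "x \<in> zero_sum n"
  have "subset_product (proper_sets n) x =
      (x 1 * subset_product (cosingletons n) x) * middle_product n x"
    unfolding d(1) subset_product_def using d(2-4) by (simp add: prod.union_disjoint)
  then show "subset_product (proper_sets n) x =
      (- 1) ^ (n - 1) * (elem_sym n n x * middle_product n x)"
    using subset_product_cosingletons[OF x] assms by simp
qed

lemma middle_sets_Suc_decomposition:
  assumes "n \<ge> 3"
  shows "middle_sets (Suc n) 1 = (cosingletons n \<union> middle_sets n 1) \<union>
      insert (Suc n) ` (insert {1} (middle_sets n 1))"
proof -
  have "A \<in> middle_sets (Suc n) 1 \<longleftrightarrow> A \<in> cosingletons n \<or> A \<in> middle_sets n 1 \<or>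
      A \<in> insert (Suc n) ` (insert {1} (middle_sets n 1))" for A
  proof (cases "Suc n \<in> A")
    case False
    then have sub: "A \<subseteq> {1..Suc n} \<longleftrightarrow> A \<subseteq> {1..n}" by (auto simp: atLeastAtMostSuc_conv)
    show ?thesis
      using False assms cosingleton_iff[of n A] unfolding middle_sets_def mem_Collect_eq sub
      by auto
  next
    case True
    define B where "B = A - {Suc n}"
    have A: "A = insert (Suc n) B" "Suc n \<notin> B" using True by (auto simp: B_def)
    have image: "A \<in> insert (Suc n) ` X \<longleftrightarrow> B \<in> X" if "\<And>C. C \<in> X \<Longrightarrow> Suc n \<notin> C" for X
      using A that by (auto simp: insert_ident)
    have "Suc n \<notin> C" if "C \<in> insert {1} (middle_sets n 1)" for C
      using that assms by (auto simp: middle_sets_def)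
    from image[of "insert {1} (middle_sets n 1)", OF this]
    have *: "A \<in> insert (Suc n) ` (insert {1} (middle_sets n 1)) \<longleftrightarrow>
        B = {1} \<or> B \<in> middle_sets n 1"
      by (simp only: insert_iff)
    have "A \<notin> cosingletons n" "A \<notin> middle_sets n 1"
      using True by (auto simp: cosingletons_def middle_sets_def)
    moreover have "A \<in> middle_sets (Suc n) 1 \<longleftrightarrow> B = {1} \<or> B \<in> middle_sets n 1"
    proof (cases "B \<subseteq> {1..n} \<and> 1 \<in> B")
      case True
      then have fin: "finite B" using finite_subset by blast
      have "card B \<noteq> 0" using True fin by auto
      moreover have "card B = 1 \<longleftrightarrow> B = {1}" using True by (auto simp: card_1_singleton_iff)
      moreover have "card A = Suc (card B)" using A fin by simp
      moreover have "A \<subseteq> {1..Suc n}" "1 \<in> A" using True A(1) by auto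
      ultimately show ?thesis using True assms by (auto simp: middle_sets_def)
    next
      case False
      have "\<not> (A \<subseteq> {1..Suc n} \<and> 1 \<in> A)" using False A assms by (auto simp: atLeastAtMostSuc_conv)
      then show ?thesis using False assms by (auto simp: middle_sets_def)
    qed
    ultimately show ?thesis using * by blast
  qed
  then show ?thesis by blast
qed

text \<open>
If the last variable is $0$, then $A$ and $A\cup\{n+1\}$ give the same sum. So every middle subset of
$\{1,\ldots,n\}$ is counted twice, while $\{1\}$ and the complements of single elements, which are
too small or too large in one of the two roles, are counted once.
\<close>

lemma middle_sets_Suc:
  assumes "n \<ge> 3"
  shows "card (middle_sets (Suc n) 1) = n + (card (middle_sets n 1) + card (middle_sets n 1))"
    and "x \<in> zero_sum n \<Longrightarrow> x (Suc n) = 0 \<Longrightarrow> subset_product (middle_sets (Suc n) 1) x =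
      (- 1) ^ (n - 1) * (elem_sym n n x *
        (middle_product n x * middle_product n x))"
proof -
  note d = proper_sets_decomposition[OF assms]
  note e = middle_sets_Suc_decomposition[OF assms]
  let ?X = "cosingletons n \<union> middle_sets n 1" and ?Y = "insert {1} (middle_sets n 1)"
  have Y: "Suc n \<notin> A \<and> finite A" if "A \<in> ?Y" for A
    using that assms by (auto simp: middle_sets_def intro: finite_subset)
  have inj: "inj_on (insert (Suc n)) ?Y"
    using Y by (intro inj_onI) (metis insert_ident)
  have "Suc n \<notin> A" if "A \<in> ?X" for A
    using that by (auto simp: cosingletons_def middle_sets_def)
  then have disj: "?X \<inter> insert (Suc n) ` ?Y = {}" by blast
  show "card (middle_sets (Suc n) 1) = n + (card (middle_sets n 1) + card (middle_sets n 1))"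
    unfolding e using disj inj d(2-4) assms
    by (simp add: card_Un_disjoint card_image card_cosingletons del: image_insert)
  assume x: "x \<in> zero_sum n" "x (Suc n) = 0"
  have "subset_product (middle_sets (Suc n) 1) x =
      subset_product ?X x * subset_product (insert (Suc n) ` ?Y) x"
    unfolding e subset_product_def using disj by (intro prod.union_disjoint) auto
  also have "subset_product (insert (Suc n) ` ?Y) x = subset_product ?Y x"
    unfolding subset_product_def prod.reindex[OF inj] comp_def
    using Y x(2) by (intro prod.cong refl) simp
  also have "\<dots> = x 1 * middle_product n x"
    using d(4) by (simp add: subset_product_def)
  also have "subset_product ?X x =
      subset_product (cosingletons n) x * middle_product n x"
    unfolding subset_product_def using d(2) by (intro prod.union_disjoint) auto
  finally have "subset_product (middle_sets (Suc n) 1) x =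
      (x 1 * subset_product (cosingletons n) x) *
        (middle_product n x * middle_product n x)"
    by (simp add: mult_ac)
  then show "subset_product (middle_sets (Suc n) 1) x = (- 1) ^ (n - 1) * (elem_sym n n x *
        (middle_product n x * middle_product n x))"
    using subset_product_cosingletons[OF x(1)] assms by simp
qed

lemma homogeneous_subset_product:
  assumes "\<And>A. A \<in> J \<Longrightarrow> A \<subseteq> {1..n}"
  shows "homogeneous n (card J) (subset_product J)"
  using homogeneous_prod[of J n "\<lambda>_. 1" partial_sum, OF homogeneous_partial_sum] assms
  by (simp add: subset_product_def[abs_def])

text \<open>
The sets are paired by the involution that fixes the membership of $j$ and of $1$ and complements
everything else; it has no fixed point because it changes the membership of a third element $t$.
\<close>

lemma even_separating_subsets:
  assumes "n \<ge> 3" "j \<in> {1..n}" "j \<noteq> 1"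
  shows "even (card {A \<in> middle_sets n j. 1 \<notin> A})"
proof -
  let ?S = "{A \<in> middle_sets n j. 1 \<notin> A}"
  \<comment> \<open>The third element exists because of $n\ge3$.\<close>
  have "card {1, j} < card {1..n}" using assms by simp
  then obtain t where t: "t \<in> {1..n}" "t \<noteq> 1" "t \<noteq> j"
    using card_mono[of "{1, j}" "{1..n}"] by fastforce
  let ?c = "\<lambda>A. insert j ({1..n} - {1} - A)"
  have c: "?c A \<in> ?S \<and> ?c (?c A) = A \<and> (t \<in> ?c A \<longleftrightarrow> t \<notin> A)" if "A \<in> ?S" for A
  proof -
    have A: "A \<subseteq> {1..n} - {1}" "j \<in> A" "2 \<le> card A" "card A + 2 \<le> n"
      using that by (auto simp: middle_sets_def)
    have "finite A" using A(1) by (rule finite_subset) simp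
    from card_Diff_subset[OF this A(1)] have "card ({1..n} - {1} - A) = n - 1 - card A"
      using assms by simp
    then have "card (?c A) = Suc (n - 1 - card A)" using A(2) by simp
    then show ?thesis using A assms t by (auto simp: middle_sets_def)
  qed
  have "bij_betw ?c {A \<in> ?S. t \<in> A} {A \<in> ?S. t \<notin> A}"
    by (rule bij_betw_byWitness[where f' = ?c]) (use c in blast)+
  then have "card {A \<in> ?S. t \<in> A} = card {A \<in> ?S. t \<notin> A}" by (rule bij_betw_same_card)
  moreover have "card ?S = card {A \<in> ?S. t \<in> A} + card {A \<in> ?S. t \<notin> A}"
    by (subst card_Un_disjoint[symmetric]) (auto intro: arg_cong[of _ _ card])
  ultimately show ?thesis by simp
qed

text \<open>
Sets containing $j$ but not $1$ have to be replaced by their complements, each at the cost of a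
sign; the number of these sets is even.
\<close>

lemma subset_product_middle_independent:
  assumes "n \<ge> 3" "j \<in> {1..n}" and x: "x \<in> zero_sum n"
  shows "subset_product (middle_sets n j) x = middle_product n x"
proof (cases "j = 1")
  case False
  let ?B = "{A \<in> middle_sets n j. 1 \<notin> A}" and ?C = "{A \<in> middle_sets n 1. j \<notin> A}"
  let ?D = "{A \<in> middle_sets n 1. j \<in> A}"
  have compl: "partial_sum ({1..n} - A) x = - 1 * partial_sum A x" if "A \<subseteq> {1..n}" for A
    using x that sum_diff[of "{1..n}" A x] by (simp add: zero_sum_def)
  have "subset_product ?C x = (\<Prod>A\<in>?B. - 1 * partial_sum A x)"
    unfolding subset_product_def
  proof (rule prod.reindex_bij_witness[of _ "\<lambda>A. {1..n} - A" "\<lambda>A. {1..n} - A"])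
    have card: "card ({1..n} - A) = n - card A" if "A \<subseteq> {1..n}" for A
      using that by (subst card_Diff_subset) (auto intro: finite_subset)
    show "{1..n} - A \<in> ?B" if "A \<in> ?C" for A
      using that assms by (auto simp: middle_sets_def card simp del: One_nat_def)
    show "{1..n} - A \<in> ?C" if "A \<in> ?B" for A
      using that assms by (auto simp: middle_sets_def card simp del: One_nat_def)
    show "- 1 * partial_sum ({1..n} - A) x = partial_sum A x" if "A \<in> ?C" for A
      using compl[of A] that by (simp add: middle_sets_def)
  qed (auto simp: middle_sets_def)
  also have "\<dots> = (- 1) ^ card ?B * subset_product ?B x"
    unfolding subset_product_def by (subst prod.distrib) simp
  finally have C: "subset_product ?C x = subset_product ?B x"
    using even_separating_subsets[OF assms(1,2) False] by simp
  have split: "middle_sets n j = ?B \<union> ?D" "middle_sets n 1 = ?C \<union> ?D"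
    by (auto simp: middle_sets_def)
  have "subset_product (?B \<union> ?D) x = subset_product ?B x * subset_product ?D x"
    unfolding subset_product_def
    by (rule prod.union_disjoint) (auto simp: middle_sets_def)
  moreover have "subset_product (?C \<union> ?D) x = subset_product ?C x * subset_product ?D x"
    unfolding subset_product_def
    by (rule prod.union_disjoint) (auto simp: middle_sets_def)
  ultimately have "subset_product (?B \<union> ?D) x = subset_product (?C \<union> ?D) x" using C by simp
  then show ?thesis unfolding split(1)[symmetric] split(2)[symmetric] .
qed simp

lemma subset_product_middle_symmetric:
  assumes "n \<ge> 3"
  shows "symmetric_on n (zero_sum n) (middle_product n)"
  unfolding symmetric_on_def
proof (intro allI impI)
  fix p x assume p: "p permutes {1..n}" and x: "x \<in> zero_sum n"
  have inj: "inj p" "inj (inv p)" using p permutes_inj permutes_inv by blast+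
  have "middle_product n (x \<circ> p) = subset_product (middle_sets n (p 1)) x"
    unfolding subset_product_def
  proof (rule prod.reindex_bij_witness[of _ "image (inv p)" "image p"])
    fix A
    show "inv p ` p ` A = A" "p ` inv p ` A = A"
      using permutes_inverses[OF p] by (auto simp: image_image)
    show "p ` A \<in> middle_sets n (p 1)" if "A \<in> middle_sets n 1"
      using that permutes_in_image[OF p] inj
      by (auto simp: middle_sets_def card_image inj_on_subset[of p UNIV])
    show "inv p ` A \<in> middle_sets n 1" if "A \<in> middle_sets n (p 1)"
      using that permutes_in_image[OF permutes_inv[OF p]] inj permutes_inverses[OF p]
      by (auto simp: middle_sets_def card_image inj_on_subset[of "inv p" UNIV]
          intro: image_eqI[of _ _ "p 1"])
    show "partial_sum (p ` A) x = partial_sum A (x \<circ> p)"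
      using inj by (subst sum.reindex) (auto simp: inj_on_subset[of p UNIV])
  qed
  also have "\<dots> = middle_product n x"
    using assms permutes_in_image[OF p, of 1]
    by (intro subset_product_middle_independent x) auto
  finally show "middle_product n (x \<circ> p) = middle_product n x" .
qed

lemma subset_product_proper_symmetric:
  assumes "n \<ge> 3"
  shows "symmetric_on n (zero_sum n) (subset_product (proper_sets n))"
  using subset_product_middle_symmetric[OF assms] proper_sets_middle(2)[OF assms]
    permuted_zero_sum
  by (auto simp: symmetric_on_def elem_sym_permuted)

lemma initial_segment_permutation:
  assumes "A \<subseteq> {1..n}"
  obtains p where "p permutes {1..n}" "p ` {1..card A} = A"
proof -
  have fin: "finite A" using assms finite_subset by blast
  have le: "card A \<le> n" using card_mono[OF _ assms] by simp
  obtain f where f: "bij_betw f {1..card A} A"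
    using finite_same_card_bij[of "{1..card A}" A] fin by auto
  have "card {Suc (card A)..n} = card ({1..n} - A)"
    using assms fin by (simp add: card_Diff_subset)
  then obtain g where g: "bij_betw g {Suc (card A)..n} ({1..n} - A)"
    using finite_same_card_bij[of "{Suc (card A)..n}" "{1..n} - A"] by auto
  define p where "p = (\<lambda>i. if i \<in> {1..card A} then f i else if i \<in> {1..n} then g i else i)"
  have f': "bij_betw p {1..card A} A"
    using f by (rule bij_betw_cong[THEN iffD1, rotated]) (simp add: p_def)
  have g': "bij_betw p {Suc (card A)..n} ({1..n} - A)"
    using g by (rule bij_betw_cong[THEN iffD1, rotated]) (simp add: p_def)
  have "bij_betw p ({1..card A} \<union> {Suc (card A)..n}) (A \<union> ({1..n} - A))"
    by (rule bij_betw_combine[OF f' g']) auto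
  moreover have "{1..card A} \<union> {Suc (card A)..n} = {1..n}" "A \<union> ({1..n} - A) = {1..n}"
    using le assms by auto
  ultimately have "bij_betw p {1..n} {1..n}" by simp
  then have "p permutes {1..n}"
    by (rule bij_imp_permutes) (use le in \<open>auto simp: p_def\<close>)
  moreover have "p ` {1..card A} = A" using f' by (simp add: bij_betw_def)
  ultimately show thesis by (rule that)
qed

text \<open>
Symmetry carries the vanishing from the initial segments to all subsets. The
pairwise distinctness of the hyperplanes is witnessed by vectors with entries $1$ and $-1$ at two
places, one inside and one outside of the subset in question.
\<close>

lemma divide_by_subset_product:
  assumes n: "n \<ge> 3" and f: "homogeneous n g f"
    and sym: "symmetric_on n (zero_sum n) f"
    and zero: "\<And>h x. h \<in> {1..<n} \<Longrightarrow> x \<in> zero_sum n \<Longrightarrow> partial_sum {1..h} x = 0 \<Longrightarrow> f x = 0"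
  shows "\<exists>c. \<forall>x\<in>zero_sum n. f x = (if card (proper_sets n) \<le> g
    then \<Sum>m\<in>U_index n (g - card (proper_sets n)).
      c m * (subset_product (proper_sets n) x * elem_mono 2 n m x) else 0)"
proof -
  let ?H = "zero_sum n" and ?Q = "proper_sets n"
  have diff: "(\<lambda>i. (if i = a then 1 else 0) - (if i = b then 1 else 0)) \<in> ?H"
    if "a \<in> {1..n}" "b \<in> {1..n}" for a b
    using that by (simp add: zero_sum_def sum_subtractf)
  have diff_sum: "partial_sum A (\<lambda>i. (if i = a then 1 else 0) - (if i = b then 1 else 0)) =
      (if a \<in> A then 1 else 0) - (if b \<in> A then 1 else 0)" if "A \<subseteq> {1..n}" for A a b
    using finite_subset[OF that] by (simp add: sum_subtractf)
  have "\<exists>q. homogeneous n (g - card ?Q) q \<and> (g < card ?Q \<longrightarrow> q = (\<lambda>x. 0)) \<and>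
    (\<forall>x\<in>?H. f x = (\<Prod>A\<in>?Q. partial_sum A x) * q x)"
  proof (rule homogeneous_divide_linear_forms[OF _ f linear_subset_zero_sum])
    show "A \<subseteq> {1..n}" if "A \<in> ?Q" for A using that by (simp add: proper_sets_def)
    show "\<exists>v\<in>?H. partial_sum A v = 1" if A: "A \<in> ?Q" for A
    proof -
      obtain b where b: "b \<in> {1..n}" "b \<notin> A"
        using A unfolding proper_sets_def by blast
      have "1 \<in> {1..n}" using n by simp
      then show ?thesis
        using diff[OF _ b(1), of 1] diff_sum[of A 1 b] A b
        by (intro bexI[OF _ diff[OF _ b(1), of 1]]) (auto simp: proper_sets_def)
    qed
    show "\<exists>w\<in>?H. partial_sum A w = 0 \<and> partial_sum B w \<noteq> 0"
      if A: "A \<in> ?Q" and B: "B \<in> ?Q" and ne: "A \<noteq> B" for A B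
    proof -
      obtain c where c: "c \<in> {1..n}" "c \<notin> B"
        using B unfolding proper_sets_def by blast
      obtain a b where ab: "a \<in> {1..n}" "b \<in> {1..n}" "a \<in> A \<longleftrightarrow> b \<in> A" "a \<in> B" "b \<notin> B"
      proof (cases "A \<subseteq> B")
        case True
        then obtain a where "a \<in> B" "a \<notin> A" using ne by blast
        moreover have "c \<notin> A" using c True by blast
        moreover have "B \<subseteq> {1..n}" using B by (simp add: proper_sets_def)
        ultimately show ?thesis using that[of a c] c by blast
      next
        case False
        then obtain b where "b \<in> A" "b \<notin> B" by blast
        then show ?thesis using that[of 1 b] A B n by (auto simp: proper_sets_def)
      qed
      then show ?thesis
        using diff_sum[of A a b] diff_sum[of B a b] A B
        by (intro bexI[OF _ diff[OF ab(1,2)]]) (auto simp: proper_sets_def)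
    qed
    show "f x = 0" if A: "A \<in> ?Q" and x: "x \<in> ?H" "partial_sum A x = 0" for A x
    proof -
      have sub: "A \<subset> {1..n}" "1 \<in> A" using A by (auto simp: proper_sets_def)
      obtain p where p: "p permutes {1..n}" "p ` {1..card A} = A"
        using initial_segment_permutation[of A n] sub by blast
      have "card A < n" using psubset_card_mono[OF _ sub(1)] by simp
      moreover have "card A \<noteq> 0" using sub finite_subset[of A "{1..n}"] by auto
      moreover have "partial_sum {1..card A} (x \<circ> p) = partial_sum (p ` {1..card A}) x"
        by (rule sum.reindex[symmetric]) (rule inj_on_subset[OF permutes_inj[OF p(1)]], simp)
      ultimately have "f (x \<circ> p) = 0"
        using p(2) x(2) by (intro zero[of "card A"] permuted_zero_sum[OF p(1) x(1)]) auto
      then show ?thesis using sym p(1) x(1) by (simp add: symmetric_on_def)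
    qed
  qed simp
  then obtain q where q: "homogeneous n (g - card ?Q) q" "g < card ?Q \<longrightarrow> q = (\<lambda>x. 0)"
    "\<And>x. x \<in> ?H \<Longrightarrow> f x = subset_product ?Q x * q x" unfolding subset_product_def by blast
  from symmetric_quotient[OF q(1) sym subset_product_proper_symmetric[OF n]
      permuted_zero_sum q(3)]
  obtain q' where q': "homogeneous n (g - card ?Q) q'" "symmetric_on n UNIV q'"
    "q = (\<lambda>x. 0) \<longrightarrow> q' = (\<lambda>x. 0)" "\<And>x. x \<in> ?H \<Longrightarrow> f x = subset_product ?Q x * q' x" by blast
  have "symmetric_on n ?H q'" using q'(2) by (simp add: symmetric_on_def)
  from symmetric_expansion_on_zero_sum[OF q'(1) this]
  obtain c where c: "\<And>x. x \<in> ?H \<Longrightarrow>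
    q' x = (\<Sum>k\<in>U_index n (g - card ?Q). c k * elem_mono 2 n k x)" by blast
  have "f x = (if card ?Q \<le> g then \<Sum>m\<in>U_index n (g - card ?Q).
      c m * (subset_product ?Q x * elem_mono 2 n m x) else 0)" if x: "x \<in> ?H" for x
  proof (cases "card ?Q \<le> g")
    case True
    then show ?thesis using q'(4)[OF x] c[OF x] by (simp add: sum_distrib_left mult_ac)
  next
    case False
    then show ?thesis using q'(3,4) q(2) x by simp
  qed
  then show ?thesis by blast
qed


section \<open>Leading exponents\<close>

definition tuple_order :: "(nat \<Rightarrow> nat) \<Rightarrow> nat \<Rightarrow> (nat \<Rightarrow> nat) \<Rightarrow> nat" where
  "tuple_order \<omega> n k = (\<Sum>i=2..n. \<omega> i * k i)"

lemma tuple_order_add: "tuple_order \<omega> n (\<lambda>i. k i + l i) = tuple_order \<omega> n k + tuple_order \<omega> n l"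
  by (simp add: tuple_order_def sum.distrib distrib_left)

text \<open>
The weight $\omega$ has to make $\mu$ the unique lightest exponent. Strictness for this one exponent
is what triangularity uses; $\omega$ may have ties elsewhere, and it is chosen to suit $f$.
\<close>

definition leading_coeffs ::
  "nat \<Rightarrow> nat \<Rightarrow> (nat \<Rightarrow> nat) \<Rightarrow> ((nat \<Rightarrow> complex) \<Rightarrow> complex) \<Rightarrow> (nat \<Rightarrow> nat) \<Rightarrow>
    ((nat \<Rightarrow> nat) \<Rightarrow> complex) \<Rightarrow> bool" where
  "leading_coeffs n d \<omega> f \<mu> c \<longleftrightarrow>
    (\<forall>x\<in>zero_sum n. f x = (\<Sum>k\<in>U_index n d. c k * elem_mono 2 n k x)) \<and>
    \<mu> \<in> U_index n d \<and> c \<mu> \<noteq> 0 \<and>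
    (\<forall>k\<in>U_index n d. c k \<noteq> 0 \<longrightarrow> k \<noteq> \<mu> \<longrightarrow> tuple_order \<omega> n \<mu> < tuple_order \<omega> n k)"

definition leading_exponent ::
  "nat \<Rightarrow> nat \<Rightarrow> (nat \<Rightarrow> nat) \<Rightarrow> ((nat \<Rightarrow> complex) \<Rightarrow> complex) \<Rightarrow> (nat \<Rightarrow> nat) \<Rightarrow> bool" where
  "leading_exponent n d \<omega> f \<mu> \<longleftrightarrow> (\<exists>c. leading_coeffs n d \<omega> f \<mu> c)"

lemma leading_exponent_elem_mono:
  assumes "k \<in> U_index n d"
  shows "leading_exponent n d \<omega> (elem_mono 2 n k) k"
  unfolding leading_exponent_def leading_coeffs_def
  using assms by (intro exI[of _ "\<lambda>l. if l = k then 1 else 0"])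
    (auto simp: if_distrib[of "\<lambda>c. c * _"] cong: if_cong)

lemma leading_exponent_scale:
  assumes "leading_exponent n d \<omega> f \<mu>" "b \<noteq> 0"
  shows "leading_exponent n d \<omega> (\<lambda>x. b * f x) \<mu>"
proof -
  obtain c where "leading_coeffs n d \<omega> f \<mu> c"
    using assms(1) by (auto simp: leading_exponent_def)
  then have "leading_coeffs n d \<omega> (\<lambda>x. b * f x) \<mu> (\<lambda>k. b * c k)"
    using assms(2) by (auto simp: leading_coeffs_def sum_distrib_left mult_ac)
  then show ?thesis by (auto simp: leading_exponent_def)
qed

lemma leading_exponent_cong:
  "leading_exponent n d \<omega> f \<mu> \<Longrightarrow> (\<And>x. x \<in> zero_sum n \<Longrightarrow> f x = g x) \<Longrightarrow>
    leading_exponent n d \<omega> g \<mu>"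
  by (auto simp: leading_exponent_def leading_coeffs_def)

text \<open>
Only the pair of the two lightest exponents contributes to the sum of these exponents, because
weights add up.
\<close>

lemma leading_exponent_mult:
  assumes "leading_exponent n d \<omega> f \<mu>" "leading_exponent n d' \<omega> g \<nu>"
  shows "leading_exponent n (d + d') \<omega> (\<lambda>x. f x * g x) (\<lambda>i. \<mu> i + \<nu> i)"
proof -
  obtain a where a: "leading_coeffs n d \<omega> f \<mu> a"
    using assms(1) by (auto simp: leading_exponent_def)
  obtain b where b: "leading_coeffs n d' \<omega> g \<nu> b"
    using assms(2) by (auto simp: leading_exponent_def)
  let ?S = "\<lambda>m. {p \<in> U_index n d \<times> U_index n d'. (\<lambda>i. fst p i + snd p i) = m}"
  define c where "c = (\<lambda>m. \<Sum>(k, l)\<in>?S m. a k * b l)"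
  have U: "\<mu> \<in> U_index n d" "\<nu> \<in> U_index n d'" "(\<lambda>i. \<mu> i + \<nu> i) \<in> U_index n (d + d')"
    using a b graded_tuples_add[of \<mu> 2 n d \<nu> d']
    by (auto simp: leading_coeffs_def U_index_weighted)
  have fin: "finite (?S m)" for m by simp
  have ge: "tuple_order \<omega> n \<mu> \<le> tuple_order \<omega> n k \<and> tuple_order \<omega> n \<nu> \<le> tuple_order \<omega> n l \<and>
      (tuple_order \<omega> n (\<lambda>i. k i + l i) \<le> tuple_order \<omega> n (\<lambda>i. \<mu> i + \<nu> i) \<longrightarrow> k = \<mu> \<and> l = \<nu>)"
    if "k \<in> U_index n d" "l \<in> U_index n d'" "a k * b l \<noteq> 0" for k l
  proof -
    have "k = \<mu> \<or> tuple_order \<omega> n \<mu> < tuple_order \<omega> n k"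
      using a that by (auto simp: leading_coeffs_def)
    moreover have "l = \<nu> \<or> tuple_order \<omega> n \<nu> < tuple_order \<omega> n l"
      using b that by (auto simp: leading_coeffs_def)
    ultimately show ?thesis by (auto simp: tuple_order_add)
  qed
  have "f x * g x = (\<Sum>m\<in>U_index n (d + d'). c m * elem_mono 2 n m x)"
    if x: "x \<in> zero_sum n" for x
  proof -
    have "(\<Sum>k\<in>U_index n d. a k * elem_mono 2 n k x) *
        (\<Sum>l\<in>U_index n d'. b l * elem_mono 2 n l x) =
      (\<Sum>m\<in>U_index n (d + d'). (\<Sum>(k, l)\<in>{p \<in> U_index n d \<times> U_index n d'.
        (\<lambda>k l i. k i + l i) (fst p) (snd p) = m}. a k * b l) * elem_mono 2 n m x)"
      by (rule sum_product_convolution)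
        (simp_all add: elem_mono_add graded_tuples_add U_index_weighted)
    then show ?thesis using a b x by (simp add: leading_coeffs_def c_def)
  qed
  moreover have "c (\<lambda>i. \<mu> i + \<nu> i) \<noteq> 0"
  proof -
    have "c (\<lambda>i. \<mu> i + \<nu> i) = (\<Sum>(k, l)\<in>{(\<mu>, \<nu>)}. a k * b l)"
      unfolding c_def
    proof (rule sum.mono_neutral_right)
      show "\<forall>p\<in>?S (\<lambda>i. \<mu> i + \<nu> i) - {(\<mu>, \<nu>)}. (case p of (k, l) \<Rightarrow> a k * b l) = 0"
      proof
        fix p assume p: "p \<in> ?S (\<lambda>i. \<mu> i + \<nu> i) - {(\<mu>, \<nu>)}"
        obtain k l where kl: "p = (k, l)" by (cases p)
        have "a k * b l = 0"
        proof (rule ccontr)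
          assume "a k * b l \<noteq> 0"
          then have "k = \<mu> \<and> l = \<nu>" using ge[of k l] p kl by auto
          then show False using p kl by simp
        qed
        then show "(case p of (k, l) \<Rightarrow> a k * b l) = 0" using kl by simp
      qed
    qed (use U fin in auto)
    then show ?thesis using a b by (auto simp: leading_coeffs_def)
  qed
  moreover have "tuple_order \<omega> n (\<lambda>i. \<mu> i + \<nu> i) < tuple_order \<omega> n m"
    if m: "c m \<noteq> 0" "m \<noteq> (\<lambda>i. \<mu> i + \<nu> i)" for m
  proof (rule ccontr)
    assume le: "\<not> ?thesis"
    have "(case p of (k, l) \<Rightarrow> a k * b l) = 0" if "p \<in> ?S m" for p
    proof (rule ccontr)
      assume nz: "(case p of (k, l) \<Rightarrow> a k * b l) \<noteq> 0"
      obtain k l where p: "p = (k, l)" by (cases p)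
      have "k = \<mu> \<and> l = \<nu>" using ge[of k l] that nz le p by auto
      then show False using that m(2) p by auto
    qed
    then have "c m = 0" unfolding c_def by (rule sum.neutral[OF ballI])
    then show False using m(1) by simp
  qed
  ultimately have "leading_coeffs n (d + d') \<omega> (\<lambda>x. f x * g x) (\<lambda>i. \<mu> i + \<nu> i) c"
    using U by (auto simp: leading_coeffs_def)
  then show ?thesis by (auto simp: leading_exponent_def)
qed

lemma leading_exponent_elem_sym_n:
  assumes "n \<ge> 2"
  shows "leading_exponent n n \<omega> (elem_sym n n) (\<lambda>i. if i = n then 1 else 0)"
proof -
  have e: "elem_mono 2 n (\<lambda>i. if i = n then 1 else 0) = elem_sym n n"
    using assms by (simp add: elem_mono_def fun_eq_iff if_distrib[of "\<lambda>j. _ ^ j"] cong: if_cong)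
  have "(\<lambda>i. if i = n then 1 else 0) \<in> U_index n n"
    using assms by (simp add: U_index_def if_distrib[of "\<lambda>j. _ * j"] cong: if_cong)
  from leading_exponent_elem_mono[OF this, of \<omega>] show ?thesis unfolding e .
qed

definition middle_tuple :: "nat \<Rightarrow> nat \<Rightarrow> nat" where
  "middle_tuple n i = (if 3 \<le> i \<and> i < n then 2 ^ (n - 1 - i) else 0)"

lemma middle_tuple_Suc:
  assumes "n \<ge> 3"
  shows "middle_tuple (Suc n) =
    (\<lambda>i. (if i = n then 1 else 0) + (middle_tuple n i + middle_tuple n i))"
proof
  fix i
  have "2 ^ (n - i) = (2::nat) * 2 ^ (n - Suc i)" if "i < n"
    using that by (simp add: Suc_diff_Suc flip: power_Suc)
  then show "middle_tuple (Suc n) i =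
      (if i = n then 1 else 0) + (middle_tuple n i + middle_tuple n i)"
    using assms by (auto simp: middle_tuple_def)
qed

text \<open>
The restriction to $\lambda_{n+1}=0$, where the product becomes $\pm e_n$ times a square, determines
the coefficients of the monomials without $e_{n+1}$. Giving the last index a weight larger than that
of the leading exponent makes all other monomials heavier.
\<close>

lemma leading_exponent_middle_product:
  assumes "n \<ge> 3"
  shows "\<exists>\<omega>. leading_exponent n (card (middle_sets n 1)) \<omega>
    (middle_product n) (middle_tuple n)"
  using assms
proof (induction n rule: nat_induct_at_least)
  case base
  have M: "middle_sets 3 1 = {}" by (auto simp: middle_sets_def)
  have t: "middle_tuple 3 = (\<lambda>_. 0)" by (auto simp: middle_tuple_def)
  have "(\<lambda>_. 0) \<in> U_index 3 0" by (simp add: U_index_def)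
  from leading_exponent_elem_mono[OF this, of "\<lambda>_. 0"] show ?case
    unfolding M t by (auto simp: subset_product_def[abs_def] elem_mono_def[abs_def])
next
  case (Suc n)
  let ?N = "Suc n" and ?P = "\<lambda>n. middle_product n"
  let ?d = "card (middle_sets ?N 1)"
  obtain \<omega> where \<omega>: "leading_exponent n (card (middle_sets n 1)) \<omega> (?P n) (middle_tuple n)"
    using Suc.IH by blast
  have "leading_exponent n ?d \<omega>
      (\<lambda>x. (- 1) ^ (n - 1) * (elem_sym n n x * (?P n x * ?P n x))) (middle_tuple ?N)"
    unfolding middle_tuple_Suc[OF Suc.hyps] middle_sets_Suc(1)[OF Suc.hyps]
    using Suc.hyps
    by (intro leading_exponent_scale leading_exponent_mult leading_exponent_elem_sym_n \<omega>) auto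
  then obtain a where a: "leading_coeffs n ?d \<omega>
      (\<lambda>x. (- 1) ^ (n - 1) * (elem_sym n n x * (?P n x * ?P n x))) (middle_tuple ?N) a"
    by (auto simp: leading_exponent_def)
  have hom: "homogeneous ?N ?d (?P ?N)"
    by (rule homogeneous_subset_product) (auto simp: middle_sets_def)
  have "symmetric_on ?N (zero_sum ?N) (?P ?N)"
    using Suc.hyps by (intro subset_product_middle_symmetric) simp
  from symmetric_expansion_on_zero_sum[OF hom this] obtain c where
    c: "\<And>x. x \<in> zero_sum ?N \<Longrightarrow> ?P ?N x = (\<Sum>k\<in>U_index ?N ?d. c k * elem_mono 2 ?N k x)"
    by blast
  have restrict: "k \<in> U_index n ?d \<longleftrightarrow> k \<in> U_index ?N ?d \<and> k ?N = 0" for k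
    using graded_tuples_restrict[of 2 n k ?d] Suc.hyps by (simp add: U_index_weighted)
  have c_eq: "c k = a k" if k: "k \<in> U_index n ?d" for k
  proof -
    have "c k - a k = 0"
    proof (rule elem_monos_independent[OF _ _ k])
      fix x assume x: "x \<in> zero_sum n"
      define y where "y = x(?N := 0)"
      have y: "y \<in> zero_sum ?N" "y \<in> zero_sum n" "y ?N = 0"
        using zero_sum_extend[OF x] by (auto simp: y_def zero_sum_def)
      have e: "elem_mono 2 ?N k y = elem_mono 2 n k x"
          "elem_mono 2 n k y = elem_mono 2 n k x"
        if "k \<in> U_index n ?d" for k
        using that elem_mono_extend[of k n ?d x] elem_mono_extend[of k n ?d y] Suc.hyps
        by (auto simp: U_index_weighted y_def)
      have "(\<Sum>k\<in>U_index n ?d. c k * elem_mono 2 n k x) =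
          (\<Sum>k\<in>U_index n ?d. c k * elem_mono 2 ?N k y)"
        by (intro sum.cong) (auto simp: e)
      also have "\<dots> = (\<Sum>k\<in>U_index ?N ?d. c k * elem_mono 2 ?N k y)"
      proof (rule sum.mono_neutral_left)
        show "\<forall>k\<in>U_index ?N ?d - U_index n ?d. c k * elem_mono 2 ?N k y = 0"
        proof
          fix k assume "k \<in> U_index ?N ?d - U_index n ?d"
          then have "k ?N \<noteq> 0" using restrict[of k] by simp
          moreover have "elem_sym ?N ?N y = 0" using y(3) by (simp add: elem_sym_n)
          ultimately have "elem_mono 2 ?N k y = 0"
            unfolding elem_mono_def using Suc.hyps
            by (intro prod_zero finite_atLeastAtMost bexI[of _ ?N]) simp_all
          then show "c k * elem_mono 2 ?N k y = 0" by simp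
        qed
      qed (auto simp: restrict simp del: One_nat_def)
      also have "\<dots> = ?P ?N y" using c[OF y(1)] by simp
      also have "\<dots> = (\<Sum>k\<in>U_index n ?d. a k * elem_mono 2 n k y)"
        using middle_sets_Suc(2)[OF Suc.hyps y(2,3)] a y(2) by (simp add: leading_coeffs_def)
      also have "\<dots> = (\<Sum>k\<in>U_index n ?d. a k * elem_mono 2 n k x)"
        by (intro sum.cong) (auto simp: e)
      finally show "(\<Sum>k\<in>U_index n ?d. (c k - a k) * elem_mono 2 n k x) = 0"
        by (simp add: left_diff_distrib sum_subtractf)
    qed (use Suc.hyps in simp)
    then show ?thesis by simp
  qed
  \<comment> \<open>The new last index is made heavier than the whole leading exponent.\<close>
  define \<omega>' where "\<omega>' = \<omega>(?N := Suc (tuple_order \<omega> n (middle_tuple ?N)))"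
  have low: "tuple_order \<omega>' ?N k = tuple_order \<omega> n k" if "k ?N = 0" for k
  proof -
    have "tuple_order \<omega>' n k = tuple_order \<omega> n k"
      unfolding tuple_order_def by (rule sum.cong) (auto simp: \<omega>'_def)
    then show ?thesis using that Suc.hyps by (simp add: tuple_order_def)
  qed
  have \<mu>: "middle_tuple ?N \<in> U_index n ?d" "middle_tuple ?N ?N = 0"
    using a by (auto simp: leading_coeffs_def middle_tuple_def)
  have "tuple_order \<omega>' ?N (middle_tuple ?N) < tuple_order \<omega>' ?N k"
    if k: "k \<in> U_index ?N ?d" "c k \<noteq> 0" "k \<noteq> middle_tuple ?N" for k
  proof (cases "k ?N = 0")
    case True
    then have "k \<in> U_index n ?d" using k(1) restrict[of k] by simp
    then show ?thesis
      using a k c_eq low[of k, OF True] low[of "middle_tuple ?N", OF \<mu>(2)] by (auto simp: leading_coeffs_def)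
  next
    case False
    have "\<omega>' ?N * 1 \<le> \<omega>' ?N * k ?N" using False by (intro mult_le_mono2) simp
    also have "\<dots> \<le> tuple_order \<omega>' ?N k" using Suc.hyps by (simp add: tuple_order_def)
    finally show ?thesis unfolding low[of "middle_tuple ?N", OF \<mu>(2)] by (simp add: \<omega>'_def)
  qed
  then have "leading_coeffs ?N ?d \<omega>' (?P ?N) (middle_tuple ?N) c"
    using c \<mu> restrict c_eq a by (auto simp: leading_coeffs_def simp del: One_nat_def)
  then show ?case by (auto simp: leading_exponent_def)
qed

lemma leading_exponent_subset_product:
  assumes "n \<ge> 3"
  shows "\<exists>\<omega>. leading_exponent n (card (proper_sets n)) \<omega>
    (subset_product (proper_sets n)) (min_tuple n)"
proof -
  obtain \<omega> where \<omega>: "leading_exponent n (card (middle_sets n 1)) \<omega>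
      (middle_product n) (middle_tuple n)"
    using leading_exponent_middle_product[OF assms] by blast
  have t: "min_tuple n = (\<lambda>i. (if i = n then 1 else 0) + middle_tuple n i)"
    by (auto simp: min_tuple_def middle_tuple_def)
  have "leading_exponent n (card (proper_sets n)) \<omega>
      (\<lambda>x. (- 1) ^ (n - 1) * (elem_sym n n x * middle_product n x)) (min_tuple n)"
    unfolding t proper_sets_middle(1)[OF assms] using assms
    by (intro leading_exponent_scale leading_exponent_mult leading_exponent_elem_sym_n \<omega>) auto
  from leading_exponent_cong[OF this proper_sets_middle(2)[OF assms, symmetric]]
  show ?thesis by blast
qed


section \<open>Linear functionals on the polynomial ring\<close>

lemma lookup_pscale [simp]: "lookup (pscale c p) m = c * lookup p m"
  unfolding pscale_def mconst_def mult_map_scale_conv_mult[symmetric] by (simp add: map.rep_eq when_def)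

lemma pscale_single [simp]: "pscale c (single m d) = single m (c * d)"
  by (rule poly_mapping_eqI) (simp add: lookup_single when_def)

lemma single_sum: "single m (\<Sum>i\<in>I. f i) = (\<Sum>i\<in>I. single m (f i))"
  by (induction I rule: infinite_finite_induct) (simp_all add: single_add)

lemma poly_mapping_sum_single:
  assumes "finite K" "keys p \<subseteq> K"
  shows "p = (\<Sum>m\<in>K. single m (lookup p m))"
proof (rule poly_mapping_eqI)
  fix k
  show "lookup p k =
      lookup (\<Sum>m\<in>K. single m (lookup p m)) k"
    using assms by (auto simp: lookup_sum lookup_single when_def in_keys_iff)
qed

definition functional :: "(apoly \<Rightarrow> complex) \<Rightarrow> bool" where
  "functional \<phi> \<longleftrightarrow> (\<forall>p q. \<phi> (p + q) = \<phi> p + \<phi> q) \<and> (\<forall>c p. \<phi> (pscale c p) = c * \<phi> p)"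

lemma functional_add: "functional \<phi> \<Longrightarrow> \<phi> (p + q) = \<phi> p + \<phi> q"
  and functional_scale: "functional \<phi> \<Longrightarrow> \<phi> (pscale c p) = c * \<phi> p"
  by (auto simp: functional_def)

lemma functional_zero: "functional \<phi> \<Longrightarrow> \<phi> 0 = 0"
  using functional_add[of \<phi> 0 0] by simp

lemma functional_sum: "functional \<phi> \<Longrightarrow> \<phi> (\<Sum>i\<in>I. f i) = (\<Sum>i\<in>I. \<phi> (f i))"
  by (induction I rule: infinite_finite_induct) (auto simp: functional_zero functional_add)

lemma functional_single:
  "functional \<phi> \<Longrightarrow> \<phi> (single m c) = c * \<phi> (single m 1)"
  using functional_scale[of \<phi> c "single m 1"] by simp

lemma functional_lookup: "functional (\<lambda>p. lookup p m)"
  by (simp add: functional_def lookup_add)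

lemma functional_vanishes_on_span:
  assumes "functional \<phi>" "\<And>s. s \<in> S \<Longrightarrow> \<phi> s = 0" "p \<in> apoly_span S"
  shows "\<phi> p = 0"
proof -
  have "apoly_span S \<subseteq> {p. \<phi> p = 0}"
  proof (rule apoly.span_minimal)
    show "apoly_subspace {p. \<phi> p = 0}"
      using functional_zero[OF assms(1)] functional_add[OF assms(1)] functional_scale[OF assms(1)]
      by (simp add: apoly.subspace_def)
  qed (use assms(2) in blast)
  then show ?thesis using assms(3) by blast
qed

text \<open>
The coordinate of $p$ in a basis that extends $p$ together with a basis of the span.
\<close>

lemma separating_functional:
  assumes "p \<notin> apoly_span V"
  obtains \<phi> where "functional \<phi>" "\<And>v. v \<in> V \<Longrightarrow> \<phi> v = 0" "\<phi> p \<noteq> 0"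
proof -
  obtain B where B: "B \<subseteq> V" "\<not> apoly_dependent B" "V \<subseteq> apoly_span B"
    by (rule apoly.basis_exists)
  have "apoly_span B \<subseteq> apoly_span V" using B(1) by (rule apoly.span_mono)
  then have p: "p \<notin> apoly_span B" using assms by blast
  then have ind: "\<not> apoly_dependent (insert p B)" using B(2) by (simp add: apoly.independent_insert)
  define E where "E = apoly.extend_basis (insert p B)"
  have E: "\<not> apoly_dependent E" "insert p B \<subseteq> E" "\<And>v. v \<in> apoly_span E"
    using apoly.independent_extend_basis[OF ind] apoly.extend_basis_superset[OF ind]
      apoly.span_extend_basis[OF ind] by (auto simp: E_def)
  define \<phi> where "\<phi> = (\<lambda>v. apoly.representation E v p)"
  have lin: "functional \<phi>"
    using E(1,3) by (simp add: functional_def \<phi>_def apoly.representation_add apoly.representation_scale)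
  show thesis
  proof (rule that[OF lin])
    fix v assume v: "v \<in> V"
    show "\<phi> v = 0"
    proof (rule functional_vanishes_on_span[OF lin])
      show "v \<in> apoly_span B" using v B(3) by blast
      show "\<phi> b = 0" if "b \<in> B" for b
        using E(1,2) that p apoly.span_base[of b B] by (auto simp: \<phi>_def apoly.representation_basis)
    qed
  next
    show "\<phi> p \<noteq> 0" using E(1,2) by (auto simp: \<phi>_def apoly.representation_basis)
  qed
qed

lemma functional_of_coefficients:
  obtains \<phi> where "functional \<phi>" "\<And>m. \<phi> (single m 1) = C m"
proof -
  define \<phi> where "\<phi> p = (\<Sum>m\<in>keys p. lookup p m * C m)" for p
  have ext: "\<phi> p = (\<Sum>m\<in>K. lookup p m * C m)"
    if "finite K" "keys p \<subseteq> K" for p K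
    unfolding \<phi>_def using that by (intro sum.mono_neutral_left) (auto simp: in_keys_iff)
  have "\<phi> (p + q) = \<phi> p + \<phi> q" for p q
    using ext[of "keys p \<union> keys q"] keys_add[of p q]
    by (simp add: lookup_add distrib_right sum.distrib)
  moreover have "\<phi> (pscale c p) = c * \<phi> p" for c p
  proof -
    have "keys (pscale c p) \<subseteq> keys p" by (auto simp: in_keys_iff)
    then show ?thesis
      using ext[of "keys p"] by (simp add: sum_distrib_left mult_ac)
  qed
  ultimately have "functional \<phi>" unfolding functional_def by blast
  moreover have "\<phi> (single m 1) = C m" for m by (simp add: \<phi>_def)
  ultimately show thesis by (rule that)
qed


section \<open>The derivation\<close>

lemma partial_extend:
  assumes "finite K" "keys p \<subseteq> K"
  shows "partial i p = (\<Sum>m\<in>K. single (m - single i 1)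
      (of_nat (lookup m i) * lookup p m))"
  unfolding partial_def using assms by (intro sum.mono_neutral_left) (auto simp: in_keys_iff)

lemma partial_add: "partial i (p + q) = partial i p + partial i q"
  using partial_extend[of "keys p \<union> keys q" _ i] keys_add[of p q]
  by (simp add: lookup_add distrib_left single_add sum.distrib)

lemma pscale_sum: "pscale c (\<Sum>i\<in>I. f i) = (\<Sum>i\<in>I. pscale c (f i))"
  by (simp add: pscale_def sum_distrib_left)

lemma pscale_mult: "pscale c p * q = pscale c (p * q)" "p * pscale c q = pscale c (p * q)"
  by (simp_all add: pscale_def mult_ac)

lemma partial_scale: "partial i (pscale c p) = pscale c (partial i p)"
proof -
  have "keys (pscale c p) \<subseteq> keys p" by (auto simp: in_keys_iff)
  from partial_extend[OF finite_keys this] show ?thesis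
    by (simp add: partial_def pscale_sum mult_ac)
qed

lemma partial_eventually_zero: "\<exists>N. \<forall>i>N. partial i p = 0"
proof -
  let ?V = "\<Union>m\<in>keys p. keys m"
  have fin: "finite ?V" by simp
  have "partial i p = 0" if "i > Max (insert 0 ?V)" for i
  proof -
    have "i \<notin> ?V" using that fin Max_ge[of "insert 0 ?V" i] by auto
    then show ?thesis unfolding partial_def by (intro sum.neutral) (auto simp: in_keys_iff)
  qed
  then show ?thesis by blast
qed

lemma deriv_D_bounded:
  assumes "\<forall>i>N. partial i p = 0"
  shows "deriv_D p = (\<Sum>i=1..N. mvar (i - 1) * partial i p)"
  unfolding deriv_D_def
proof (rule sum.mono_neutral_left)
  show "{i. i \<ge> 1 \<and> partial i p \<noteq> 0} \<subseteq> {1..N}" using assms by (auto simp: not_less[symmetric])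
qed auto

lemma deriv_D_add: "deriv_D (p + q) = deriv_D p + deriv_D q"
proof -
  obtain M where M: "\<forall>i>M. partial i p = 0" using partial_eventually_zero by blast
  obtain N where N: "\<forall>i>N. partial i q = 0" using partial_eventually_zero by blast
  let ?K = "max M N"
  have "\<forall>i>?K. partial i p = 0" "\<forall>i>?K. partial i q = 0" "\<forall>i>?K. partial i (p + q) = 0"
    using M N by (auto simp: partial_add)
  then show ?thesis by (simp add: deriv_D_bounded[of ?K] partial_add distrib_left sum.distrib)
qed

lemma deriv_D_scale: "deriv_D (pscale c p) = pscale c (deriv_D p)"
proof -
  obtain N where N: "\<forall>i>N. partial i p = 0" using partial_eventually_zero by blast
  then have "\<forall>i>N. partial i (pscale c p) = 0" by (simp add: partial_scale)
  then show ?thesis using N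
    by (simp add: deriv_D_bounded[of N] partial_scale pscale_mult pscale_sum)
qed

lemma deriv_D_zero [simp]: "deriv_D 0 = 0"
  using deriv_D_add[of 0 0] by simp

lemma deriv_D_sum: "deriv_D (\<Sum>i\<in>I. f i) = (\<Sum>i\<in>I. deriv_D (f i))"
  by (induction I rule: infinite_finite_induct) (auto simp: deriv_D_add)

lemma functional_deriv_D: "functional \<phi> \<Longrightarrow> functional (\<lambda>p. \<phi> (deriv_D p))"
  by (simp add: functional_def deriv_D_add deriv_D_scale)


section \<open>The values of the potenziante\<close>

lemma mono_degree_extend:
  assumes "finite K" "keys m \<subseteq> K"
  shows "mono_degree m = (\<Sum>i\<in>K. lookup m i)"
  unfolding mono_degree_def using assms by (intro sum.mono_neutral_left) (auto simp: in_keys_iff)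

lemma mono_weight_extend:
  assumes "finite K" "keys m \<subseteq> K"
  shows "mono_weight m = (\<Sum>i\<in>K. i * lookup m i)"
  unfolding mono_weight_def using assms by (intro sum.mono_neutral_left) (auto simp: in_keys_iff)

lemma mono_degree_add: "mono_degree (m + m') = mono_degree m + mono_degree m'"
  using mono_degree_extend[of "keys m \<union> keys m'"] keys_add[of m m']
  by (simp add: lookup_add sum.distrib)

lemma mono_weight_add: "mono_weight (m + m') = mono_weight m + mono_weight m'"
  using mono_weight_extend[of "keys m \<union> keys m'"] keys_add[of m m']
  by (simp add: lookup_add distrib_left sum.distrib)

definition tuple_monomial :: "nat \<Rightarrow> (nat \<Rightarrow> nat) \<Rightarrow> monomial" where
  "tuple_monomial n r = (\<Sum>i=1..n. single (r i) 1)"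

lemma mono_degree_tuple: "mono_degree (tuple_monomial n r) = n"
  by (induction n)
    (simp_all add: tuple_monomial_def mono_degree_add, simp_all add: mono_degree_def)

lemma mono_weight_tuple: "mono_weight (tuple_monomial n r) = (\<Sum>i=1..n. r i)"
  by (induction n)
    (simp_all add: tuple_monomial_def mono_weight_add, simp_all add: mono_weight_def)

lemma tuple_monomial_surj_degree:
  "mono_degree m = n \<Longrightarrow> \<exists>r. (\<forall>i. i \<notin> {1..n} \<longrightarrow> r i = 0) \<and> tuple_monomial n r = m"
proof (induction n arbitrary: m)
  case 0
  then have "m = 0"
    by (intro poly_mapping_eqI) (auto simp: mono_degree_def in_keys_iff)
  then show ?case by (intro exI[of _ "\<lambda>_. 0"]) (simp add: tuple_monomial_def)
next
  case (Suc n)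
  then obtain i where i: "lookup m i \<noteq> 0"
    by (metis mono_degree_def sum.neutral nat.distinct(2))
  define m' where "m' = m - single i 1"
  have m: "m = m' + single i 1"
    using i by (intro poly_mapping_eqI) (auto simp: m'_def lookup_add lookup_minus lookup_single when_def)
  have "mono_degree m' = n"
    using Suc.prems mono_degree_add[of m' "single i 1"] m by (simp add: mono_degree_def)
  then obtain r where r: "\<forall>i. i \<notin> {1..n} \<longrightarrow> r i = 0" "tuple_monomial n r = m'" using Suc.IH by blast
  have "tuple_monomial n (r(Suc n := i)) = tuple_monomial n r"
    unfolding tuple_monomial_def by (rule sum.cong) auto
  then have "tuple_monomial (Suc n) (r(Suc n := i)) = m"
    using m r(2) by (simp add: tuple_monomial_def)
  moreover have "\<forall>j. j \<notin> {1..Suc n} \<longrightarrow> (r(Suc n := i)) j = 0" using r(1) by auto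
  ultimately show ?case by blast
qed

lemma tuple_monomial_surj:
  assumes "mono_degree m = n" "mono_weight m = g"
  obtains r where "r \<in> tuples n g" "tuple_monomial n r = m"
  using tuple_monomial_surj_degree[OF assms(1)] assms(2) mono_weight_tuple[of n]
  by (auto simp: tuples_def)

lemma lookup_tuple_monomial:
  "lookup (tuple_monomial n r) j = card {i \<in> {1..n}. r i = j}"
proof -
  have "lookup (tuple_monomial n r) j = (\<Sum>i=1..n. if r i = j then 1 else 0)"
    unfolding tuple_monomial_def lookup_sum by (intro sum.cong) (auto simp: lookup_single when_def)
  also have "\<dots> = (\<Sum>i\<in>{i \<in> {1..n}. r i = j}. 1)" by (rule sum.inter_filter[symmetric]) simp
  finally show ?thesis by simp
qed

text \<open>
Both tuples enumerate the indices of the same monomial with their multiplicities.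
\<close>

lemma tuple_monomial_eq_permuted:
  assumes "tuple_monomial n r = tuple_monomial n s"
  obtains p where "p permutes {1..n}" "\<And>i. i \<in> {1..n} \<Longrightarrow> r i = s (p i)"
proof -
  have "image_mset r (mset_set {1..n}) = image_mset s (mset_set {1..n})"
  proof (rule multiset_eqI)
    fix j
    have "card {i \<in> {1..n}. r i = j} = card {i \<in> {1..n}. s i = j}"
      using assms by (metis lookup_tuple_monomial)
    moreover have "count (image_mset t (mset_set {1..n})) j = card {i \<in> {1..n}. t i = j}" for t :: "nat \<Rightarrow> nat"
    proof -
      have "{i. i \<in># mset_set {1..n} \<and> j = t i} = {i \<in> {1..n}. t i = j}" by auto
      moreover have "t -` {j} \<inter> {1..n} = {i \<in> {1..n}. t i = j}" by auto
      ultimately show ?thesis by (simp add: count_image_mset)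
    qed
    ultimately show "count (image_mset r (mset_set {1..n})) j = count (image_mset s (mset_set {1..n})) j"
      by simp
  qed
  then obtain p where "p permutes {1..n}" "\<forall>i\<in>{1..n}. r i = s (p i)"
    by (rule image_mset_eq_implies_permutes[OF finite_atLeastAtMost])
  then show thesis by (intro that) simp_all
qed

lemma tuple_monomial_permuted:
  assumes "p permutes {1..n}"
  shows "tuple_monomial n (r \<circ> p) = tuple_monomial n r"
  using sum.permute[OF assms, of "\<lambda>i. single (r i) (1::nat)"]
  by (simp add: tuple_monomial_def comp_def)

text \<open>
The value of the potenziante at complex numbers $\lambda_i=x_i$; the monomial $a_{r_1}\cdots a_{r_n}$
is \<^term>\<open>tuple_monomial n r\<close>.
\<close>

definition pot :: "nat \<Rightarrow> nat \<Rightarrow> (nat \<Rightarrow> complex) \<Rightarrow> apoly" where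
  "pot n g x = (\<Sum>r\<in>tuples n g. single (tuple_monomial n r) (\<Prod>i=1..n. x i ^ r i))"

lemma functional_pot:
  assumes "functional \<phi>"
  shows "\<phi> (pot n g x) =
    (\<Sum>r\<in>tuples n g. \<phi> (single (tuple_monomial n r) 1) * (\<Prod>i=1..n. x i ^ r i))"
  unfolding pot_def functional_sum[OF assms]
  by (intro sum.cong refl) (subst functional_single[OF assms], rule mult.commute)

lemma homogeneous_tuple_sum:
  "homogeneous n g (\<lambda>x. \<Sum>r\<in>tuples n g. c r * (\<Prod>i=1..n. x i ^ r i))"
proof (intro homogeneous_sum homogeneous_scale)
  fix r assume r: "r \<in> tuples n g"
  have "homogeneous n (r i) (\<lambda>x. x i ^ r i)" if "i \<in> {1..n}" for i
    using homogeneous_power[OF homogeneous.var[OF that], of "r i"] by simp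
  from homogeneous_prod[of "{1..n}" n r "\<lambda>i x. x i ^ r i", OF this]
  show "homogeneous n g (\<lambda>x. \<Prod>i=1..n. x i ^ r i)" using r by (simp add: tuples_def)
qed

lemma homogeneous_pot: "functional \<phi> \<Longrightarrow> homogeneous n g (\<lambda>x. \<phi> (pot n g x))"
  using homogeneous_tuple_sum[of n g] by (simp add: functional_pot)

lemma tuples_permuted:
  assumes "p permutes {1..n}" "r \<in> tuples n g"
  shows "r \<circ> p \<in> tuples n g"
  using assms permutes_in_image[OF assms(1)] sum.permute[OF assms(1), of r] by (auto simp: tuples_def)

lemma tuple_sum_permuted:
  fixes x :: "nat \<Rightarrow> complex"
  assumes p: "p permutes {1..n}"
  shows "(\<Sum>r\<in>tuples n g. F r (\<Prod>i=1..n. (x \<circ> p) i ^ r i)) =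
    (\<Sum>r\<in>tuples n g. F (r \<circ> p) (\<Prod>i=1..n. x i ^ r i))"
proof (rule sum.reindex_bij_witness[of _ "\<lambda>r. r \<circ> p" "\<lambda>r. r \<circ> inv p"])
  fix r assume r: "r \<in> tuples n g"
  show "r \<circ> inv p \<circ> p = r" "r \<circ> p \<circ> inv p = r"
    using permutes_inv_o[OF p] by (simp_all add: comp_assoc)
  show "r \<circ> p \<in> tuples n g" "r \<circ> inv p \<in> tuples n g"
    using r tuples_permuted p permutes_inv[OF p] by blast+
  have "(\<Prod>i=1..n. (x \<circ> p) i ^ r i) = (\<Prod>i=1..n. x i ^ (r \<circ> inv p) i)"
    using prod.permute[OF p, of "\<lambda>i. x i ^ (r \<circ> inv p) i"] permutes_inverses[OF p]
    by (simp add: comp_def)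
  then show "F (r \<circ> inv p \<circ> p) (\<Prod>i=1..n. x i ^ (r \<circ> inv p) i) =
      F r (\<Prod>i=1..n. (x \<circ> p) i ^ r i)"
    using permutes_inv_o[OF p] by (simp add: comp_assoc)
qed

lemma pot_permuted: "p permutes {1..n} \<Longrightarrow> pot n g (x \<circ> p) = pot n g x"
  unfolding pot_def by (subst tuple_sum_permuted) (simp_all add: tuple_monomial_permuted)

lemma tuples_eqI:
  assumes "r \<in> tuples n g" "s \<in> tuples n g" "\<And>i. i \<in> {1..n} \<Longrightarrow> r i = s i"
  shows "r = s"
proof
  fix i
  show "r i = s i" using assms by (cases "i \<in> {1..n}") (auto simp: tuples_def)
qed

text \<open>
The values of the potenziante span the whole component: its coefficients at the monomials in the
$\lambda_i$ are all monomials of degree $n$ and weight $g$.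
\<close>

lemma functional_vanishes_on_part:
  assumes "functional \<phi>" "\<And>x. \<phi> (pot n g x) = 0" "p \<in> apoly_part n g"
  shows "\<phi> p = 0"
proof (rule functional_vanishes_on_span[OF assms(1)])
  show "p \<in> apoly_span {single m 1 |m. mono_degree m = n \<and> mono_weight m = g}"
    using assms(3) by (simp add: apoly_part_def)
  fix s assume "s \<in> {single m (1::complex) |m. mono_degree m = n \<and> mono_weight m = g}"
  then obtain m where s: "s = single m 1" "mono_degree m = n" "mono_weight m = g" by blast
  obtain r where r: "r \<in> tuples n g" "tuple_monomial n r = m" by (rule tuple_monomial_surj[OF s(2,3)])
  have "\<phi> (single (tuple_monomial n r) 1) = 0"
  proof (rule polynomial_coefficients_zero[of "{1..n}" "tuples n g" "\<lambda>r. r"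
        "\<lambda>r. \<phi> (single (tuple_monomial n r) 1)" r])
    show "(\<Sum>r\<in>tuples n g. \<phi> (single (tuple_monomial n r) 1) * (\<Prod>i=1..n. x i ^ r i)) = 0"
      for x using assms(2)[of x] by (simp add: functional_pot[OF assms(1)])
  qed (use r tuples_eqI in auto)
  then show "\<phi> s = 0" using s(1) r(2) by simp
qed

text \<open>
The functional sends $a_{r_1}\cdots a_{r_n}$ to the coefficient of $f$ at
$\lambda_1^{r_1}\cdots\lambda_n^{r_n}$. By symmetry this does not depend on the order of
$r_1,\ldots,r_n$. The other components of the grading are sent to $0$, so that the functional can be
applied to inhomogeneous elements.
\<close>

lemma symmetric_function_functional:
  assumes hom: "homogeneous n g f" and sym: "symmetric_on n UNIV f"
  obtains \<phi> where "functional \<phi>" "\<And>x. \<phi> (pot n g x) = f x"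
    "\<And>p n' g'. p \<in> apoly_part n' g' \<Longrightarrow> (n', g') \<noteq> (n, g) \<Longrightarrow> \<phi> p = 0"
proof -
  obtain c where c: "\<And>x. f x = (\<Sum>r\<in>tuples n g. c r * (\<Prod>i=1..n. x i ^ r i))"
    using homogeneous_expansion[OF hom] by blast
  have c_sym: "c (r \<circ> p) = c r" if p: "p permutes {1..n}" and r: "r \<in> tuples n g" for p r
  proof -
    have "c (r \<circ> p) - c r = 0"
    proof (rule polynomial_coefficients_zero[of "{1..n}" "tuples n g" "\<lambda>r. r"
          "\<lambda>r. c (r \<circ> p) - c r" r, OF _ _ tuples_eqI _ r])
      fix x :: "nat \<Rightarrow> complex"
      have "(\<Sum>r\<in>tuples n g. c (r \<circ> p) * (\<Prod>i=1..n. x i ^ r i)) = f (x \<circ> p)"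
        using tuple_sum_permuted[OF p, of "\<lambda>r y. c r * y" x g] by (simp only: c)
      also have "\<dots> = f x" using sym p by (simp add: symmetric_on_def)
      finally show "(\<Sum>r\<in>tuples n g. (c (r \<circ> p) - c r) * (\<Prod>i=1..n. x i ^ r i)) = 0"
        by (simp add: c left_diff_distrib sum_subtractf)
    qed auto
    then show ?thesis by simp
  qed
  \<comment> \<open>Symmetry makes the value independent of the chosen tuple.\<close>
  define C where "C m = (if mono_degree m = n \<and> mono_weight m = g
    then c (SOME r. r \<in> tuples n g \<and> tuple_monomial n r = m) else 0)" for m
  have C: "C (tuple_monomial n r) = c r" if r: "r \<in> tuples n g" for r
  proof -
    define s where "s = (SOME s. s \<in> tuples n g \<and> tuple_monomial n s = tuple_monomial n r)"
    have s: "s \<in> tuples n g \<and> tuple_monomial n s = tuple_monomial n r"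
      unfolding s_def by (rule someI[where x = r]) (use r in simp)
    obtain p where p: "p permutes {1..n}" "\<And>i. i \<in> {1..n} \<Longrightarrow> s i = r (p i)"
      using tuple_monomial_eq_permuted s by blast
    have "s = r \<circ> p" by (rule tuples_eqI) (use s r p tuples_permuted in auto)
    then have "c s = c r" using c_sym p(1) r by simp
    moreover have "mono_weight (tuple_monomial n r) = g"
      using r by (simp add: mono_weight_tuple tuples_def)
    ultimately show ?thesis by (simp add: C_def mono_degree_tuple s_def)
  qed
  obtain \<phi> where \<phi>: "functional \<phi>" "\<And>m. \<phi> (single m 1) = C m"
    by (rule functional_of_coefficients[of C], rule that)
  show thesis
  proof (rule that[OF \<phi>(1)])
    show "\<phi> (pot n g x) = f x" for x
      unfolding functional_pot[OF \<phi>(1)] c \<phi>(2) by (intro sum.cong) (auto simp: C)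
    show "\<phi> p = 0" if "p \<in> apoly_part n' g'" "(n', g') \<noteq> (n, g)" for p n' g'
    proof (rule functional_vanishes_on_span[OF \<phi>(1)])
      show "p \<in> apoly_span {single m 1 |m. mono_degree m = n' \<and> mono_weight m = g'}"
        using that(1) by (simp add: apoly_part_def)
    qed (use that(2) in \<open>auto simp: \<phi>(2) C_def\<close>)
  qed
qed

lemma mvar_single: "mvar j * single m c = single (m + single j 1) c"
  by (simp add: mvar_def mult_single add.commute)

text \<open>
The exponent of $a_i$ counts the places $j$ with $r_j=i$, so the derivation lowers one entry at a
time.
\<close>

lemma deriv_D_tuple_monomial:
  "deriv_D (single (tuple_monomial n r) c) =
    (\<Sum>j\<in>{j \<in> {1..n}. r j \<noteq> 0}. single (tuple_monomial n (r(j := r j - 1))) c)"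
proof -
  let ?m = "tuple_monomial n r"
  have partial: "partial i (single ?m c) =
      single (?m - single i 1) (of_nat (lookup ?m i) * c)" for i
    by (simp add: partial_def)
  obtain N where N: "\<And>j. j \<in> {1..n} \<Longrightarrow> r j \<le> N"
    using Max_ge[of "r ` {1..n}"] by blast
  have "{j \<in> {1..n}. r j = i} = {}" if "i > N" for i
    using N that by fastforce
  then have "\<forall>i>N. partial i (single ?m c) = 0"
    by (simp add: partial lookup_tuple_monomial del: Collect_empty_eq)
  then have "deriv_D (single ?m c) =
      (\<Sum>i=1..N. mvar (i - 1) * partial i (single ?m c))" by (rule deriv_D_bounded)
  also have "\<dots> = (\<Sum>i=1..N. \<Sum>j\<in>{j \<in> {j \<in> {1..n}. r j \<noteq> 0}. r j = i}.
      single (tuple_monomial n (r(j := r j - 1))) c)"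
  proof (rule sum.cong[OF refl])
    fix i assume i: "i \<in> {1..N}"
    let ?J = "{j \<in> {1..n}. r j = i}"
    have J: "{j \<in> {j \<in> {1..n}. r j \<noteq> 0}. r j = i} = ?J" using i by auto
    have lower: "tuple_monomial n (r(j := r j - 1)) =
        ?m - single i 1 + single (i - 1) 1" if j: "j \<in> ?J" for j
    proof -
      have rest: "(\<Sum>k\<in>{1..n} - {j}. single ((r(j := r j - 1)) k) (1::nat)) =
          (\<Sum>k\<in>{1..n} - {j}. single (r k) 1)" by (rule sum.cong) auto
      have split: "tuple_monomial n s = single (s j) 1 +
          (\<Sum>k\<in>{1..n} - {j}. single (s k) 1)" for s
        unfolding tuple_monomial_def using j by (subst sum.remove[of _ j]) auto
      show ?thesis using j unfolding split[of r] split[of "r(j := r j - 1)"] rest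
        by (simp add: add.commute)
    qed
    have "mvar (i - 1) * partial i (single ?m c) =
        single (?m - single i 1 + single (i - 1) 1)
          (of_nat (card ?J) * c)"
      unfolding partial mvar_single lookup_tuple_monomial ..
    also have "\<dots> = (\<Sum>j\<in>?J.
        single (?m - single i 1 + single (i - 1) 1) c)"
      unfolding single_sum[symmetric] by simp
    also have "\<dots> = (\<Sum>j\<in>?J. single (tuple_monomial n (r(j := r j - 1))) c)"
      by (rule sum.cong[OF refl]) (simp only: lower)
    finally show "mvar (i - 1) * partial i (single ?m c) =
      (\<Sum>j\<in>{j \<in> {j \<in> {1..n}. r j \<noteq> 0}. r j = i}.
        single (tuple_monomial n (r(j := r j - 1))) c)" unfolding J .
  qed
  also have "\<dots> = (\<Sum>j\<in>{j \<in> {1..n}. r j \<noteq> 0}.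
      single (tuple_monomial n (r(j := r j - 1))) c)"
    by (rule sum.group) (use N in \<open>auto simp: Suc_le_eq\<close>)
  finally show ?thesis .
qed

text \<open>
Lowering the entry $j$ by one while keeping the power of $\lambda$ amounts to multiplying the
potenziante of weight $g-1$ by $\lambda_j$.
\<close>

lemma deriv_D_pot:
  "deriv_D (pot n g x) = (if g = 0 then 0 else pscale (\<Sum>i=1..n. x i) (pot n (g - 1) x))"
proof (cases "g = 0")
  case True
  then have "{j \<in> {1..n}. r j \<noteq> 0} = {}" if "r \<in> tuples n g" for r
    using that by (auto simp: tuples_def)
  then show ?thesis
    using True by (simp add: pot_def deriv_D_sum deriv_D_tuple_monomial del: Collect_empty_eq)
next
  case False
  let ?s = "\<lambda>r. single (tuple_monomial n r) :: complex \<Rightarrow> apoly"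
  let ?x = "\<lambda>r. \<Prod>i=1..n. x i ^ r i"
  have "deriv_D (pot n g x) =
      (\<Sum>r\<in>tuples n g. \<Sum>j\<in>{j \<in> {1..n}. r j \<noteq> 0}. ?s (r(j := r j - 1)) (?x r))"
    by (simp add: pot_def deriv_D_sum deriv_D_tuple_monomial)
  also have "\<dots> = (\<Sum>j=1..n. \<Sum>r\<in>{r \<in> tuples n g. r j \<noteq> 0}. ?s (r(j := r j - 1)) (?x r))"
    by (rule sum.swap_restrict) auto
  also have "\<dots> = (\<Sum>j=1..n. \<Sum>r\<in>tuples n (g - 1). ?s r (x j * ?x r))"
  proof (rule sum.cong[OF refl])
    fix j assume j: "j \<in> {1..n}"
    show "(\<Sum>r\<in>{r \<in> tuples n g. r j \<noteq> 0}. ?s (r(j := r j - 1)) (?x r)) =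
        (\<Sum>r\<in>tuples n (g - 1). ?s r (x j * ?x r))"
    proof (rule sum.reindex_bij_witness[of _ "\<lambda>r. r(j := Suc (r j))" "\<lambda>r. r(j := r j - 1)"])
      have sum_upd: "(\<Sum>i=1..n. (r(j := m)) i) = m + (\<Sum>i\<in>{1..n} - {j}. r i)" for r :: "nat \<Rightarrow> nat" and m
      proof -
        have "(\<Sum>i\<in>{1..n} - {j}. (r(j := m)) i) = (\<Sum>i\<in>{1..n} - {j}. r i)"
          by (rule sum.cong) auto
        then show ?thesis using j by (subst sum.remove[of _ j]) auto
      qed
      have sum_split: "(\<Sum>i=1..n. r i) = r j + (\<Sum>i\<in>{1..n} - {j}. r i)" for r :: "nat \<Rightarrow> nat"
        using j by (subst sum.remove[of _ j]) auto
      fix r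
      have upd: "r(j := m) \<in> tuples n g' \<longleftrightarrow> m + (\<Sum>i\<in>{1..n} - {j}. r i) = g'"
        if "\<forall>i. i \<notin> {1..n} \<longrightarrow> r i = 0" for m g'
        unfolding tuples_def mem_Collect_eq sum_upd using that j by auto
      show "r(j := r j - 1) \<in> tuples n (g - 1)" if "r \<in> {r \<in> tuples n g. r j \<noteq> 0}"
      proof -
        have r: "\<forall>i. i \<notin> {1..n} \<longrightarrow> r i = 0" "(\<Sum>i=1..n. r i) = g" "r j \<noteq> 0"
          using that by (simp_all add: tuples_def)
        show ?thesis unfolding upd[OF r(1)] using r(2,3) sum_split[of r] by linarith
      qed
      show "r(j := Suc (r j)) \<in> {r \<in> tuples n g. r j \<noteq> 0}" if "r \<in> tuples n (g - 1)"
      proof -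
        have r: "\<forall>i. i \<notin> {1..n} \<longrightarrow> r i = 0" "(\<Sum>i=1..n. r i) = g - 1"
          using that by (simp_all add: tuples_def)
        have "r(j := Suc (r j)) \<in> tuples n g"
          unfolding upd[OF r(1)] using r(2) sum_split[of r] False by linarith
        then show ?thesis by simp
      qed
      show "(r(j := r j - 1))(j := Suc ((r(j := r j - 1)) j)) = r" if "r \<in> {r \<in> tuples n g. r j \<noteq> 0}"
        using that by auto
      have "?x r = x j * ?x (r(j := r j - 1))" if "r j \<noteq> 0"
      proof -
        have "(\<Prod>i\<in>{1..n} - {j}. x i ^ r i) = (\<Prod>i\<in>{1..n} - {j}. x i ^ (r(j := r j - 1)) i)"
          by (rule prod.cong) auto
        moreover have "x j ^ r j = x j * x j ^ (r j - 1)" using that by (cases "r j") auto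
        moreover have split: "?x s = x j ^ s j * (\<Prod>i\<in>{1..n} - {j}. x i ^ s i)" for s
          by (rule prod.remove) (use j in auto)
        ultimately show ?thesis
          unfolding split[of r] split[of "r(j := r j - 1)"] by simp
      qed
      then show "?s (r(j := r j - 1)) (x j * ?x (r(j := r j - 1))) = ?s (r(j := r j - 1)) (?x r)"
        if "r \<in> {r \<in> tuples n g. r j \<noteq> 0}" using that by simp
    qed auto
  qed
  also have "\<dots> = (\<Sum>r\<in>tuples n (g - 1). \<Sum>j=1..n. ?s r (x j * ?x r))" by (rule sum.swap)
  also have "\<dots> = (\<Sum>r\<in>tuples n (g - 1). ?s r ((\<Sum>j=1..n. x j) * ?x r))"
    by (simp only: single_sum[symmetric] sum_distrib_right)
  finally show ?thesis using False by (simp add: pot_def pscale_sum)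
qed

lemma sum_shifted:
  fixes x :: "nat \<Rightarrow> 'b::comm_monoid_add"
  assumes "h \<le> n"
  shows "(\<Sum>i=1..n. x i) = (\<Sum>i=1..h. x i) + (\<Sum>i=1..n - h. x (i + h))"
  using sum.shift_bounds_cl_nat_ivl[of x 1 h "n - h"] sum.ub_add_nat[of 1 h x "n - h"] assms
  by (simp add: add.commute)

lemma tuple_monomial_split:
  assumes "h \<le> n"
  shows "tuple_monomial n r = tuple_monomial h r + tuple_monomial (n - h) (\<lambda>i. r (i + h))"
  unfolding tuple_monomial_def by (rule sum_shifted[OF assms])

lemma pot_product:
  assumes h: "h \<le> n"
  shows "pot n g x = (\<Sum>g'\<le>g. pot h g' x * pot (n - h) (g - g') (\<lambda>i. x (i + h)))"
proof -
  let ?s = "\<lambda>n r. single (tuple_monomial n r) :: complex \<Rightarrow> apoly"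
  let ?x = "\<lambda>n x r. \<Prod>i=1..n. x i ^ r i"
  let ?y = "\<lambda>i. x (i + h)"
  let ?T = "\<lambda>g'. tuples h g' \<times> tuples (n - h) (g - g')"
  have prod_split: "?x n x r = ?x h x r * ?x (n - h) ?y (\<lambda>i. r (i + h))" for r
    using prod.shift_bounds_cl_nat_ivl[of "\<lambda>i. x i ^ r i" 1 h "n - h"]
      prod.ub_add_nat[of 1 h "\<lambda>i. x i ^ r i" "n - h"] h
    by (simp add: add.commute)
  have "pot n g x = (\<Sum>(g', r, s)\<in>(SIGMA g':{..g}. ?T g').
      ?s h r (?x h x r) * ?s (n - h) s (?x (n - h) ?y s))"
    unfolding pot_def
  proof (rule sum.reindex_bij_witness[of _
        "\<lambda>(g', r, s) i. if i \<le> h then r i else s (i - h)"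
        "\<lambda>r. (\<Sum>i=1..h. r i, (\<lambda>i. if i \<le> h then r i else 0),
          (\<lambda>i. if i = 0 then 0 else r (i + h)))"])
    fix r assume r: "r \<in> tuples n g"
    let ?r = "\<lambda>i. if i \<le> h then r i else 0" and ?t = "\<lambda>i. if i = 0 then 0 else r (i + h)"
    have sums: "(\<Sum>i=1..h. ?r i) = (\<Sum>i=1..h. r i)" "(\<Sum>i=1..n - h. ?t i) = (\<Sum>i=1..n - h. r (i + h))"
      by (intro sum.cong; auto)+
    have g: "(\<Sum>i=1..h. r i) + (\<Sum>i=1..n - h. r (i + h)) = g"
      using r sum_shifted[OF h, of r] by (simp add: tuples_def)
    have r0: "r i = 0" if "i = 0 \<or> i > n" for i using r that by (auto simp: tuples_def)
    show "((\<Sum>i=1..h. r i), ?r, ?t) \<in> (SIGMA g':{..g}. ?T g')"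
      using sums g r0 h by (auto simp: tuples_def)
    show "(case ((\<Sum>i=1..h. r i), ?r, ?t) of (g', r, s) \<Rightarrow> \<lambda>i. if i \<le> h then r i else s (i - h)) = r"
      by (auto simp: fun_eq_iff)
    have m: "tuple_monomial h ?r = tuple_monomial h r"
        "tuple_monomial (n - h) ?t = tuple_monomial (n - h) (\<lambda>i. r (i + h))"
      unfolding tuple_monomial_def by (intro sum.cong; auto)+
    have p: "?x h x ?r = ?x h x r" "?x (n - h) ?y ?t = ?x (n - h) ?y (\<lambda>i. r (i + h))"
      by (intro prod.cong; auto)+
    have "?s h ?r (?x h x ?r) * ?s (n - h) ?t (?x (n - h) ?y ?t) = ?s n r (?x n x r)"
      unfolding mult_single m p tuple_monomial_split[OF h, of r] prod_split[of r] ..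
    then show "(case ((\<Sum>i=1..h. r i), ?r, ?t) of (g', r, s) \<Rightarrow>
        ?s h r (?x h x r) * ?s (n - h) s (?x (n - h) ?y s)) = ?s n r (?x n x r)"
      by simp
  next
    fix q assume q: "q \<in> (SIGMA g':{..g}. ?T g')"
    obtain g' r s where q_eq: "q = (g', r, s)" by (cases q)
    have rs: "r \<in> tuples h g'" "s \<in> tuples (n - h) (g - g')" "g' \<le> g" using q q_eq by auto
    have r0: "r i = 0" if "i > h" for i using rs(1) that by (auto simp: tuples_def)
    have s0: "s i = 0" if "i = 0 \<or> i > n - h" for i using rs(2) that by (auto simp: tuples_def)
    have r00: "r 0 = 0" using rs(1) by (simp add: tuples_def)
    let ?r = "\<lambda>i. if i \<le> h then r i else s (i - h)"
    have sums: "(\<Sum>i=1..h. ?r i) = g'" "(\<Sum>i=1..n - h. ?r (i + h)) = g - g'"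
    proof -
      have "(\<Sum>i=1..h. ?r i) = (\<Sum>i=1..h. r i)" by (rule sum.cong) auto
      then show "(\<Sum>i=1..h. ?r i) = g'" using rs(1) by (simp add: tuples_def)
      have "(\<Sum>i=1..n - h. ?r (i + h)) = (\<Sum>i=1..n - h. s i)" by (rule sum.cong) auto
      then show "(\<Sum>i=1..n - h. ?r (i + h)) = g - g'" using rs(2) by (simp add: tuples_def)
    qed
    have "?r i = 0" if "i \<notin> {1..n}" for i
      using that h r00 s0[of "i - h"] by (cases "i = 0") auto
    moreover have "(\<Sum>i=1..n. ?r i) = g" unfolding sum_shifted[OF h, of ?r] sums using rs(3) by simp
    ultimately have "?r \<in> tuples n g" unfolding tuples_def by blast
    then show "(case q of (g', r, s) \<Rightarrow> \<lambda>i. if i \<le> h then r i else s (i - h)) \<in> tuples n g"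
      by (simp add: q_eq)
    have "(\<lambda>i. if i \<le> h then ?r i else 0) = r" "(\<lambda>i. if i = 0 then 0 else ?r (i + h)) = s"
      using r0 s0 by (auto simp: fun_eq_iff)
    then show "((\<Sum>i=1..h. (case q of (g', r, s) \<Rightarrow> \<lambda>i. if i \<le> h then r i else s (i - h)) i),
        (\<lambda>i. if i \<le> h then (case q of (g', r, s) \<Rightarrow> \<lambda>i. if i \<le> h then r i else s (i - h)) i else 0),
        (\<lambda>i. if i = 0 then 0
          else (case q of (g', r, s) \<Rightarrow> \<lambda>i. if i \<le> h then r i else s (i - h)) (i + h))) = q"
      using sums(1) by (simp only: q_eq prod.case)
  qed
  also have "\<dots> = (\<Sum>g'\<le>g. \<Sum>(r, s)\<in>?T g'. ?s h r (?x h x r) * ?s (n - h) s (?x (n - h) ?y s))"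
    by (subst sum.Sigma) auto
  also have "\<dots> = (\<Sum>g'\<le>g. pot h g' x * pot (n - h) (g - g') ?y)"
    by (intro sum.cong refl) (simp add: pot_def sum_product sum.cartesian_product)
  finally show ?thesis .
qed


section \<open>Evaluation of the variables $\lambda_i$\<close>

definition mono_value :: "(nat \<Rightarrow> complex) \<Rightarrow> monomial \<Rightarrow> complex" where
  "mono_value x m = (\<Prod>i\<in>keys m. x i ^ lookup m i)"

lemma mono_value_extend:
  assumes "finite K" "keys m \<subseteq> K"
  shows "mono_value x m = (\<Prod>i\<in>K. x i ^ lookup m i)"
  unfolding mono_value_def using assms by (intro prod.mono_neutral_left) (auto simp: in_keys_iff)

lemma mono_value_add: "mono_value x (m + m') = mono_value x m * mono_value x m'"
  using mono_value_extend[of "keys m \<union> keys m'" _ x] keys_add[of m m']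
  by (simp add: lookup_add power_add prod.distrib)

definition eval_lambda :: "(nat \<Rightarrow> complex) \<Rightarrow> apoly mpoly \<Rightarrow> apoly" where
  "eval_lambda x z =
    (\<Sum>m\<in>keys z. pscale (mono_value x m) (lookup z m))"

lemma pscale_add: "pscale c (p + q) = pscale c p + pscale c q"
  by (simp add: pscale_def distrib_left)

lemma pscale_pscale: "pscale c (pscale d p) = pscale (c * d) p"
  by (rule poly_mapping_eqI) simp

lemma pscale_zero [simp]: "pscale c 0 = 0" "pscale 0 p = 0"
  by (rule poly_mapping_eqI, simp)+

lemma pscale_one [simp]: "pscale 1 p = p"
  by (rule poly_mapping_eqI) simp

lemma eval_lambda_extend:
  assumes "finite K" "keys z \<subseteq> K"
  shows "eval_lambda x z = (\<Sum>m\<in>K. pscale (mono_value x m) (lookup z m))"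
  unfolding eval_lambda_def using assms by (intro sum.mono_neutral_left) (auto simp: in_keys_iff)

lemma eval_lambda_add: "eval_lambda x (z + w) = eval_lambda x z + eval_lambda x w"
  using eval_lambda_extend[of "keys z \<union> keys w" _ x] keys_add[of z w]
  by (simp add: lookup_add pscale_add sum.distrib)

lemma eval_lambda_zero [simp]: "eval_lambda x 0 = 0"
  by (simp add: eval_lambda_def)

lemma eval_lambda_diff: "eval_lambda x (z - w) = eval_lambda x z - eval_lambda x w"
  using eval_lambda_add[of x "z - w" w] by simp

lemma eval_lambda_sum: "eval_lambda x (\<Sum>i\<in>I. f i) = (\<Sum>i\<in>I. eval_lambda x (f i))"
  by (induction I rule: infinite_finite_induct) (auto simp: eval_lambda_add)

lemma eval_lambda_single: "eval_lambda x (single m p) = pscale (mono_value x m) p"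
  using eval_lambda_extend[of "{m}" "single m p" x] by simp

lemma eval_lambda_mult: "eval_lambda x (z * w) = eval_lambda x z * eval_lambda x w"
proof -
  let ?z = "keys z" and ?w = "keys w"
  have "z * w = (\<Sum>m\<in>?z. single m (lookup z m)) *
      (\<Sum>m\<in>?w. single m (lookup w m))"
    using poly_mapping_sum_single[of ?z z] poly_mapping_sum_single[of ?w w] by simp
  also have "\<dots> = (\<Sum>m\<in>?z. \<Sum>m'\<in>?w.
      single (m + m') (lookup z m * lookup w m'))"
    by (simp add: sum_product mult_single)
  finally have "eval_lambda x (z * w) = (\<Sum>m\<in>?z. \<Sum>m'\<in>?w. pscale (mono_value x (m + m'))
      (lookup z m * lookup w m'))"
    by (simp add: eval_lambda_sum eval_lambda_single)
  also have "\<dots> = eval_lambda x z * eval_lambda x w"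
    by (simp add: eval_lambda_def sum_product mono_value_add pscale_mult pscale_pscale
        mult.commute[where 'a = complex])
  finally show ?thesis .
qed

lemma eval_lambda_mconst: "eval_lambda x (mconst p) = p"
  by (simp add: mconst_def eval_lambda_single mono_value_def)

lemma eval_lambda_one [simp]: "eval_lambda x 1 = 1"
  using eval_lambda_mconst[of x 1] by (simp add: mconst_def)

lemma eval_lambda_mvar: "eval_lambda x (mvar i) = pscale (x i) 1"
  by (simp add: mvar_def eval_lambda_single mono_value_def)

lemma eval_lambda_power: "eval_lambda x (z ^ k) = eval_lambda x z ^ k"
  by (induction k) (auto simp: eval_lambda_mult)

lemma eval_lambda_prod: "eval_lambda x (\<Prod>i\<in>I. f i) = (\<Prod>i\<in>I. eval_lambda x (f i))"
  by (induction I rule: infinite_finite_induct) (auto simp: eval_lambda_mult)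

lemma pscale_one_sum: "(\<Sum>i\<in>I. pscale (f i) 1) = pscale (\<Sum>i\<in>I. f i) 1"
  by (rule poly_mapping_eqI) (simp add: lookup_sum sum_distrib_right)

lemma pscale_one_power: "pscale c 1 ^ k = pscale (c ^ k) 1"
  by (induction k) (auto simp: pscale_mult pscale_pscale mult.commute)

lemma pscale_one_prod: "(\<Prod>i\<in>I. pscale (f i) 1) = pscale (\<Prod>i\<in>I. f i) 1"
  by (induction I rule: infinite_finite_induct) (auto simp: pscale_mult pscale_pscale)

lemma prod_mvar_tuple: "(\<Prod>i=1..n. mvar (r i)) = (single (tuple_monomial n r) 1 :: apoly)"
  by (induction n)
    (simp_all add: tuple_monomial_def mvar_def mult_single)

lemma eval_lambda_potenziante: "eval_lambda x (potenziante n g) = pot n g x"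
  unfolding potenziante_def pot_def tuples_def[symmetric]
  by (simp add: eval_lambda_sum eval_lambda_mult eval_lambda_prod eval_lambda_power
      eval_lambda_mvar eval_lambda_mconst pscale_one_power pscale_one_prod pscale_mult
      prod_mvar_tuple[unfolded One_nat_def] del: pscale_single)
    (simp add: mult.commute)

lemma eval_lambda_esym: "eval_lambda x (esym n i) = pscale (elem_sym n i x) 1"
  by (simp add: esym_def elem_sym_def eval_lambda_sum eval_lambda_prod eval_lambda_mvar
      pscale_one_prod pscale_one_sum)

lemma eval_lambda_U_sum:
  "eval_lambda x (\<Sum>k\<in>K. (\<Prod>i=2..n. esym n i ^ k i) * mconst (u k)) =
    (\<Sum>k\<in>K. pscale (elem_mono 2 n k x) (u k))"
  by (simp add: eval_lambda_sum eval_lambda_mult eval_lambda_prod eval_lambda_power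
      eval_lambda_mconst eval_lambda_esym pscale_one_power pscale_one_prod pscale_mult
      elem_mono_def)

definition lambda_poly :: "nat \<Rightarrow> 'c::comm_ring_1 mpoly \<Rightarrow> bool" where
  "lambda_poly n z \<longleftrightarrow> (\<forall>m\<in>keys z. keys m \<subseteq> {1..n})"

lemma lambda_poly_add: "lambda_poly n z \<Longrightarrow> lambda_poly n w \<Longrightarrow> lambda_poly n (z + w)"
  using keys_add[of z w] unfolding lambda_poly_def by blast

lemma lambda_poly_zero [simp]: "lambda_poly n 0"
  by (simp add: lambda_poly_def)

lemma lambda_poly_one [simp]: "lambda_poly n 1"
  by (simp add: lambda_poly_def)

lemma lambda_poly_uminus: "lambda_poly n z \<Longrightarrow> lambda_poly n (- z)"
  by (auto simp: lambda_poly_def in_keys_iff)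

lemma lambda_poly_mult: "lambda_poly n z \<Longrightarrow> lambda_poly n w \<Longrightarrow> lambda_poly n (z * w)"
  unfolding lambda_poly_def
proof
  fix m assume z: "\<forall>m\<in>keys z. keys m \<subseteq> {1..n}"
    and w: "\<forall>m\<in>keys w. keys m \<subseteq> {1..n}"
    and "m \<in> keys (z * w)"
  then obtain a b where "m = a + b" "a \<in> keys z" "b \<in> keys w"
    using keys_mult[of z w] by blast
  then show "keys m \<subseteq> {1..n}" using z w keys_add[of a b] by blast
qed

lemma lambda_poly_sum: "(\<And>i. i \<in> I \<Longrightarrow> lambda_poly n (f i)) \<Longrightarrow> lambda_poly n (\<Sum>i\<in>I. f i)"
  by (induction I rule: infinite_finite_induct) (auto intro: lambda_poly_add)

lemma lambda_poly_prod: "(\<And>i. i \<in> I \<Longrightarrow> lambda_poly n (f i)) \<Longrightarrow> lambda_poly n (\<Prod>i\<in>I. f i)"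
  by (induction I rule: infinite_finite_induct) (auto intro: lambda_poly_mult)

lemma lambda_poly_power: "lambda_poly n z \<Longrightarrow> lambda_poly n (z ^ k)"
  by (induction k) (auto intro: lambda_poly_mult)

lemma lambda_poly_mvar: "i \<in> {1..n} \<Longrightarrow> lambda_poly n (mvar i)"
  by (simp add: lambda_poly_def mvar_def)

lemma lambda_poly_mconst: "lambda_poly n (mconst c)"
  by (simp add: lambda_poly_def mconst_def)

lemma lambda_poly_mono: "lambda_poly m z \<Longrightarrow> m \<le> n \<Longrightarrow> lambda_poly n z"
  by (fastforce simp: lambda_poly_def)

lemma lambda_poly_potenziante: "lambda_poly n (potenziante n g)"
  unfolding potenziante_def
  by (intro lambda_poly_sum lambda_poly_mult lambda_poly_prod lambda_poly_power lambda_poly_mvar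
      lambda_poly_mconst) auto

lemma lambda_poly_esym: "lambda_poly n (esym n i)"
  unfolding esym_def by (intro lambda_poly_sum lambda_poly_prod lambda_poly_mvar) auto

lemma mvar_power: "mvar i ^ k = single (single i k) 1"
  by (induction k) (simp_all add: mvar_def mult_single flip: single_add)

lemma prod_mvar_power:
  "(\<Prod>i\<in>I. mvar i ^ e i) = single (\<Sum>i\<in>I. single i (e i)) 1"
  by (induction I rule: infinite_finite_induct) (simp_all add: mvar_power mult_single)

lemma single_as_product:
  "single m p =
    mconst p * (\<Prod>i\<in>keys m. mvar i ^ lookup m i)"
  using poly_mapping_sum_single[of "keys m" m]
  by (simp add: prod_mvar_power mconst_def mult_single)

text \<open>
Replacing $\lambda_n$ by $-(\lambda_1+\cdots+\lambda_{n-1})$ does not change the class modulo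
$\lambda_1+\cdots+\lambda_n$; the elements for which this works form a subring.
\<close>

lemma eliminate_last_variable:
  fixes z :: "'c::comm_ring_1 mpoly"
  assumes n: "n > 0" and z: "lambda_poly n z"
  shows "\<exists>q w. lambda_poly n q \<and> lambda_poly (n - 1) w \<and> z = (\<Sum>i=1..n. mvar i) * q + w"
proof -
  define s :: "'c mpoly" where "s = (\<Sum>i=1..n. mvar i)"
  define R where "R z \<longleftrightarrow> (\<exists>q w. lambda_poly n q \<and> lambda_poly (n - 1) w \<and> z = s * q + w)" for z
  have s: "lambda_poly n s" unfolding s_def by (intro lambda_poly_sum lambda_poly_mvar)
  have low: "R w" if "lambda_poly (n - 1) w" for w
    unfolding R_def by (rule exI[of _ 0], rule exI[of _ w]) (use that in simp)
  have add: "R (y + z)" if y: "R y" and z: "R z" for y z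
  proof -
    obtain q w where y: "lambda_poly n q" "lambda_poly (n - 1) w" "y = s * q + w"
      using y by (auto simp: R_def)
    obtain q' w' where z: "lambda_poly n q'" "lambda_poly (n - 1) w'" "z = s * q' + w'"
      using z by (auto simp: R_def)
    have "y + z = s * (q + q') + (w + w')" using y z by (simp add: algebra_simps)
    then show ?thesis using y(1,2) z(1,2) lambda_poly_add unfolding R_def by blast
  qed
  have mult: "R (y * z)" if y: "R y" and z: "R z" for y z
  proof -
    obtain q w where y: "lambda_poly n q" "lambda_poly (n - 1) w" "y = s * q + w"
      using y by (auto simp: R_def)
    obtain q' w' where z: "lambda_poly n q'" "lambda_poly (n - 1) w'" "z = s * q' + w'"
      using z by (auto simp: R_def)
    have "y * z = s * (q * (s * q' + w') + w * q') + w * w'"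
      using y z by (simp add: algebra_simps)
    moreover have "lambda_poly n (q * (s * q' + w') + w * q')"
      using y z s lambda_poly_mono[of "n - 1" _ n]
      by (intro lambda_poly_add lambda_poly_mult) auto
    ultimately show ?thesis using y(2) z(2) lambda_poly_mult unfolding R_def by blast
  qed
  have var: "R (mvar i)" if i: "i \<in> {1..n}" for i
  proof (cases "i = n")
    case True
    have "lambda_poly (n - 1) (- (\<Sum>i=1..n - 1. mvar i) :: 'c mpoly)"
      by (intro lambda_poly_uminus lambda_poly_sum lambda_poly_mvar)
    moreover have "s = (\<Sum>i=1..n - 1. mvar i) + mvar n"
      using n unfolding s_def by (cases n) auto
    then have "mvar i = s * 1 + - (\<Sum>i=1..n - 1. mvar i)" using True by simp
    ultimately show ?thesis using lambda_poly_one unfolding R_def by blast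
  next
    case False
    then have "i \<in> {1..n - 1}" using i by auto
    then show ?thesis by (intro low lambda_poly_mvar)
  qed
  have one: "R 1" by (rule low) simp
  have power: "R (y ^ k)" if "R y" for y k
    by (induction k) (simp_all add: one mult that)
  have prod: "R (\<Prod>i\<in>I. f i)" if "\<And>i. i \<in> I \<Longrightarrow> R (f i)" for I :: "nat set" and f
    using that by (induction I rule: infinite_finite_induct) (simp_all add: one mult)
  have sum: "R (\<Sum>i\<in>I. f i)" if "\<And>i. i \<in> I \<Longrightarrow> R (f i)" for I :: "monomial set" and f
    using that by (induction I rule: infinite_finite_induct) (simp_all add: low add)
  have "R (single m (lookup z m))" if "m \<in> keys z" for m
    unfolding single_as_product
  proof (intro mult prod power var)
    show "R (mconst (lookup z m))" by (intro low lambda_poly_mconst)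
    show "i \<in> {1..n}" if "i \<in> keys m" for i
      using z that \<open>m \<in> keys z\<close> unfolding lambda_poly_def by blast
  qed
  then have "R (\<Sum>m\<in>keys z. single m (lookup z m))"
    by (rule sum)
  then have "R z" using poly_mapping_sum_single[of "keys z" z] by simp
  then show ?thesis unfolding R_def s_def .
qed

lemma lambda_poly_zero_by_values:
  assumes z: "lambda_poly n z" and zero: "\<And>x. eval_lambda x z = 0"
  shows "z = (0 :: apoly mpoly)"
proof (rule poly_mapping_eqI, rule poly_mapping_eqI)
  fix m a
  have "lookup (lookup z m) a = 0"
  proof (cases "m \<in> keys z")
    case True
    show ?thesis
    proof (rule polynomial_coefficients_zero[of "{1..n}" "keys z" lookup
          "\<lambda>m. lookup (lookup z m) a" m])
      fix k l
      assume kl: "k \<in> keys z" "l \<in> keys z"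
        "\<And>i. i \<in> {1..n} \<Longrightarrow> lookup k i = lookup l i"
      show "k = l"
      proof (rule poly_mapping_eqI)
        fix i
        show "lookup k i = lookup l i"
        proof (cases "i \<in> {1..n}")
          case False
          then have "i \<notin> keys k" "i \<notin> keys l"
            using z kl(1,2) unfolding lambda_poly_def by blast+
          then show ?thesis by (simp add: in_keys_iff)
        qed (rule kl(3))
      qed
    next
      fix x
      have "mono_value x m = (\<Prod>i=1..n. x i ^ lookup m i)"
        if "m \<in> keys z" for m
        using z that unfolding lambda_poly_def by (intro mono_value_extend) auto
      then have "(\<Sum>m\<in>keys z. lookup (lookup z m) a *
          (\<Prod>i=1..n. x i ^ lookup m i)) = lookup (eval_lambda x z) a"
        by (simp add: eval_lambda_def lookup_sum mult.commute)
      then show "(\<Sum>m\<in>keys z. lookup (lookup z m) a *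
          (\<Prod>i=1..n. x i ^ lookup m i)) = 0" using zero[of x] by simp
    qed (use True in auto)
  qed (simp add: in_keys_iff)
  then show "lookup (lookup z m) a =
      lookup (lookup 0 m) a" by simp
qed

text \<open>
This translates the quotient ring in the definition of $U$ to points of the hyperplane: a
representative without $\lambda_n$ that vanishes at all these points vanishes at all values of
$\lambda_1,\ldots,\lambda_{n-1}$, hence is zero.
\<close>

lemma cong_lambda_iff_values:
  assumes n: "n > 0" and z: "lambda_poly n z" and w: "lambda_poly n w"
  shows "cong_lambda n z w \<longleftrightarrow> (\<forall>x\<in>zero_sum n. eval_lambda x z = eval_lambda x w)"
proof
  assume "cong_lambda n z w"
  then obtain q where q: "z - w = (\<Sum>i=1..n. mvar i) * q" by (auto simp: cong_lambda_def)
  show "\<forall>x\<in>zero_sum n. eval_lambda x z = eval_lambda x w"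
  proof
    fix x assume "x \<in> zero_sum n"
    then have "eval_lambda x (\<Sum>i=1..n. mvar i) = 0"
      unfolding eval_lambda_sum eval_lambda_mvar pscale_one_sum by (simp add: zero_sum_def)
    then have "eval_lambda x (z - w) = 0" by (simp add: q eval_lambda_mult)
    then show "eval_lambda x z = eval_lambda x w" by (simp add: eval_lambda_diff)
  qed
next
  assume eq: "\<forall>x\<in>zero_sum n. eval_lambda x z = eval_lambda x w"
  have "lambda_poly n (z - w)" using lambda_poly_add[OF z lambda_poly_uminus[OF w]] by simp
  then obtain q v where q: "lambda_poly n q" and v: "lambda_poly (n - 1) v"
    and zw: "z - w = (\<Sum>i=1..n. mvar i) * q + v"
    using eliminate_last_variable[OF n] by blast
  have "v = 0"
  proof (rule lambda_poly_zero_by_values[OF v])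
    fix y :: "nat \<Rightarrow> complex"
    define x where "x = y(n := - (\<Sum>i=1..n - 1. y i))"
    have "(\<Sum>i=1..n - 1. x i) = (\<Sum>i=1..n - 1. y i)" using n by (intro sum.cong) (auto simp: x_def)
    moreover have "(\<Sum>i=1..n. x i) = (\<Sum>i=1..n - 1. x i) + x n" using n by (cases n) auto
    ultimately have sum: "(\<Sum>i=1..n. x i) = 0" by (simp add: x_def)
    then have x: "x \<in> zero_sum n" by (simp add: zero_sum_def)
    have "eval_lambda x (\<Sum>i=1..n. mvar i) = 0"
      unfolding eval_lambda_sum eval_lambda_mvar pscale_one_sum sum by simp
    then have "eval_lambda x v = eval_lambda x (z - w)"
      unfolding zw by (simp add: eval_lambda_add eval_lambda_mult)
    also have "\<dots> = 0" using eq x by (simp add: eval_lambda_diff)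
    also have "eval_lambda x v = eval_lambda y v"
      unfolding eval_lambda_def
    proof (rule sum.cong[OF refl])
      fix m assume "m \<in> keys v"
      then have "keys m \<subseteq> {1..n - 1}" using v by (auto simp: lambda_poly_def)
      then have "mono_value x m = mono_value y m"
        unfolding mono_value_def using n by (intro prod.cong) (auto simp: x_def)
      then show "pscale (mono_value x m) (lookup v m) =
          pscale (mono_value y m) (lookup v m)" by simp
    qed
    finally show "eval_lambda y v = 0" .
  qed
  then show "cong_lambda n z w" using q zw unfolding cong_lambda_def lambda_poly_def by auto
qed


section \<open>The elements U\<close>

lemma apoly_part_iff:
  "p \<in> apoly_part n g \<longleftrightarrow> (\<forall>m\<in>keys p. mono_degree m = n \<and> mono_weight m = g)"
proof
  let ?S = "{p. \<forall>m\<in>keys p. mono_degree m = n \<and> mono_weight m = g}"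
  assume "p \<in> apoly_part n g"
  moreover have "apoly_part n g \<subseteq> ?S"
    unfolding apoly_part_def
  proof (rule apoly.span_minimal)
    show "apoly_subspace ?S"
    proof (rule apoly.subspaceI)
      show "p + q \<in> ?S" if "p \<in> ?S" "q \<in> ?S" for p q using that keys_add[of p q] by blast
      show "pscale c p \<in> ?S" if "p \<in> ?S" for c p using that by (auto simp: in_keys_iff)
    qed simp
  qed auto
  ultimately show "\<forall>m\<in>keys p. mono_degree m = n \<and> mono_weight m = g" by blast
next
  assume *: "\<forall>m\<in>keys p. mono_degree m = n \<and> mono_weight m = g"
  have "(\<Sum>m\<in>keys p. single m (lookup p m)) \<in> apoly_part n g"
    unfolding apoly_part_def
  proof (rule apoly.span_sum)
    fix m assume "m \<in> keys p"
    then have "single m (1::complex) \<in>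
        {single m 1 |m. mono_degree m = n \<and> mono_weight m = g}" using * by blast
    from apoly.span_scale[OF apoly.span_base[OF this], of "lookup p m"]
    show "single m (lookup p m) \<in>
        apoly_span {single m 1 |m. mono_degree m = n \<and> mono_weight m = g}" by simp
  qed
  then show "p \<in> apoly_part n g" using poly_mapping_sum_single[of "keys p" p] by simp
qed

lemma apoly_part_mult:
  assumes "p \<in> apoly_part n g" "q \<in> apoly_part n' g'"
  shows "p * q \<in> apoly_part (n + n') (g + g')"
  using assms keys_mult[of p q] unfolding apoly_part_iff
  by (fastforce simp: mono_degree_add mono_weight_add)

text \<open>
The condition that characterizes the elements $U$, with values on the hyperplane in place of the
congruence.
\<close>

definition U_family :: "nat \<Rightarrow> nat \<Rightarrow> ((nat \<Rightarrow> nat) \<Rightarrow> apoly) \<Rightarrow> bool" where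
  "U_family n g u \<longleftrightarrow> (\<forall>k. k \<notin> U_index n g \<longrightarrow> u k = 0) \<and>
    (\<forall>k\<in>U_index n g. u k \<in> apoly_part n g) \<and>
    (\<forall>x\<in>zero_sum n. pot n g x = (\<Sum>k\<in>U_index n g. pscale (elem_mono 2 n k x) (u k)))"

text \<open>
The coefficient of the potenziante at a fixed monomial in the $a_i$ is a symmetric form in the
$\lambda_i$ and can be expanded.
\<close>

lemma U_family_exists: "\<exists>u. U_family n g u"
proof -
  have "\<exists>c. \<forall>x\<in>zero_sum n. lookup (pot n g x) m =
      (\<Sum>k\<in>U_index n g. c k * elem_mono 2 n k x)" for m
    by (rule symmetric_expansion_on_zero_sum[OF homogeneous_pot[OF functional_lookup]])
      (simp add: symmetric_on_def pot_permuted)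
  then obtain c where c: "\<And>m x. x \<in> zero_sum n \<Longrightarrow> lookup (pot n g x) m =
      (\<Sum>k\<in>U_index n g. c m k * elem_mono 2 n k x)" by metis
  let ?M = "tuple_monomial n ` tuples n g"
  define u where "u k = (if k \<in> U_index n g then \<Sum>m\<in>?M. single m (c m k) else 0)" for k
  have lookup_u: "lookup (u k) m = (if m \<in> ?M \<and> k \<in> U_index n g then c m k else 0)" for k m
    by (auto simp: u_def lookup_sum lookup_single when_def)
  have "u k \<in> apoly_part n g" for k
    unfolding apoly_part_iff using lookup_u[of k]
    by (auto simp: in_keys_iff mono_degree_tuple mono_weight_tuple tuples_def split: if_splits)
  moreover have "pot n g x = (\<Sum>k\<in>U_index n g. pscale (elem_mono 2 n k x) (u k))"
    if x: "x \<in> zero_sum n" for x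
  proof (rule poly_mapping_eqI)
    fix m
    show "lookup (pot n g x) m =
        lookup (\<Sum>k\<in>U_index n g. pscale (elem_mono 2 n k x) (u k)) m"
    proof (cases "m \<in> ?M")
      case True
      then show ?thesis by (simp add: c[OF x] lookup_sum lookup_u mult.commute)
    next
      case False
      then have "lookup (pot n g x) m = 0"
        unfolding pot_def lookup_sum by (intro sum.neutral) (auto simp: lookup_single when_def)
      then show ?thesis using False by (simp add: lookup_sum lookup_u)
    qed
  qed
  moreover have "u k = 0" if "k \<notin> U_index n g" for k using that by (simp add: u_def)
  ultimately show ?thesis unfolding U_family_def by blast
qed

lemma U_family_unique:
  assumes n: "n > 0" and u: "U_family n g u" and v: "U_family n g v"
  shows "u = v"
proof (rule ext, rule poly_mapping_eqI)
  fix k m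
  show "lookup (u k) m = lookup (v k) m"
  proof (cases "k \<in> U_index n g")
    case True
    have "lookup (u k) m - lookup (v k) m = 0"
    proof (rule elem_monos_independent[OF n _ True])
      fix x assume x: "x \<in> zero_sum n"
      have "(\<Sum>k\<in>U_index n g. pscale (elem_mono 2 n k x) (u k)) =
          (\<Sum>k\<in>U_index n g. pscale (elem_mono 2 n k x) (v k))"
        using u v x by (simp add: U_family_def)
      from arg_cong[OF this, of "\<lambda>p. lookup p m"]
      have "(\<Sum>k\<in>U_index n g. lookup (u k) m * elem_mono 2 n k x) =
          (\<Sum>k\<in>U_index n g. lookup (v k) m * elem_mono 2 n k x)"
        by (simp add: lookup_sum mult.commute)
      then show "(\<Sum>k\<in>U_index n g. (lookup (u k) m - lookup (v k) m) *
          elem_mono 2 n k x) = 0"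
        by (simp add: left_diff_distrib sum_subtractf)
    qed
    then show ?thesis by simp
  qed (use u v in \<open>simp add: U_family_def\<close>)
qed

lemma U_family_U_elem:
  assumes n: "n > 0"
  shows "U_family n g (U_elem n g)"
proof -
  have "cong_lambda n (potenziante n g)
      (\<Sum>k\<in>U_index n g. (\<Prod>i=2..n. esym n i ^ k i) * mconst (u k)) \<longleftrightarrow>
    (\<forall>x\<in>zero_sum n. pot n g x = (\<Sum>k\<in>U_index n g. pscale (elem_mono 2 n k x) (u k)))"
    for u
    unfolding eval_lambda_potenziante[symmetric] eval_lambda_U_sum[symmetric]
    by (intro cong_lambda_iff_values[OF n] lambda_poly_potenziante lambda_poly_sum lambda_poly_mult
        lambda_poly_prod lambda_poly_power lambda_poly_esym lambda_poly_mconst)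
  then have "U_elem n g = (THE u. U_family n g u)"
    unfolding U_elem_def U_family_def by simp
  moreover have "\<exists>!u. U_family n g u" using U_family_exists U_family_unique[OF n] by blast
  ultimately show ?thesis by (simp add: theI')
qed

lemma functional_pot_U:
  assumes "n > 0" "functional \<phi>" "x \<in> zero_sum n"
  shows "\<phi> (pot n g x) = (\<Sum>k\<in>U_index n g. \<phi> (U_elem n g k) * elem_mono 2 n k x)"
  using U_family_U_elem[OF assms(1), of g] assms(3)
  by (simp add: U_family_def functional_sum[OF assms(2)] functional_scale[OF assms(2)] mult.commute)

lemma functional_U_zero:
  assumes "n > 0" "functional \<phi>" "\<And>x. x \<in> zero_sum n \<Longrightarrow> \<phi> (pot n g x) = 0"
  shows "\<phi> (U_elem n g k) = 0"
proof (cases "k \<in> U_index n g")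
  case True
  show ?thesis
    by (rule elem_monos_independent[OF assms(1) _ True, where c = "\<lambda>k. \<phi> (U_elem n g k)"])
      (use assms functional_pot_U[OF assms(1,2)] in auto)
next
  case False
  then have "U_elem n g k = 0" using U_family_U_elem[OF assms(1), of g] by (simp add: U_family_def)
  then show ?thesis by (simp add: functional_zero[OF assms(2)])
qed

text \<open>
In particular the elements $U$ are linearly independent: there are enough functionals because
every symmetric form comes from one.
\<close>

lemma functional_with_U_values:
  assumes "n > 0"
  obtains \<phi> where "functional \<phi>" "\<And>k. k \<in> U_index n g \<Longrightarrow> \<phi> (U_elem n g k) = c k"
    "\<And>p n' g'. p \<in> apoly_part n' g' \<Longrightarrow> (n', g') \<noteq> (n, g) \<Longrightarrow> \<phi> p = 0"
proof -
  let ?f = "\<lambda>x. \<Sum>k\<in>U_index n g. c k * elem_mono 2 n k x"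
  have "homogeneous n g ?f"
    by (intro homogeneous_sum homogeneous_scale homogeneous_elem_mono) (simp add: U_index_weighted)
  moreover have "symmetric_on n UNIV ?f" by (simp add: symmetric_on_def elem_mono_permuted)
  ultimately obtain \<phi> where \<phi>: "functional \<phi>" "\<And>x. \<phi> (pot n g x) = ?f x"
    "\<And>p n' g'. p \<in> apoly_part n' g' \<Longrightarrow> (n', g') \<noteq> (n, g) \<Longrightarrow> \<phi> p = 0"
    using symmetric_function_functional by blast
  have "\<phi> (U_elem n g k) = c k" if k: "k \<in> U_index n g" for k
  proof -
    have "\<phi> (U_elem n g k) - c k = 0"
    proof (rule elem_monos_independent[OF assms _ k])
      fix x assume "x \<in> zero_sum n"
      then show "(\<Sum>k\<in>U_index n g. (\<phi> (U_elem n g k) - c k) * elem_mono 2 n k x) = 0"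
        using functional_pot_U[OF assms \<phi>(1), of x g] \<phi>(2)[of x]
        by (simp add: left_diff_distrib sum_subtractf)
    qed
    then show ?thesis by simp
  qed
  with \<phi> show thesis by (intro that)
qed

lemma U_elem_invariant:
  assumes "n > 0"
  shows "U_elem n g k \<in> invariants n g"
proof -
  have "U_elem n g k \<in> apoly_part n g"
    using U_family_U_elem[OF assms, of g]
    by (cases "k \<in> U_index n g") (auto simp: U_family_def apoly_part_iff)
  moreover have "deriv_D (U_elem n g k) = 0"
  proof (rule poly_mapping_eqI)
    fix m
    have "lookup (deriv_D (U_elem n g k)) m = 0"
      by (rule functional_U_zero[OF assms functional_deriv_D[OF functional_lookup]])
        (simp add: deriv_D_pot zero_sum_def)
    then show "lookup (deriv_D (U_elem n g k)) m = lookup 0 m" by simp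
  qed
  ultimately show ?thesis by (simp add: invariants_def)
qed

text \<open>
A functional $\phi$ that kills all elements $U$ has a form vanishing on the hyperplane, hence of the
shape $e_1h$ with $h$ symmetric. If $\psi$ is the functional of $h$, then $\phi=\psi\circ\mathbf D$ on
$\mathbb C[a]_{n,g}$, so $\phi$ kills the kernel of $\mathbf D$.
\<close>

lemma invariants_span_U:
  assumes n: "n > 0" and p: "p \<in> invariants n g"
  shows "p \<in> apoly_span (U_elem n g ` U_index n g)"
proof (rule ccontr)
  assume "p \<notin> apoly_span (U_elem n g ` U_index n g)"
  then obtain \<phi> where \<phi>: "functional \<phi>" "\<And>v. v \<in> U_elem n g ` U_index n g \<Longrightarrow> \<phi> v = 0" "\<phi> p \<noteq> 0"
    by (rule separating_functional) (rule that)
  let ?f = "\<lambda>x. \<phi> (pot n g x)"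
  have sym: "symmetric_on n UNIV ?f" by (simp add: symmetric_on_def pot_permuted)
  have zero: "?f x = 0" if "x \<in> zero_sum n" for x
    using functional_pot_U[OF n \<phi>(1) that] \<phi>(2) by simp
  have "\<exists>q. homogeneous n (g - card {{1..n}}) q \<and> (g < card {{1..n}} \<longrightarrow> q = (\<lambda>x. 0)) \<and>
    (\<forall>x\<in>UNIV. ?f x = (\<Prod>A\<in>{{1..n}}. partial_sum A x) * q x)"
  proof (rule homogeneous_divide_linear_forms[OF _ homogeneous_pot[OF \<phi>(1)]])
    show "linear_subset UNIV" by (simp add: linear_subset_def)
    show "\<exists>v\<in>UNIV. partial_sum A v = (1::complex)" if "A \<in> {{1..n}}" for A
      using that n by (intro bexI[of _ "\<lambda>i. if i = 1 then 1 else 0"]) auto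
  qed (use zero in \<open>auto simp: zero_sum_def\<close>)
  then obtain q where q: "homogeneous n (g - 1) q" "g < 1 \<longrightarrow> q = (\<lambda>x. 0)"
    "\<And>x. ?f x = (\<Sum>i=1..n. x i) * q x" by auto
  have "symmetric_on n UNIV (partial_sum {1..n})"
    unfolding symmetric_on_def
  proof (intro allI impI)
    fix p and x :: "nat \<Rightarrow> complex" assume "p permutes {1..n}"
    from sum.permute[OF this, of x] show "partial_sum {1..n} (x \<circ> p) = partial_sum {1..n} x" by simp
  qed
  from symmetric_quotient[OF q(1) sym this UNIV_I q(3)] obtain h where h: "homogeneous n (g - 1) h"
    "symmetric_on n UNIV h" "q = (\<lambda>x. 0) \<longrightarrow> h = (\<lambda>x. 0)" "\<forall>x\<in>UNIV. ?f x = (\<Sum>i=1..n. x i) * h x"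
    by (elim exE conjE)
  obtain \<psi> where \<psi>: "functional \<psi>" "\<And>x. \<psi> (pot n (g - 1) x) = h x"
    by (rule symmetric_function_functional[OF h(1,2)]) (rule that)
  have "\<phi> p - \<psi> (deriv_D p) = 0"
  proof (rule functional_vanishes_on_part[where \<phi> = "\<lambda>p. \<phi> p - \<psi> (deriv_D p)"])
    show "functional (\<lambda>p. \<phi> p - \<psi> (deriv_D p))"
      using \<phi>(1) functional_deriv_D[OF \<psi>(1)] by (simp add: functional_def algebra_simps)
    show "\<phi> (pot n g x) - \<psi> (deriv_D (pot n g x)) = 0" for x
      using h(3,4) q(2)
      by (cases "g = 0") (auto simp: deriv_D_pot functional_zero[OF \<psi>(1)] functional_scale[OF \<psi>(1)] \<psi>(2)
          simp del: One_nat_def)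
    show "p \<in> apoly_part n g" using p by (simp add: invariants_def)
  qed
  then show False using \<phi>(3) p functional_zero[OF \<psi>(1)] by (simp add: invariants_def)
qed


section \<open>Products of invariants\<close>

lemma pot_cong: "(\<And>i. i \<in> {1..n} \<Longrightarrow> x i = y i) \<Longrightarrow> pot n g x = pot n g y"
  unfolding pot_def by (intro sum.cong arg_cong[of _ _ "single _"] prod.cong) auto

lemma pot_scaled: "pot n g (\<lambda>i. t * x i) = pscale (t ^ g) (pot n g x)"
  unfolding pot_def pscale_sum
  by (intro sum.cong refl)
    (auto simp: tuples_def power_mult_distrib prod.distrib simp flip: power_sum)

lemma functional_times: "functional \<phi> \<Longrightarrow> functional (\<lambda>p. \<phi> (p * q))"
  by (simp add: functional_def distrib_right pscale_mult)

lemma functional_times_left: "functional \<phi> \<Longrightarrow> functional (\<lambda>p. \<phi> (q * p))"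
  by (simp add: functional_def distrib_left pscale_mult)

text \<open>
At a point composed of $ty$ and $z$, with $y$ and $z$ in the two smaller hyperplanes, the
potenziante is a polynomial in $t$ whose coefficients separate the weights $g_1$. The independence of
the monomials in the elementary symmetric functions is then used first for $y$ and then for $z$.
\<close>

lemma functional_U_product_zero:
  assumes \<psi>: "functional \<psi>" and h: "h \<in> {1..<n}"
    and zero: "\<And>x. x \<in> zero_sum n \<Longrightarrow> partial_sum {1..h} x = 0 \<Longrightarrow> \<psi> (pot n g x) = 0"
    and "g\<^sub>1 \<le> g"
  shows "\<psi> (U_elem h g\<^sub>1 k * U_elem (n - h) (g - g\<^sub>1) l) = 0"
proof -
  have pot: "\<psi> (pot h g\<^sub>1 y * pot (n - h) (g - g\<^sub>1) z) = 0"
    if y: "y \<in> zero_sum h" and z: "z \<in> zero_sum (n - h)" for y z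
  proof -
    have "(\<Sum>i\<le>g. \<psi> (pot h i y * pot (n - h) (g - i) z) * t ^ i) = 0" for t
    proof -
      define x where "x i = (if i \<le> h then t * y i else z (i - h))" for i
      have "(\<Sum>i=1..h. x i) = (\<Sum>i=1..h. t * y i)" by (rule sum.cong) (auto simp: x_def)
      then have 1: "(\<Sum>i=1..h. x i) = 0"
        using y by (simp add: zero_sum_def flip: sum_distrib_left)
      have "(\<Sum>i=1..n - h. x (i + h)) = (\<Sum>i=1..n - h. z i)" by (rule sum.cong) (auto simp: x_def)
      then have "x \<in> zero_sum n"
        using z h 1 sum_shifted[of h n x] by (simp add: zero_sum_def)
      then have "\<psi> (pot n g x) = 0" using 1 by (rule zero)
      moreover have "pot h i x = pscale (t ^ i) (pot h i y)" for i
        unfolding pot_scaled[symmetric] by (rule pot_cong) (simp add: x_def)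
      moreover have "pot (n - h) i (\<lambda>i. x (i + h)) = pot (n - h) i z" for i
        by (rule pot_cong) (simp add: x_def)
      ultimately show ?thesis
        using h pot_product[of h n g x]
        by (simp add: pscale_mult functional_sum[OF \<psi>] functional_scale[OF \<psi>] mult.commute)
    qed
    then show ?thesis using assms(4)
      polyfun_eq_0[of "\<lambda>i. \<psi> (pot h i y * pot (n - h) (g - i) z)" g] by blast
  qed
  have "\<psi> (U_elem h g\<^sub>1 k * pot (n - h) (g - g\<^sub>1) z) = 0" if "z \<in> zero_sum (n - h)" for z
    using h that pot by (intro functional_U_zero[OF _ functional_times[OF \<psi>]]) auto
  then show ?thesis
    using h by (intro functional_U_zero[OF _ functional_times_left[OF \<psi>]]) auto
qed

text \<open>
By bilinearity only products of two homogeneous invariants matter, and these are combinations of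
products of elements $U$; products in another component are killed because $\phi$ lives on a single
one.
\<close>

lemma functional_vanishes_on_decomposables:
  assumes \<phi>: "functional \<phi>"
    and part: "\<And>p n' g'. p \<in> apoly_part n' g' \<Longrightarrow> (n', g') \<noteq> (n, g) \<Longrightarrow> \<phi> p = 0"
    and zero: "\<And>h x. h \<in> {1..<n} \<Longrightarrow> x \<in> zero_sum n \<Longrightarrow> partial_sum {1..h} x = 0 \<Longrightarrow>
      \<phi> (pot n g x) = 0"
    and p: "p \<in> inv_ideal_sq"
  shows "\<phi> p = 0"
proof (rule functional_vanishes_on_span[OF \<phi> _ p[unfolded inv_ideal_sq_def]])
  \<comment> \<open>Both factors have positive degree, so $0<h<n$ in the component of degree $n$.\<close>
  have homog: "\<phi> (a * b) = 0"
    if a: "a \<in> invariants h g\<^sub>1" "h \<ge> 1" and b: "b \<in> invariants h' g\<^sub>2" "h' \<ge> 1" for a b h h' g\<^sub>1 g\<^sub>2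
  proof (cases "(h + h', g\<^sub>1 + g\<^sub>2) = (n, g)")
    case False
    then show ?thesis
      using part[OF apoly_part_mult[of a h g\<^sub>1 b h' g\<^sub>2]] a b by (simp add: invariants_def)
  next
    case True
    then have eq: "h' = n - h" "g\<^sub>2 = g - g\<^sub>1" "g\<^sub>1 \<le> g" "h \<in> {1..<n}" using a b by auto
    have "\<phi> (U_elem h g\<^sub>1 k * b) = 0" for k
      by (rule functional_vanishes_on_span[OF functional_times_left[OF \<phi>] _ invariants_span_U[OF _ b(1)]])
        (use eq b(2) functional_U_product_zero[OF \<phi> eq(4) zero eq(3)] in auto)
    then show ?thesis
      by (intro functional_vanishes_on_span[OF functional_times[OF \<phi>] _ invariants_span_U[OF _ a(1)]])
        (use a(2) in auto)
  qed
  fix s assume "s \<in> {p * q |p q. p \<in> inv_ideal \<and> q \<in> inv_ideal}"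
  then obtain a b where s: "s = a * b" "a \<in> inv_ideal" "b \<in> inv_ideal" by blast
  have "\<phi> (a * b) = 0" if a: "a \<in> invariants h g\<^sub>1" "h \<ge> 1" for a h g\<^sub>1
    by (rule functional_vanishes_on_span[OF functional_times_left[OF \<phi>] _ s(3)[unfolded inv_ideal_def]])
      (use homog[OF a] in auto)
  then show "\<phi> s = 0" unfolding s(1)
    by (intro functional_vanishes_on_span[OF functional_times[OF \<phi>] _ s(2)[unfolded inv_ideal_def]])
      auto
qed

text \<open>
That $\mathbf D$ kills the product is seen coefficientwise: the coefficients of $\mathbf D$ are
functionals, and they kill the potenziante on the hyperplane.
\<close>

lemma U_product_invariant:
  assumes h: "h \<in> {1..<n}" and g: "g\<^sub>1 \<le> g"
  shows "U_elem h g\<^sub>1 k * U_elem (n - h) (g - g\<^sub>1) l \<in> inv_ideal_sq \<inter> invariants n g"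
proof -
  let ?p = "U_elem h g\<^sub>1 k" and ?q = "U_elem (n - h) (g - g\<^sub>1) l"
  have pq: "?p \<in> invariants h g\<^sub>1" "?q \<in> invariants (n - h) (g - g\<^sub>1)"
    using h by (auto intro: U_elem_invariant)
  then have "?p \<in> inv_ideal" "?q \<in> inv_ideal"
    unfolding inv_ideal_def using h by (auto intro!: apoly.span_base bexI[of _ h] bexI[of _ "n - h"])
  then have "?p * ?q \<in> inv_ideal_sq" unfolding inv_ideal_sq_def by (intro apoly.span_base) blast
  moreover have "?p * ?q \<in> apoly_part n g"
    using apoly_part_mult[of ?p h g\<^sub>1 ?q "n - h" "g - g\<^sub>1"] pq h g by (simp add: invariants_def)
  moreover have "deriv_D (?p * ?q) = 0"
  proof (rule poly_mapping_eqI)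
    fix m
    have "lookup (deriv_D (?p * ?q)) m = 0"
      by (rule functional_U_product_zero[OF functional_deriv_D[OF functional_lookup] h _ g])
        (simp add: deriv_D_pot zero_sum_def)
    then show "lookup (deriv_D (?p * ?q)) m = lookup 0 m" by simp
  qed
  ultimately show ?thesis by (simp add: invariants_def)
qed

lemma functional_pot_zero_of_decomposables:
  assumes \<phi>: "functional \<phi>" "\<And>p. p \<in> inv_ideal_sq \<inter> invariants n g \<Longrightarrow> \<phi> p = 0"
    and h: "h \<in> {1..<n}" and x: "x \<in> zero_sum n" "partial_sum {1..h} x = 0"
  shows "\<phi> (pot n g x) = 0"
proof -
  let ?y = "\<lambda>i. x (i + h)"
  have H: "x \<in> zero_sum h" "?y \<in> zero_sum (n - h)"
    using x h sum_shifted[of h n x] by (auto simp: zero_sum_def)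
  have "\<phi> (pot h g\<^sub>1 x * pot (n - h) (g - g\<^sub>1) ?y) = 0" if "g\<^sub>1 \<le> g" for g\<^sub>1
  proof -
    have "\<phi> (U_elem h g\<^sub>1 k * pot (n - h) (g - g\<^sub>1) ?y) = 0" for k
      using h H \<phi>(2)[OF U_product_invariant[OF h that]]
      by (subst functional_pot_U[OF _ functional_times_left[OF \<phi>(1)] H(2)]) auto
    then show ?thesis
      using h by (subst functional_pot_U[OF _ functional_times[OF \<phi>(1)] H(1)]) auto
  qed
  then show ?thesis
    using h by (simp add: pot_product[of h n g x] functional_sum[OF \<phi>(1)])
qed


section \<open>Perpetuants\<close>

lemma apoly_subspace_invariants: "apoly_subspace (invariants n g)"
proof (rule apoly.subspaceI)
  have part: "apoly_subspace (apoly_part n g)" unfolding apoly_part_def by (rule apoly.subspace_span)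
  show "0 \<in> invariants n g" using apoly.subspace_0[OF part] by (simp add: invariants_def)
  show "p + q \<in> invariants n g" if "p \<in> invariants n g" "q \<in> invariants n g" for p q
    using that apoly.subspace_add[OF part] by (simp add: invariants_def deriv_D_add)
  show "pscale c p \<in> invariants n g" if "p \<in> invariants n g" for c p
    using that apoly.subspace_scale[OF part] by (simp add: invariants_def deriv_D_scale)
qed

text \<open>
Subtracting the minimal tuple identifies the admissible indices with the exponents of the
cofactors of the product of the subset sums.
\<close>

lemma perpetuant_index_shift:
  assumes \<mu>: "min_tuple n \<in> U_index n d"
  shows "perpetuant_index n g =
    (if d \<le> g then (\<lambda>m i. min_tuple n i + m i) ` U_index n (g - d) else {})"
proof -
  have shift: "d \<le> g \<and> (\<lambda>i. k i - min_tuple n i) \<in> U_index n (g - d) \<and>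
      k = (\<lambda>i. min_tuple n i + (k i - min_tuple n i))" if k: "k \<in> perpetuant_index n g" for k
  proof -
    have eq: "k i = min_tuple n i + (k i - min_tuple n i)" for i
      using k \<mu> by (cases "i \<in> {2..n}") (auto simp: perpetuant_index_def U_index_def)
    have "(\<Sum>i=2..n. i * k i) = (\<Sum>i=2..n. i * (min_tuple n i + (k i - min_tuple n i)))"
      using eq by simp
    also have "\<dots> = (\<Sum>i=2..n. i * min_tuple n i) + (\<Sum>i=2..n. i * (k i - min_tuple n i))"
      by (simp only: distrib_left sum.distrib)
    finally have "g = d + (\<Sum>i=2..n. i * (k i - min_tuple n i))"
      using k \<mu> by (simp add: perpetuant_index_def U_index_def)
    then show ?thesis using eq k by (auto simp: perpetuant_index_def U_index_def)
  qed
  have unshift: "(\<lambda>i. min_tuple n i + m i) \<in> perpetuant_index n g"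
    if "d \<le> g" "m \<in> U_index n (g - d)" for m
    using graded_tuples_add[of "min_tuple n" 2 n d m "g - d"] \<mu> that
    by (simp add: perpetuant_index_def U_index_weighted)
  show ?thesis
  proof (cases "d \<le> g")
    case True
    have "k \<in> (\<lambda>m i. min_tuple n i + m i) ` U_index n (g - d)" if "k \<in> perpetuant_index n g" for k
      using shift[OF that] by (intro image_eqI[of k _ "\<lambda>i. k i - min_tuple n i"]) simp_all
    then show ?thesis using True unshift by auto
  next
    case False
    then show ?thesis using shift by auto
  qed
qed

lemma zero_in_inv_ideal_sq: "0 \<in> inv_ideal_sq"
  unfolding inv_ideal_sq_def by (rule apoly.span_zero)

lemma apoly_subspace_decomposables: "apoly_subspace (inv_ideal_sq \<inter> invariants n g)"
  unfolding inv_ideal_sq_def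
  by (intro apoly.subspace_inter apoly.subspace_span apoly_subspace_invariants)

lemma shifted_leading_coeffs:
  assumes "leading_exponent n d \<omega> q \<mu>" "d \<le> g"
  shows "\<exists>M. \<forall>m\<in>U_index n (g - d).
    leading_coeffs n g \<omega> (\<lambda>x. q x * elem_mono 2 n m x) (\<lambda>i. \<mu> i + m i) (M m)"
proof (rule bchoice, rule ballI)
  fix m assume "m \<in> U_index n (g - d)"
  from leading_exponent_mult[OF assms(1) leading_exponent_elem_mono[OF this]]
  show "\<exists>c. leading_coeffs n g \<omega> (\<lambda>x. q x * elem_mono 2 n m x) (\<lambda>i. \<mu> i + m i) c"
    using assms(2) by (simp add: leading_exponent_def)
qed

text \<open>
Take a heaviest index $k_0=\boldsymbol n+m$ with nonzero coefficient and the functional whose form is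
$Q_ne^m$. It kills the decomposable elements, and it kills the other occurring $U_k$, since
all monomials of $Q_ne^m$ other than $e^{k_0}$ are heavier than $e^{k_0}$.
\<close>

lemma U_independent_mod_decomposables:
  assumes n: "n \<ge> 3" and dec: "(\<Sum>k\<in>perpetuant_index n g. pscale (c k) (U_elem n g k)) \<in> inv_ideal_sq"
    and k: "k \<in> perpetuant_index n g"
  shows "c k = 0"
proof (rule ccontr)
  assume nz: "c k \<noteq> 0"
  let ?Q = "subset_product (proper_sets n)" and ?d = "card (proper_sets n)"
  let ?P = "perpetuant_index n g"
  obtain \<omega> where \<omega>: "leading_exponent n ?d \<omega> ?Q (min_tuple n)"
    using leading_exponent_subset_product[OF n] by blast
  then have \<mu>: "min_tuple n \<in> U_index n ?d" by (auto simp: leading_exponent_def leading_coeffs_def)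
  note P = perpetuant_index_shift[OF \<mu>, of g]
  have dg: "?d \<le> g" using k P by (auto split: if_splits)
  obtain M where M: "\<forall>m\<in>U_index n (g - ?d).
      leading_coeffs n g \<omega> (\<lambda>x. ?Q x * elem_mono 2 n m x) (\<lambda>i. min_tuple n i + m i) (M m)"
    using shifted_leading_coeffs[OF \<omega> dg] by blast
  have P_sub: "?P \<subseteq> U_index n g" by (auto simp: perpetuant_index_def)
  then have fin: "finite ?P" by (rule finite_subset) simp
  let ?N = "{k \<in> ?P. c k \<noteq> 0}"
  have N: "finite ?N" "?N \<noteq> {}" using fin k nz by auto
  obtain k\<^sub>0 where k\<^sub>0: "k\<^sub>0 \<in> ?N" "\<And>k. k \<in> ?N \<Longrightarrow> tuple_order \<omega> n k \<le> tuple_order \<omega> n k\<^sub>0"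
    using obtains_MAX[OF N, of "tuple_order \<omega> n"] N(1)
    by (metis (no_types, lifting) Max_ge finite_imageI imageI)
  obtain m where m: "m \<in> U_index n (g - ?d)" "k\<^sub>0 = (\<lambda>i. min_tuple n i + m i)"
    using k\<^sub>0(1) P dg by auto
  have Mm: "leading_coeffs n g \<omega> (\<lambda>x. ?Q x * elem_mono 2 n m x) k\<^sub>0 (M m)"
    using M m by simp
  have "n > 0" using n by simp
  then obtain \<phi> where \<phi>: "functional \<phi>" "\<And>k. k \<in> U_index n g \<Longrightarrow> \<phi> (U_elem n g k) = M m k"
    "\<And>p n' g'. p \<in> apoly_part n' g' \<Longrightarrow> (n', g') \<noteq> (n, g) \<Longrightarrow> \<phi> p = 0"
    by (rule functional_with_U_values[of n g "M m"]) (rule that)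
  have "\<phi> (\<Sum>k\<in>?P. pscale (c k) (U_elem n g k)) = 0"
  proof (rule functional_vanishes_on_decomposables[OF \<phi>(1,3) _ dec])
    fix h x assume h: "h \<in> {1..<n}" and x: "x \<in> zero_sum n" "partial_sum {1..h} x = 0"
    have "card {1..h} \<noteq> card {1..n}" using h by simp
    then have "{1..h} \<in> proper_sets n" using h by (auto simp: proper_sets_def)
    then have "?Q x = 0" unfolding subset_product_def using x(2) by (intro prod_zero) auto
    moreover have "\<phi> (pot n g x) = ?Q x * elem_mono 2 n m x"
      using functional_pot_U[OF _ \<phi>(1) x(1), of g] Mm x(1) n \<phi>(2)
      by (simp add: leading_coeffs_def)
    ultimately show "\<phi> (pot n g x) = 0" by simp
  qed
  then have "(\<Sum>k\<in>?P. c k * M m k) = 0"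
    using P_sub \<phi>(2) by (simp add: functional_sum[OF \<phi>(1)] functional_scale[OF \<phi>(1)] subset_iff)
  moreover have "(\<Sum>k\<in>?P. c k * M m k) = (\<Sum>k\<in>{k\<^sub>0}. c k * M m k)"
  proof (rule sum.mono_neutral_right)
    show "\<forall>k\<in>?P - {k\<^sub>0}. c k * M m k = 0"
    proof
      fix k assume k: "k \<in> ?P - {k\<^sub>0}"
      show "c k * M m k = 0"
      proof (rule ccontr)
        assume "c k * M m k \<noteq> 0"
        then have "tuple_order \<omega> n k \<le> tuple_order \<omega> n k\<^sub>0" "tuple_order \<omega> n k\<^sub>0 < tuple_order \<omega> n k"
          using k k\<^sub>0(2) Mm P_sub by (auto simp: leading_coeffs_def)
        then show False by simp
      qed
    qed
  qed (use fin k\<^sub>0 in auto)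
  ultimately show False using k\<^sub>0(1) Mm by (simp add: leading_coeffs_def)
qed

text \<open>
Otherwise a functional kills the decomposable elements and the $U_k$ with $k\succeq\boldsymbol n$
but not all invariants. Its form is $Q_n$ times $\sum_mc_me^m$; for a lightest $m$ with $c_m\ne0$ the
monomial $e^{\boldsymbol n+m}$ occurs in no other $Q_ne^{m'}$ with $c_{m'}\ne0$. So the functional
does not vanish at $U_{\boldsymbol n+m}$, a contradiction.
\<close>

lemma invariants_span_perpetuants:
  assumes n: "n \<ge> 3" and p: "p \<in> invariants n g"
  shows "p \<in> apoly_span (U_elem n g ` perpetuant_index n g \<union> (inv_ideal_sq \<inter> invariants n g))"
proof (rule ccontr)
  let ?Q = "subset_product (proper_sets n)" and ?d = "card (proper_sets n)"
  let ?P = "perpetuant_index n g"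
  assume "p \<notin> apoly_span (U_elem n g ` ?P \<union> (inv_ideal_sq \<inter> invariants n g))"
  then obtain \<phi> where \<phi>: "functional \<phi>"
    "\<And>v. v \<in> U_elem n g ` ?P \<union> (inv_ideal_sq \<inter> invariants n g) \<Longrightarrow> \<phi> v = 0" "\<phi> p \<noteq> 0"
    by (rule separating_functional) (rule that)
  obtain \<omega> where \<omega>: "leading_exponent n ?d \<omega> ?Q (min_tuple n)"
    using leading_exponent_subset_product[OF n] by blast
  then have \<mu>: "min_tuple n \<in> U_index n ?d" by (auto simp: leading_exponent_def leading_coeffs_def)
  let ?f = "\<lambda>x. \<phi> (pot n g x)"
  have sym: "symmetric_on n (zero_sum n) ?f" by (simp add: symmetric_on_def pot_permuted)
  have zero: "?f x = 0" if "h \<in> {1..<n}" "x \<in> zero_sum n" "partial_sum {1..h} x = 0" for h x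
    by (rule functional_pot_zero_of_decomposables[OF \<phi>(1) _ that]) (use \<phi>(2) in blast)
  have "\<exists>c. \<forall>x\<in>zero_sum n. ?f x = (if ?d \<le> g
      then \<Sum>m\<in>U_index n (g - ?d). c m * (?Q x * elem_mono 2 n m x) else 0)"
    by (rule divide_by_subset_product[OF n homogeneous_pot[OF \<phi>(1)] sym]) (rule zero)
  then obtain c where c: "\<forall>x\<in>zero_sum n. ?f x = (if ?d \<le> g
      then \<Sum>m\<in>U_index n (g - ?d). c m * (?Q x * elem_mono 2 n m x) else 0)" ..
  have "?f x = 0" if x: "x \<in> zero_sum n" for x
  proof (cases "?d \<le> g")
    case True
    obtain M where M: "\<forall>m\<in>U_index n (g - ?d).
        leading_coeffs n g \<omega> (\<lambda>x. ?Q x * elem_mono 2 n m x) (\<lambda>i. min_tuple n i + m i) (M m)"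
      using shifted_leading_coeffs[OF \<omega> True] by blast
    have vals: "\<phi> (U_elem n g k) = (\<Sum>m\<in>U_index n (g - ?d). c m * M m k)" if k: "k \<in> U_index n g" for k
    proof -
      have "\<phi> (U_elem n g k) - (\<Sum>m\<in>U_index n (g - ?d). c m * M m k) = 0"
      proof (rule elem_monos_independent[OF _ _ k])
        fix x assume x: "x \<in> zero_sum n"
        have "(\<Sum>k\<in>U_index n g. \<phi> (U_elem n g k) * elem_mono 2 n k x) =
            (\<Sum>m\<in>U_index n (g - ?d). c m * (?Q x * elem_mono 2 n m x))"
          using functional_pot_U[OF _ \<phi>(1) x, of g] c x True n by simp
        also have "\<dots> = (\<Sum>m\<in>U_index n (g - ?d). c m *
            (\<Sum>k\<in>U_index n g. M m k * elem_mono 2 n k x))"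
          using M x by (intro sum.cong) (simp_all add: leading_coeffs_def)
        also have "\<dots> = (\<Sum>k\<in>U_index n g. (\<Sum>m\<in>U_index n (g - ?d). c m * M m k) *
            elem_mono 2 n k x)"
          unfolding sum_distrib_left sum_distrib_right
          by (subst sum.swap) (simp add: mult.assoc)
        finally show "(\<Sum>k\<in>U_index n g. (\<phi> (U_elem n g k) -
            (\<Sum>m\<in>U_index n (g - ?d). c m * M m k)) * elem_mono 2 n k x) = 0"
          by (simp add: left_diff_distrib sum_subtractf)
      qed (use n in simp)
      then show ?thesis by simp
    qed
    have "c m = 0" if m: "m \<in> U_index n (g - ?d)" for m
    proof (rule ccontr)
      assume nz: "c m \<noteq> 0"
      let ?N = "{m \<in> U_index n (g - ?d). c m \<noteq> 0}"
      have N: "finite ?N" "?N \<noteq> {}" using m nz by auto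
      obtain m\<^sub>0 where m\<^sub>0: "m\<^sub>0 \<in> ?N" "\<And>m. m \<in> ?N \<Longrightarrow> tuple_order \<omega> n m\<^sub>0 \<le> tuple_order \<omega> n m"
        using obtains_MIN[OF N, of "tuple_order \<omega> n"] N(1)
        by (metis (no_types, lifting) Min_le finite_imageI imageI)
      define k where "k = (\<lambda>i. min_tuple n i + m\<^sub>0 i)"
      have k: "k \<in> ?P" using perpetuant_index_shift[OF \<mu>, of g] True m\<^sub>0(1) by (auto simp: k_def)
      then have kU: "k \<in> U_index n g" by (simp add: perpetuant_index_def)
      have "(\<Sum>m\<in>U_index n (g - ?d). c m * M m k) = (\<Sum>m\<in>{m\<^sub>0}. c m * M m k)"
      proof (rule sum.mono_neutral_right)
        show "\<forall>m\<in>U_index n (g - ?d) - {m\<^sub>0}. c m * M m k = 0"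
        proof
          fix m assume m: "m \<in> U_index n (g - ?d) - {m\<^sub>0}"
          show "c m * M m k = 0"
          proof (rule ccontr)
            assume nz: "c m * M m k \<noteq> 0"
            have "k \<noteq> (\<lambda>i. min_tuple n i + m i)"
            proof
              assume "k = (\<lambda>i. min_tuple n i + m i)"
              then have "m = m\<^sub>0" unfolding k_def by (simp add: fun_eq_iff)
              then show False using m by simp
            qed
            then have "tuple_order \<omega> n (\<lambda>i. min_tuple n i + m i) < tuple_order \<omega> n k"
              using M m nz kU by (simp add: leading_coeffs_def)
            moreover have "tuple_order \<omega> n m\<^sub>0 \<le> tuple_order \<omega> n m" using m\<^sub>0(2) m nz by simp
            ultimately show False by (simp add: k_def tuple_order_add)
          qed
        qed
      qed (use m\<^sub>0 in auto)
      moreover have "\<phi> (U_elem n g k) = 0" using \<phi>(2) k by blast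
      moreover have "M m\<^sub>0 k \<noteq> 0" using M m\<^sub>0(1) by (simp add: leading_coeffs_def k_def)
      ultimately show False using vals[OF kU] m\<^sub>0(1) by simp
    qed
    then show ?thesis using c x by simp
  qed (use c x in simp)
  then have U0: "\<phi> (U_elem n g k) = 0" for k
    using n by (intro functional_U_zero[OF _ \<phi>(1)]) auto
  have "\<phi> p = 0"
    by (rule functional_vanishes_on_span[OF \<phi>(1) _ invariants_span_U[OF _ p]]) (use U0 n in auto)
  then show False using \<phi>(3) by simp
qed

theorem theorem3p9:
  fixes n g :: nat
  assumes "n \<ge> 3"
  shows "\<exists>P. perpetuant_space n g P \<and>
           inj_on (U_elem n g) (perpetuant_index n g) \<and>
           \<not> apoly_dependent (U_elem n g ` perpetuant_index n g) \<and>
           apoly_span (U_elem n g ` perpetuant_index n g) = P"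
proof -
  let ?U = "U_elem n g" and ?I = "perpetuant_index n g"
  let ?P = "apoly_span (?U ` ?I)" and ?D = "inv_ideal_sq \<inter> invariants n g"
  have fin: "finite ?I" by (rule finite_subset[of _ "U_index n g"]) (auto simp: perpetuant_index_def)
  note ind = U_independent_mod_decomposables[OF assms]
  have inj: "inj_on ?U ?I"
  proof (rule inj_onI, rule ccontr)
    fix k l assume kl: "k \<in> ?I" "l \<in> ?I" "?U k = ?U l" "k \<noteq> l"
    \<comment> \<open>A coincidence of two elements is a linear relation with coefficients $1$ and $-1$.\<close>
    let ?c = "\<lambda>j. (if j = k then 1 else 0) - (if j = l then 1 else 0 :: complex)"
    have "pscale (?c j) (?U j) = (if j = k then ?U j else 0) - (if j = l then ?U j else 0)" for j
      using kl(4) by (auto intro!: poly_mapping_eqI simp: lookup_minus)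
    then have "(\<Sum>j\<in>?I. pscale (?c j) (?U j)) = 0"
      using fin kl by (simp add: sum_subtractf)
    then have "?c k = 0" using ind[of ?c g k] kl(1) zero_in_inv_ideal_sq by simp
    then show False using kl(4) by simp
  qed
  have coefficients: "\<forall>v\<in>?U ` ?I. a v = 0" if "(\<Sum>v\<in>?U ` ?I. pscale (a v) v) \<in> inv_ideal_sq" for a
  proof -
    have "(\<Sum>k\<in>?I. pscale (a (?U k)) (?U k)) \<in> inv_ideal_sq"
      using that inj by (simp add: sum.reindex)
    then show ?thesis using ind[of "\<lambda>k. a (?U k)"] by blast
  qed
  have "\<not> apoly_dependent (?U ` ?I)"
  proof (rule apoly.independent_if_scalars_zero)
    show "a v = 0" if "(\<Sum>v\<in>?U ` ?I. pscale (a v) v) = 0" "v \<in> ?U ` ?I" for a v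
    proof -
      have "(\<Sum>v\<in>?U ` ?I. pscale (a v) v) \<in> inv_ideal_sq"
        using that(1) zero_in_inv_ideal_sq by simp
      from coefficients[OF this] that(2) show ?thesis by blast
    qed
  qed (use fin in simp)
  moreover have "perpetuant_space n g ?P"
    unfolding perpetuant_space_def
  proof (intro conjI)
    show "apoly_subspace ?P" by (rule apoly.subspace_span)
    show sub: "?P \<subseteq> invariants n g"
      using assms by (intro apoly.span_minimal apoly_subspace_invariants) (auto intro: U_elem_invariant)
    show "?P \<inter> ?D = {0}"
    proof
      show "?P \<inter> ?D \<subseteq> {0}"
      proof
        fix p assume p: "p \<in> ?P \<inter> ?D"
        then obtain a where a: "p = (\<Sum>v\<in>?U ` ?I. pscale (a v) v)"
          using apoly.span_finite[of "?U ` ?I"] fin by auto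
        then have "\<forall>v\<in>?U ` ?I. a v = 0" using coefficients p by blast
        then have "p = 0" unfolding a by (intro sum.neutral) auto
        then show "p \<in> {0}" by simp
      qed
      show "{0} \<subseteq> ?P \<inter> ?D"
        using apoly.span_zero apoly.subspace_0[OF apoly_subspace_decomposables] by blast
    qed
    show "{p + q |p q. p \<in> ?P \<and> q \<in> ?D} = invariants n g"
    proof
      show "{p + q |p q. p \<in> ?P \<and> q \<in> ?D} \<subseteq> invariants n g"
        using sub apoly.subspace_add[OF apoly_subspace_invariants] by blast
      show "invariants n g \<subseteq> {p + q |p q. p \<in> ?P \<and> q \<in> ?D}"
      proof
        fix p assume "p \<in> invariants n g"
        then have "p \<in> apoly_span (?U ` ?I \<union> ?D)" by (rule invariants_span_perpetuants[OF assms])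
        moreover have "apoly_span ?D = ?D"
          using apoly.span_eq_iff apoly_subspace_decomposables by blast
        ultimately show "p \<in> {p + q |p q. p \<in> ?P \<and> q \<in> ?D}"
          unfolding apoly.span_Un by simp
      qed
    qed
  qed
  ultimately show ?thesis using inj by blast
qed

end
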